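(* Let $\theta\in(0,1)$ be irrational, let $h:\mathbb{R}\to\mathbb{R}$ be even, smooth and exponentially decaying, let $\mathbb{P}_0$ be a compactly supported Borel probability measure on $\mathbb{R}$, and let $H_R(b,\omega_1,\omega_2)$ be the random incommensurate coupled chain operators on $\ell^2(\mathbb{Z})\oplus\ell^2(\mathbb{Z})$, with truncations $H_{R,L}(b,\omega_1,\omega_2)=1_{\Lambda_L}H_R(b,\omega_1,\omega_2)1_{\Lambda_L}$, $L>0$ (see context). Suppose that, for almost every $(b,\omega_1,\omega_2)$ and all $L>0$, the difference $H_{R,L}(b,\omega_1,\omega_2)-1_{\Lambda_L}H_R(b,\omega_1,\omega_2)$ is trace-class and $$\operatorname{tr}\left|H_{R,L}(b,\omega_1,\omega_2)-1_{\Lambda_L}H_R(b,\omega_1,\omega_2)\right|\le\epsilon(L)\,|\Lambda_L|$$ with $\epsilon(L)\to0$ as $L\to\infty$. Then for almost all $(b,\omega_1,\omega_2)\in\mathbb{R}\times\mathbb{R}^{\mathbb{Z}}\times\mathbb{R}^{\mathbb{Z}}$ with respect to the product measure, and all $g\in C_0(\mathbb{R})$, as $L\to\infty$, $$\frac{1}{|\Lambda_L|}\left(\sum_{x\in\Lambda_L^1}\langle\delta_{1x},g(H_{R,L}(b,\omega_1,\omega_2))\delta_{1x}\rangle+\sum_{x\in\Lambda_L^2}\langle\delta_{2x},g(H_{R,L}(b,\omega_1,\omega_2))\delta_{2x}\rangle\right)$$ converges to $$\frac{1-\theta}{1+(1-\theta)}\int_{[0,1-\theta)\times\mathbb{R}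^{\mathbb{Z}}\times\mathbb{R}^{\mathbb{Z}}}\langle\delta_{10},g(H_R(b',\omega_1',\omega_2'))\delta_{10}\rangle\,\mathrm{d}\mathbb{P}_{R,2}+\frac{1}{1+(1-\theta)}\int_{[0,1)\times\mathbb{R}^{\mathbb{Z}}\times\mathbb{R}^{\mathbb{Z}}}\langle\delta_{20},g(H_R(b',\omega_1',\omega_2'))\delta_{20}\rangle\,\mathrm{d}\mathbb{P}_{R,1}.$$
   Context: Elements of $\ell^2(\mathbb{Z})\oplus\ell^2(\mathbb{Z})$ are written $\psi=(\psi_1,\psi_2)$, $\psi_i=(\psi_{in})_{n\in\mathbb{Z}}$, with the natural inner product. $(\Delta\phi)_n:=\phi_{n+1}-2\phi_n+\phi_{n-1}$. Exponentially decaying means $|h(\eta)|\le Ce^{-c|\eta|}$ for some $C,c>0$. Let $\mathbb{P}$ be the product probability measure of copies of $\mathbb{P}_0$ on $\mathbb{R}^{\mathbb{Z}}$ with the product Borel $\sigma$-algebra. For $b\in\mathbb{R}$ and $\omega_i=(\omega_{ij})_{j\in\mathbb{Z}}\in\mathbb{R}^{\mathbb{Z}}$, $i\in\{1,2\}$, the random incommensurate coupled chain operator is the self-adjoint operator $$(H_R(b,\omega_1,\omega_2)\psi)_{1n}=-(\Delta\psi_1)_n+\omega_{1n}\psi_{1n}+\sum_{n'\in\mathbb{Z}}h(n-(1-\theta)n'-b)\psi_{2n'},$$ $$(H_R(b,\omega_1,\omega_2)\psi)_{2n}=-(\Delta\psi_2)_n+\omega_{2n}\psi_{2n}+\sum_{n'\in\mathbb{Z}}h((1-\theta)n+b-n')\psi_{1n'}.$$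 (Since $\mathbb{P}_0$ is compactly supported, almost surely all $\omega_{ij}$ lie in a fixed compact set and the operator is bounded, uniformly; for other $\omega_1,\omega_2$ it is taken on its maximal domain.) For $b\in\mathbb{R}$, $L>0$: $\Lambda_L^1:=\mathbb{Z}\cap[-L,L]$, $\Lambda_L^2:=\mathbb{Z}\cap\left[\frac{-L-b}{1-\theta},\frac{L-b}{1-\theta}\right]$, $|\Lambda_L|:=|\Lambda_L^1|+|\Lambda_L^2|$ (cardinalities). The projection $1_{\Lambda_L}$ sets $\psi_{1n}$ to $0$ for $n\notin\Lambda_L^1$ and $\psi_{2n}$ to $0$ for $n\notin\Lambda_L^2$, leaving other entries unchanged. $\delta_{ix}$ is the vector with entry $1$ at site $x$ of layer $i$ and $0$ elsewhere. $C_0(\mathbb{R})$ is the space of continuous functions vanishing at infinity. The product measure on $\mathbb{R}\times\mathbb{R}^{\mathbb{Z}}\times\mathbb{R}^{\mathbb{Z}}$ is Lebesgue measure times $\mathbb{P}\times\mathbb{P}$. $\mathbb{P}_{R,2}$ (resp. $\mathbb{P}_{R,1}$) is the product of normalized Lebesgue measure on $[0,1-\theta)$ (resp. $[0,1)$) with $\mathbb{P}\times\mathbb{P}$. *)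

theory Defs
  imports "HOL-Probability.Probability"
begin

section \<open>The Hilbert space\<close>

definition square_summable :: "(int \<Rightarrow> complex) \<Rightarrow> bool" where
  "square_summable \<phi> \<longleftrightarrow> (\<lambda>n. (cmod (\<phi> n))\<^sup>2) summable_on UNIV"

lemma square_summable_0: "square_summable (\<lambda>_. 0)"
  by (simp add: square_summable_def)

lemma square_summable_mult:
  assumes "square_summable \<phi>"
  shows "square_summable (\<lambda>n. c * \<phi> n)"
  using summable_on_cmult_right[of "\<lambda>n. (cmod (\<phi> n))\<^sup>2" UNIV "(cmod c)\<^sup>2"] assms
  by (simp add: square_summable_def norm_mult power_mult_distrib)

lemma square_summable_add:
  assumes "square_summable \<phi>" "square_summable \<psi>"
  shows "square_summable (\<lambda>n. \<phi> n + \<psi> n)"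
  unfolding square_summable_def
proof (rule summable_on_comparison_test)
  show "(\<lambda>n. 2 * (cmod (\<phi> n))\<^sup>2 + 2 * (cmod (\<psi> n))\<^sup>2) summable_on UNIV"
    using assms unfolding square_summable_def
    by (intro summable_on_add summable_on_cmult_right) auto
  fix n
  have "(cmod (\<phi> n + \<psi> n))\<^sup>2 \<le> (cmod (\<phi> n) + cmod (\<psi> n))\<^sup>2"
    by (simp add: norm_triangle_ineq power_mono)
  also have "\<dots> \<le> 2 * (cmod (\<phi> n))\<^sup>2 + 2 * (cmod (\<psi> n))\<^sup>2"
    using zero_le_power2[of "cmod (\<phi> n) - cmod (\<psi> n)"]
    by (simp add: power2_sum power2_diff)
  finally show "(cmod (\<phi> n + \<psi> n))\<^sup>2 \<le> 2 * (cmod (\<phi> n))\<^sup>2 + 2 * (cmod (\<psi> n))\<^sup>2" .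
qed simp_all

lemma square_summable_uminus:
  "square_summable \<phi> \<Longrightarrow> square_summable (\<lambda>n. - \<phi> n)"
  by (simp add: square_summable_def)

lemma square_summable_diff:
  "square_summable \<phi> \<Longrightarrow> square_summable \<psi> \<Longrightarrow> square_summable (\<lambda>n. \<phi> n - \<psi> n)"
  using square_summable_add[of \<phi> "\<lambda>n. - \<psi> n"] square_summable_uminus[of \<psi>] by simp

lemma square_summable_restrict:
  "square_summable \<phi> \<Longrightarrow> square_summable (\<lambda>n. if n \<in> A then \<phi> n else 0)"
  unfolding square_summable_def
  by (rule summable_on_comparison_test) auto

lemma square_summable_single:
  "square_summable (\<lambda>m. if m = n then c else 0)"
  unfolding square_summable_def
  by (rule finite_nonzero_values_imp_summable_on, rule finite_subset[of _ "{n}"]) auto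

text \<open>\<open>\<ell>\<^sup>2(\<int>)\<close> with complex scalars; \<open>entry \<phi> n\<close> is the n-th entry of \<open>\<phi>\<close>.\<close>

typedef ell2 = "{\<phi>. square_summable \<phi>}"
  morphisms entry Abs_ell2
  using square_summable_0 by blast

setup_lifting type_definition_ell2

lemma square_summable_entry: "square_summable (entry \<phi>)"
  using entry by blast

lemma entry_summable_mult:
  "(\<lambda>n. cmod (entry \<phi> n) * cmod (entry \<psi> n)) summable_on UNIV"
proof (rule summable_on_comparison_test)
  show "(\<lambda>n. (cmod (entry \<phi> n))\<^sup>2 + (cmod (entry \<psi> n))\<^sup>2) summable_on UNIV"
    using square_summable_entry unfolding square_summable_def
    by (intro summable_on_add) auto
  fix n
  show "cmod (entry \<phi> n) * cmod (entry \<psi> n) \<le> (cmod (entry \<phi> n))\<^sup>2 + (cmod (entry \<psi> n))\<^sup>2"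
    using zero_le_power2[of "cmod (entry \<phi> n) - cmod (entry \<psi> n)"]
      mult_nonneg_nonneg[OF norm_ge_zero[of "entry \<phi> n"] norm_ge_zero[of "entry \<psi> n"]]
    unfolding power2_diff by linarith
qed simp_all

lemma entry_inner_summable:
  "(\<lambda>n. entry \<phi> n \<bullet> entry \<psi> n) summable_on UNIV"
  by (rule abs_summable_summable, rule Infinite_Sum.abs_summable_on_comparison_test'[OF entry_summable_mult[of \<phi> \<psi>]])
     (simp add: Cauchy_Schwarz_ineq2)

instantiation ell2 :: real_inner
begin

lift_definition zero_ell2 :: ell2 is "\<lambda>_. 0" by (rule square_summable_0)
lift_definition plus_ell2 :: "ell2 \<Rightarrow> ell2 \<Rightarrow> ell2" is "\<lambda>\<phi> \<psi> n. \<phi> n + \<psi> n"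
  by (rule square_summable_add)
lift_definition minus_ell2 :: "ell2 \<Rightarrow> ell2 \<Rightarrow> ell2" is "\<lambda>\<phi> \<psi> n. \<phi> n - \<psi> n"
  by (rule square_summable_diff)
lift_definition uminus_ell2 :: "ell2 \<Rightarrow> ell2" is "\<lambda>\<phi> n. - \<phi> n"
  by (rule square_summable_uminus)
lift_definition scaleR_ell2 :: "real \<Rightarrow> ell2 \<Rightarrow> ell2" is "\<lambda>r \<phi> n. complex_of_real r * \<phi> n"
  by (rule square_summable_mult)

text \<open>The real inner product is the real part of the complex one, \<open>cinner\<close> below;
  both induce the same norm.\<close>

definition inner_ell2 :: "ell2 \<Rightarrow> ell2 \<Rightarrow> real" where
  "inner_ell2 \<phi> \<psi> = (\<Sum>\<^sub>\<infinity>n. entry \<phi> n \<bullet> entry \<psi> n)"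
definition norm_ell2 :: "ell2 \<Rightarrow> real" where
  "norm_ell2 \<phi> = sqrt (\<phi> \<bullet> \<phi>)"
definition dist_ell2 :: "ell2 \<Rightarrow> ell2 \<Rightarrow> real" where
  "dist_ell2 \<phi> \<psi> = norm (\<phi> - \<psi>)"
definition sgn_ell2 :: "ell2 \<Rightarrow> ell2" where
  "sgn_ell2 \<phi> = inverse (norm \<phi>) *\<^sub>R \<phi>"
definition uniformity_ell2 :: "(ell2 \<times> ell2) filter" where
  "uniformity_ell2 = (INF e\<in>{0<..}. principal {(x, y). dist x y < e})"
definition open_ell2 :: "ell2 set \<Rightarrow> bool" where
  "open_ell2 U \<longleftrightarrow> (\<forall>x\<in>U. eventually (\<lambda>(x', y). x' = x \<longrightarrow> y \<in> U) uniformity)"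

instance
proof
  fix x y z :: ell2 and r s :: real and U :: "ell2 set"
  show "x + y + z = x + (y + z)" by transfer (simp add: add.assoc)
  show "x + y = y + x" by transfer (simp add: add.commute)
  show "0 + x = x" by transfer simp
  show "- x + x = 0" by transfer simp
  show "x - y = x + - y" by transfer simp
  show "r *\<^sub>R (x + y) = r *\<^sub>R x + r *\<^sub>R y" by transfer (simp add: algebra_simps)
  show "(r + s) *\<^sub>R x = r *\<^sub>R x + s *\<^sub>R x" by transfer (simp add: algebra_simps)
  show "r *\<^sub>R s *\<^sub>R x = (r * s) *\<^sub>R x" by transfer (simp add: algebra_simps)
  show "1 *\<^sub>R x = x" by transfer simp
  show "dist x y = norm (x - y)" by (rule dist_ell2_def)
  show "sgn x = inverse (norm x) *\<^sub>R x" by (rule sgn_ell2_def)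
  show "uniformity = (INF e\<in>{0<..}. principal {(x, y). dist x (y::ell2) < e})"
    by (rule uniformity_ell2_def)
  show "open U \<longleftrightarrow> (\<forall>x\<in>U. eventually (\<lambda>(x', y). x' = x \<longrightarrow> y \<in> U) uniformity)"
    by (rule open_ell2_def)
  show "x \<bullet> y = y \<bullet> x"
    by (simp add: inner_ell2_def inner_commute)
  show "(x + y) \<bullet> z = x \<bullet> z + y \<bullet> z"
    by (simp add: inner_ell2_def plus_ell2.rep_eq inner_add_left infsum_add entry_inner_summable)
  have "entry (r *\<^sub>R x) n \<bullet> entry y n = r * (entry x n \<bullet> entry y n)" for n
    by (simp add: scaleR_ell2.rep_eq flip: scaleR_conv_of_real)
  then show "r *\<^sub>R x \<bullet> y = r * (x \<bullet> y)"
    by (simp add: inner_ell2_def infsum_cmult_right entry_inner_summable)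
  show "0 \<le> x \<bullet> x"
    by (simp add: inner_ell2_def infsum_nonneg)
  show "x \<bullet> x = 0 \<longleftrightarrow> x = 0"
  proof
    assume "x \<bullet> x = 0"
    then have "entry x n \<bullet> entry x n = 0" for n
      using nonneg_infsum_le_0D[of "\<lambda>n. entry x n \<bullet> entry x n" UNIV n] entry_inner_summable[of x x]
      by (simp add: inner_ell2_def)
    then show "x = 0" by (simp add: entry_inject[symmetric] zero_ell2.rep_eq fun_eq_iff)
  qed (simp add: inner_ell2_def zero_ell2.rep_eq)
  show "norm x = sqrt (x \<bullet> x)" by (rule norm_ell2_def)
qed

end

text \<open>\<open>\<ell>\<^sup>2(\<int>) \<oplus> \<ell>\<^sup>2(\<int>)\<close>: the norm is
  \<open>sqrt (\<parallel>\<psi>\<^sub>1\<parallel>\<^sup>2 + \<parallel>\<psi>\<^sub>2\<parallel>\<^sup>2)\<close>, from the library instance for products.\<close>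

type_synonym state = "ell2 \<times> ell2"

definition cinner :: "state \<Rightarrow> state \<Rightarrow> complex" where
  "cinner \<phi> \<psi> = (\<Sum>\<^sub>\<infinity>n. cnj (entry (fst \<phi>) n) * entry (fst \<psi>) n)
               + (\<Sum>\<^sub>\<infinity>n. cnj (entry (snd \<phi>) n) * entry (snd \<psi>) n)"

lift_definition scaleC_ell2 :: "complex \<Rightarrow> ell2 \<Rightarrow> ell2" is "\<lambda>c \<phi> n. c * \<phi> n"
  by (rule square_summable_mult)

definition scaleC :: "complex \<Rightarrow> state \<Rightarrow> state" (infixr \<open>*\<^sub>C\<close> 75) where
  "c *\<^sub>C \<psi> = (scaleC_ell2 c (fst \<psi>), scaleC_ell2 c (snd \<psi>))"

lift_definition delta :: "int \<Rightarrow> ell2" is "\<lambda>n m. if m = n then 1 else 0"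
  by (rule square_summable_single)

definition delta1 :: "int \<Rightarrow> state" where "delta1 x = (delta x, 0)"
definition delta2 :: "int \<Rightarrow> state" where "delta2 x = (0, delta x)"

section \<open>Operators\<close>

definition bounded_clinear :: "(state \<Rightarrow> state) \<Rightarrow> bool" where
  "bounded_clinear B \<longleftrightarrow> bounded_linear B \<and> (\<forall>c \<psi>. B (c *\<^sub>C \<psi>) = c *\<^sub>C B \<psi>)"

text \<open>Possibly unbounded operators are partial maps; the domain of \<open>A\<close> is \<open>dom A\<close>.
  Products with a bounded operator and differences have their natural domains.\<close>

type_synonym operator = "state \<rightharpoonup> state"

definition lmult :: "(state \<Rightarrow> state) \<Rightarrow> operator \<Rightarrow> operator" where
  "lmult B A = (\<lambda>\<psi>. map_option B (A \<psi>))"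

definition rmult :: "operator \<Rightarrow> (state \<Rightarrow> state) \<Rightarrow> operator" where
  "rmult A B = (\<lambda>\<psi>. A (B \<psi>))"

definition op_diff :: "operator \<Rightarrow> operator \<Rightarrow> operator" where
  "op_diff A B = (\<lambda>\<psi>. case (A \<psi>, B \<psi>) of (Some u, Some v) \<Rightarrow> Some (u - v) | _ \<Rightarrow> None)"

subsection \<open>Trace class\<close>

definition cadjoint :: "(state \<Rightarrow> state) \<Rightarrow> (state \<Rightarrow> state)" where
  "cadjoint B = (THE C. \<forall>\<phi> \<psi>. cinner (C \<phi>) \<psi> = cinner \<phi> (B \<psi>))"

definition positive_op :: "(state \<Rightarrow> state) \<Rightarrow> bool" where
  "positive_op B \<longleftrightarrow> bounded_clinear B \<and> (\<forall>\<psi>. cinner \<psi> (B \<psi>) \<in> \<real>\<^sub>\<ge>\<^sub>0)"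

definition abs_op :: "(state \<Rightarrow> state) \<Rightarrow> (state \<Rightarrow> state)" where
  "abs_op B = (THE Q. positive_op Q \<and> Q \<circ> Q = cadjoint B \<circ> B)"

definition trace :: "(state \<Rightarrow> state) \<Rightarrow> complex" where
  "trace B = (\<Sum>\<^sub>\<infinity>n. cinner (delta1 n) (B (delta1 n))) + (\<Sum>\<^sub>\<infinity>n. cinner (delta2 n) (B (delta2 n)))"

text \<open>A trace-class operator is in particular everywhere defined and bounded.\<close>

definition trace_class :: "operator \<Rightarrow> bool" where
  "trace_class T \<longleftrightarrow> (\<exists>B. T = (\<lambda>\<psi>. Some (B \<psi>)) \<and> bounded_clinear B
     \<and> (\<lambda>n. cinner (delta1 n) (abs_op B (delta1 n))) summable_on UNIV
     \<and> (\<lambda>n. cinner (delta2 n) (abs_op B (delta2 n))) summable_on UNIV)"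

definition trace_norm :: "operator \<Rightarrow> real" where
  "trace_norm T = Re (trace (abs_op (\<lambda>\<psi>. the (T \<psi>))))"

subsection \<open>Functional calculus\<close>

definition C0 :: "(real \<Rightarrow> complex) set" where
  "C0 = {g. continuous_on UNIV g \<and> (g \<longlongrightarrow> 0) at_infinity}"

text \<open>\<open>R = (A - z)\<^sup>-\<^sup>1\<close>\<close>

definition is_resolvent :: "operator \<Rightarrow> complex \<Rightarrow> (state \<Rightarrow> state) \<Rightarrow> bool" where
  "is_resolvent A z R \<longleftrightarrow> bounded_clinear R
     \<and> (\<forall>\<phi>. \<exists>u. A (R \<phi>) = Some u \<and> u - z *\<^sub>C R \<phi> = \<phi>)
     \<and> (\<forall>\<psi> u. A \<psi> = Some u \<longrightarrow> R (u - z *\<^sub>C \<psi>) = \<psi>)"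

text \<open>The continuous functional calculus of a (bounded or unbounded) self-adjoint operator \<open>A\<close> is the
  *-homomorphism from \<open>C\<^sub>0(\<real>)\<close> to the bounded operators that maps \<open>x \<mapsto> 1 / (x - z)\<close> to the
  resolvent \<open>(A - z)\<^sup>-\<^sup>1\<close> for all non-real \<open>z\<close>. It exists by the spectral theorem. It is unique on
  \<open>C\<^sub>0(\<real>)\<close> by the Stone-Weierstrass theorem, as such homomorphisms are contractive.\<close>

definition C0_calculus :: "operator \<Rightarrow> ((real \<Rightarrow> complex) \<Rightarrow> (state \<Rightarrow> state)) \<Rightarrow> bool" where
  "C0_calculus A \<Phi> \<longleftrightarrow>
     (\<forall>f\<in>C0. bounded_clinear (\<Phi> f))
     \<and> (\<forall>f\<in>C0. \<forall>g\<in>C0. \<forall>\<psi>. \<Phi> (\<lambda>x. f x + g x) \<psi> = \<Phi> f \<psi> + \<Phi> g \<psi>)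
     \<and> (\<forall>c. \<forall>f\<in>C0. \<forall>\<psi>. \<Phi> (\<lambda>x. c * f x) \<psi> = c *\<^sub>C \<Phi> f \<psi>)
     \<and> (\<forall>f\<in>C0. \<forall>g\<in>C0. \<forall>\<psi>. \<Phi> (\<lambda>x. f x * g x) \<psi> = \<Phi> f (\<Phi> g \<psi>))
     \<and> (\<forall>f\<in>C0. \<forall>\<phi> \<psi>. cinner \<phi> (\<Phi> (\<lambda>x. cnj (f x)) \<psi>) = cinner (\<Phi> f \<phi>) \<psi>)
     \<and> (\<forall>z. Im z \<noteq> 0 \<longrightarrow> is_resolvent A z (\<Phi> (\<lambda>x. 1 / (complex_of_real x - z))))"

definition fun_of_op :: "(real \<Rightarrow> complex) \<Rightarrow> operator \<Rightarrow> (state \<Rightarrow> state)" where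
  "fun_of_op g A = (THE B. \<exists>\<Phi>. C0_calculus A \<Phi> \<and> B = \<Phi> g)"

section \<open>The random incommensurate coupled chain\<close>

definition laplacian :: "(int \<Rightarrow> complex) \<Rightarrow> int \<Rightarrow> complex" where
  "laplacian \<phi> n = \<phi> (n + 1) - 2 * \<phi> n + \<phi> (n - 1)"

definition H_action1 ::
  "real \<Rightarrow> (real \<Rightarrow> real) \<Rightarrow> real \<Rightarrow> (int \<Rightarrow> real) \<Rightarrow> state \<Rightarrow> int \<Rightarrow> complex" where
  "H_action1 \<theta> h b \<omega>\<^sub>1 \<psi> n =
     - laplacian (entry (fst \<psi>)) n + complex_of_real (\<omega>\<^sub>1 n) * entry (fst \<psi>) n
     + (\<Sum>\<^sub>\<infinity>n'. complex_of_real (h (real_of_int n - (1 - \<theta>) * real_of_int n' - b)) * entry (snd \<psi>) n')"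

definition H_action2 ::
  "real \<Rightarrow> (real \<Rightarrow> real) \<Rightarrow> real \<Rightarrow> (int \<Rightarrow> real) \<Rightarrow> state \<Rightarrow> int \<Rightarrow> complex" where
  "H_action2 \<theta> h b \<omega>\<^sub>2 \<psi> n =
     - laplacian (entry (snd \<psi>)) n + complex_of_real (\<omega>\<^sub>2 n) * entry (snd \<psi>) n
     + (\<Sum>\<^sub>\<infinity>n'. complex_of_real (h ((1 - \<theta>) * real_of_int n + b - real_of_int n')) * entry (fst \<psi>) n')"

text \<open>The operator on its maximal domain; it is everywhere defined when \<open>\<omega>\<^sub>1\<close> and \<open>\<omega>\<^sub>2\<close> are bounded.\<close>

definition H_R ::
  "real \<Rightarrow> (real \<Rightarrow> real) \<Rightarrow> real \<times> (int \<Rightarrow> real) \<times> (int \<Rightarrow> real) \<Rightarrow> operator" where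
  "H_R \<theta> h = (\<lambda>(b, \<omega>\<^sub>1, \<omega>\<^sub>2) \<psi>.
     if square_summable (H_action1 \<theta> h b \<omega>\<^sub>1 \<psi>) \<and> square_summable (H_action2 \<theta> h b \<omega>\<^sub>2 \<psi>)
     then Some (Abs_ell2 (H_action1 \<theta> h b \<omega>\<^sub>1 \<psi>), Abs_ell2 (H_action2 \<theta> h b \<omega>\<^sub>2 \<psi>))
     else None)"

definition Lambda1 :: "real \<Rightarrow> int set" where
  "Lambda1 L = {n. real_of_int n \<in> {- L..L}}"

definition Lambda2 :: "real \<Rightarrow> real \<Rightarrow> real \<Rightarrow> int set" where
  "Lambda2 \<theta> b L = {n. real_of_int n \<in> {(- L - b) / (1 - \<theta>)..(L - b) / (1 - \<theta>)}}"

definition card_Lambda :: "real \<Rightarrow> real \<Rightarrow> real \<Rightarrow> nat" where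
  "card_Lambda \<theta> b L = card (Lambda1 L) + card (Lambda2 \<theta> b L)"

lift_definition restrict_ell2 :: "int set \<Rightarrow> ell2 \<Rightarrow> ell2" is "\<lambda>A \<phi> n. if n \<in> A then \<phi> n else 0"
  by (rule square_summable_restrict)

definition proj_Lambda :: "real \<Rightarrow> real \<Rightarrow> real \<Rightarrow> state \<Rightarrow> state" where
  "proj_Lambda \<theta> b L \<psi> = (restrict_ell2 (Lambda1 L) (fst \<psi>), restrict_ell2 (Lambda2 \<theta> b L) (snd \<psi>))"

definition H_RL ::
  "real \<Rightarrow> (real \<Rightarrow> real) \<Rightarrow> real \<Rightarrow> real \<times> (int \<Rightarrow> real) \<times> (int \<Rightarrow> real) \<Rightarrow> operator" where
  "H_RL \<theta> h L x = lmult (proj_Lambda \<theta> (fst x) L) (rmult (H_R \<theta> h x) (proj_Lambda \<theta> (fst x) L))"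

definition truncation_error ::
  "real \<Rightarrow> (real \<Rightarrow> real) \<Rightarrow> real \<Rightarrow> real \<times> (int \<Rightarrow> real) \<times> (int \<Rightarrow> real) \<Rightarrow> operator" where
  "truncation_error \<theta> h L x = op_diff (H_RL \<theta> h L x) (lmult (proj_Lambda \<theta> (fst x) L) (H_R \<theta> h x))"

definition local_trace_average ::
  "real \<Rightarrow> (real \<Rightarrow> real) \<Rightarrow> (real \<Rightarrow> complex) \<Rightarrow> real \<times> (int \<Rightarrow> real) \<times> (int \<Rightarrow> real) \<Rightarrow> real \<Rightarrow> complex"
where
  "local_trace_average \<theta> h g x L =
     ((\<Sum>n\<in>Lambda1 L. cinner (delta1 n) (fun_of_op g (H_RL \<theta> h L x) (delta1 n)))
      + (\<Sum>n\<in>Lambda2 \<theta> (fst x) L. cinner (delta2 n) (fun_of_op g (H_RL \<theta> h L x) (delta2 n))))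
     / of_nat (card_Lambda \<theta> (fst x) L)"

section \<open>Probability and regularity\<close>

definition disorder_measure :: "real measure \<Rightarrow> (int \<Rightarrow> real) measure" where
  "disorder_measure P0 = (\<Pi>\<^sub>M j\<in>UNIV. P0)"

definition parameter_measure :: "real measure \<Rightarrow> (real \<times> (int \<Rightarrow> real) \<times> (int \<Rightarrow> real)) measure" where
  "parameter_measure P0 = lborel \<Otimes>\<^sub>M (disorder_measure P0 \<Otimes>\<^sub>M disorder_measure P0)"

text \<open>Normalized Lebesgue measure on \<open>[0, a)\<close> times the law of the disorder. The completion lets the
  Bochner integral be applied to functions determined only almost everywhere; it does not change the
  integral of a function that is measurable for the product sigma-algebra.\<close>

definition shift_measure ::
  "real \<Rightarrow> real measure \<Rightarrow> (real \<times> (int \<Rightarrow> real) \<times> (int \<Rightarrow> real)) measure" where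
  "shift_measure a P0 =
     completion (uniform_measure lborel {0..<a} \<Otimes>\<^sub>M (disorder_measure P0 \<Otimes>\<^sub>M disorder_measure P0))"

definition smooth :: "(real \<Rightarrow> real) \<Rightarrow> bool" where
  "smooth h \<longleftrightarrow> (\<forall>k x. (deriv ^^ k) h field_differentiable at x)"

definition exponentially_decaying :: "(real \<Rightarrow> real) \<Rightarrow> bool" where
  "exponentially_decaying h \<longleftrightarrow> (\<exists>C>0. \<exists>c>0. \<forall>\<eta>. \<bar>h \<eta>\<bar> \<le> C * exp (- c * \<bar>\<eta>\<bar>))"

end

theory Submission
  imports Defs "HOL-Computational_Algebra.Fundamental_Theorem_Algebra" "HOL-Library.Discrete_Functions"
begin

text \<open>
  The disorder is almost surely bounded, so all operators are uniformly bounded and a continuous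
  function of them is uniformly approximated by a polynomial; cutting off \<open>h\<close> at a large distance
  changes them by little in norm. This reduces the theorem to moments \<open>\<langle>\<delta>\<^sub>x, H\<^sup>k \<delta>\<^sub>x\<rangle>\<close> of an operator of finite
  range. These depend on finitely many \<open>\<omega>\<^sub>i\<^sub>j\<close> only, and truncation does not affect them except at a bounded
  number of boundary sites. For fixed \<open>b\<close>, the strong law of large numbers replaces the moments by
  their expectations, which by translation covariance are the values of one continuous periodic function of
  the offset along an irrational rotation; equidistribution gives the integral over the offset.
\<close>

section \<open>Polynomials of a symmetric operator\<close>

text \<open>The limit is claimed for all \<open>g\<close> outside one null set, so that set is fixed
  before any \<open>g\<close> appears: \<open>generic\<close> demands convergence of the moment
  averages for every power, both layers and every cutoff radius, which are countably many
  conditions. Since \<open>fun_of_op\<close> is a definite description, its values are accessible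
  only after existence and uniqueness of the calculus. Existence rests on bounding the norm of p(A)
  by the supremum of |p| on [-M, M]; this comes without spectral theory, from sum-of-squares
  certificates for positive polynomials. One \<open>M\<close> serves the operator, its truncations
  and all its cutoffs, because a cutoff never increases |h|; hence one polynomial approximates at
  all sites and scales at once. At fixed offset the moments along a layer are neither independent
  nor identically distributed: their means wander with the site. So the fluctuations are averaged by
  decorrelation at a distance, the means by rotation. This works for every offset, and joint
  measurability then gives almost every triple.\<close>

definition poly_op :: "('a::real_vector \<Rightarrow> 'a) \<Rightarrow> real poly \<Rightarrow> 'a \<Rightarrow> 'a" where
  "poly_op A p x = (\<Sum>k\<le>degree p. coeff p k *\<^sub>R (A ^^ k) x)"

lemma poly_op_eq_sum:
  assumes "degree p \<le> N"
  shows "poly_op A p x = (\<Sum>k\<le>N. coeff p k *\<^sub>R (A ^^ k) x)"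
  unfolding poly_op_def
  by (rule sum.mono_neutral_left) (use assms in \<open>auto intro: coeff_eq_0\<close>)

lemma poly_op_0: "poly_op A 0 x = 0"
  by (simp add: poly_op_def)

lemma poly_op_pCons:
  assumes "linear A"
  shows "poly_op A (pCons a p) x = a *\<^sub>R x + A (poly_op A p x)"
proof -
  interpret linear A by fact
  have "poly_op A (pCons a p) x = (\<Sum>k\<le>Suc (degree p). coeff (pCons a p) k *\<^sub>R (A ^^ k) x)"
    by (rule poly_op_eq_sum) (rule degree_pCons_le)
  also have "\<dots> = a *\<^sub>R x + (\<Sum>k\<le>degree p. coeff p k *\<^sub>R A ((A ^^ k) x))"
    by (subst sum.atMost_Suc_shift) simp
  finally show ?thesis
    by (simp add: poly_op_def sum scale)
qed

lemma poly_op_const: "poly_op A [:a:] x = a *\<^sub>R x"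
  by (simp add: poly_op_def)

lemma poly_op_add: "poly_op A (p + q) x = poly_op A p x + poly_op A q x"
proof -
  let ?N = "max (degree p) (degree q)"
  have "degree (p + q) \<le> ?N" by (rule degree_add_le_max)
  then show ?thesis
    by (simp add: poly_op_eq_sum[of _ ?N] scaleR_add_left sum.distrib)
qed

lemma poly_op_smult: "poly_op A (smult a p) x = a *\<^sub>R poly_op A p x"
  by (simp add: poly_op_eq_sum[of "smult a p" "degree p"] poly_op_def scaleR_sum_right)

lemma poly_op_diff: "poly_op A (p - q) x = poly_op A p x - poly_op A q x"
  using poly_op_add[of A p "smult (-1) q" x] by (simp only: poly_op_smult) simp

lemma linear_poly_op:
  assumes "linear A"
  shows "linear (poly_op A p)"
proof (induction p)
  case 0
  show ?case by (simp add: poly_op_0[abs_def] linear_0 Real_Vector_Spaces.linear_iff)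
next
  case (pCons a p)
  then show ?case using assms
    by (simp add: Real_Vector_Spaces.linear_iff poly_op_pCons algebra_simps)
qed

lemma poly_op_mult:
  assumes "linear A"
  shows "poly_op A (p * q) x = poly_op A p (poly_op A q x)"
proof (induction p)
  case 0
  show ?case by (simp add: poly_op_0)
next
  case (pCons a p)
  then show ?case using assms
    by (simp add: poly_op_pCons poly_op_add poly_op_smult)
qed

lemma poly_op_commute:
  assumes "linear A"
  shows "poly_op A p (poly_op A q x) = poly_op A q (poly_op A p x)"
  by (metis poly_op_mult[OF assms] mult.commute)

lemma poly_op_intertwine:
  assumes "linear A" "linear J" "\<And>x. J (A x) = A (J x)"
  shows "J (poly_op A p x) = poly_op A p (J x)"
proof (induction p)
  case 0
  show ?case using linear_0[OF assms(2)] by (simp add: poly_op_0)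
next
  case (pCons a p)
  then show ?case
    using assms by (simp add: poly_op_pCons linear_add linear_scale)
qed

text \<open>The certificates \<open>\<sigma>\<^sub>0 + (M\<^sup>2 - t\<^sup>2) \<sigma>\<^sub>1\<close>, with sums of squares \<open>\<sigma>\<^sub>0\<close> and \<open>\<sigma>\<^sub>1\<close>, of nonnegativity on \<open>[-M, M]\<close>.\<close>

inductive pos_cert :: "real \<Rightarrow> real poly \<Rightarrow> bool" for M where
  square: "pos_cert M (p * p)"
| weighted: "pos_cert M ([:M\<^sup>2, 0, -1:] * (p * p))"
| add: "pos_cert M p \<Longrightarrow> pos_cert M q \<Longrightarrow> pos_cert M (p + q)"

lemma pos_cert_mult_square: "pos_cert M q \<Longrightarrow> pos_cert M (p * p * q)"
proof (induction rule: pos_cert.induct)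
  case (square r)
  have "p * p * (r * r) = (p * r) * (p * r)" by (simp add: ac_simps)
  then show ?case using pos_cert.square by metis
next
  case (weighted r)
  have "p * p * ([:M\<^sup>2, 0, -1:] * (r * r)) = [:M\<^sup>2, 0, -1:] * ((p * r) * (p * r))"
    by (simp only: ac_simps)
  then show ?case using pos_cert.weighted by metis
next
  case (add q r)
  then show ?case by (simp add: distrib_left pos_cert.add)
qed

text \<open>The weight times a weighted square is again a plain square, so products of weights need
  no third kind of certificate. This is what closes the certificates under multiplication.\<close>

lemma pos_cert_mult_weight: "pos_cert M q \<Longrightarrow> pos_cert M ([:M\<^sup>2, 0, -1:] * q)"
proof (induction rule: pos_cert.induct)
  case (square r)
  show ?case by (rule pos_cert.weighted)
next
  case (weighted r)
  let ?w = "[:M\<^sup>2, 0, -1:]"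
  have "?w * (?w * (r * r)) = (?w * r) * (?w * r)"
    by (simp only: ac_simps)
  then show ?case using pos_cert.square by metis
next
  case (add q r)
  then show ?case by (simp only: distrib_left pos_cert.add)
qed

lemma pos_cert_mult: "pos_cert M p \<Longrightarrow> pos_cert M q \<Longrightarrow> pos_cert M (p * q)"
proof (induction rule: pos_cert.induct)
  case (square p)
  then show ?case by (rule pos_cert_mult_square)
next
  case (weighted p)
  then show ?case
    using pos_cert_mult_weight[OF pos_cert_mult_square[of M q p]] by (simp only: mult.assoc)
next
  case (add p r)
  then show ?case by (simp only: distrib_right pos_cert.add)
qed

lemma pos_cert_const: "0 \<le> c \<Longrightarrow> pos_cert M [:c:]"
  using pos_cert.square[of M "[:sqrt c:]"] by simp

lemma pos_cert_smult: "0 \<le> c \<Longrightarrow> pos_cert M p \<Longrightarrow> pos_cert M (smult c p)"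
  using pos_cert_mult[OF pos_cert_const] by fastforce

text \<open>Because \<open>(M + t)^2 + (M^2 - t^2) = 2 M (M + t)\<close>, the factor
  \<open>M + t\<close> has a certificate; a root further to the left only adds the constant
  \<open>- a - M\<close>. The mirror image of this identity treats roots to the right.\<close>

lemma pos_cert_left:
  assumes "0 < M" "a \<le> - M"
  shows "pos_cert M [:- a, 1:]"
proof -
  have "[:M, 1:] = smult (1 / (2 * M)) ([:M, 1:] * [:M, 1:] + [:M\<^sup>2, 0, -1:] * (1 * 1))"
    using assms by (simp add: field_simps power2_eq_square)
  then have "pos_cert M [:M, 1:]"
    using assms pos_cert_smult[OF _ pos_cert.add[OF pos_cert.square pos_cert.weighted[of M 1]], of "1 / (2 * M)"]
    by (metis divide_nonneg_pos less_eq_real_def mult_pos_pos zero_less_numeral zero_le_one)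
  then have "pos_cert M ([:- a - M:] + [:M, 1:])"
    using assms by (intro pos_cert.add pos_cert_const) auto
  then show ?thesis by simp
qed

lemma pos_cert_right:
  assumes "0 < M" "M \<le> a"
  shows "pos_cert M [:a, -1:]"
proof -
  have "[:M, -1:] = smult (1 / (2 * M)) ([:M, -1:] * [:M, -1:] + [:M\<^sup>2, 0, -1:] * (1 * 1))"
    using assms by (simp add: field_simps power2_eq_square)
  then have "pos_cert M [:M, -1:]"
    using assms pos_cert_smult[OF _ pos_cert.add[OF pos_cert.square pos_cert.weighted[of M 1]], of "1 / (2 * M)"]
    by (metis divide_nonneg_pos less_eq_real_def mult_pos_pos zero_less_numeral zero_le_one)
  then have "pos_cert M ([:a - M:] + [:M, -1:])"
    using assms by (intro pos_cert.add pos_cert_const) auto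
  then show ?thesis by simp
qed

section \<open>Complex roots of real polynomials and certificates of positivity\<close>

lemma poly_map_of_real_add:
  "poly (map_poly of_real (p + q)) z = poly (map_poly of_real p) z + (poly (map_poly of_real q) z :: complex)"
proof -
  have "map_poly of_real (p + q) = map_poly of_real p + (map_poly of_real q :: complex poly)"
    by (intro poly_eqI) (simp add: coeff_map_poly)
  then show ?thesis by simp
qed

lemma poly_map_of_real_mult:
  "poly (map_poly of_real (p * q)) z = poly (map_poly of_real p) z * (poly (map_poly of_real q) z :: complex)"
  by (induction p) (simp_all add: map_poly_pCons poly_map_of_real_add map_poly_smult algebra_simps)

lemma poly_map_of_real_of_real:
  "poly (map_poly of_real p) (of_real t) = complex_of_real (poly p t)"
  by (induction p) (simp_all add: map_poly_pCons)

text \<open>The remainder modulo the real quadratic with roots \<open>z\<close> and its conjugate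
  has degree at most 1 and real coefficients, and a real linear polynomial can vanish at a non-real
  point only if it is 0.\<close>

lemma real_poly_conj_root_dvd:
  fixes p :: "real poly"
  assumes root: "poly (map_poly of_real p) z = (0::complex)" and im: "Im z \<noteq> 0"
  shows "[:(Re z)\<^sup>2 + (Im z)\<^sup>2, - 2 * Re z, 1:] dvd p"
proof -
  define d where "d = [:(Re z)\<^sup>2 + (Im z)\<^sup>2, - 2 * Re z, 1:]"
  have deg: "degree d = 2" by (simp add: d_def)
  have "poly (map_poly of_real d) z = of_real ((Re z)\<^sup>2 + (Im z)\<^sup>2) + z * (of_real (- 2 * Re z) + z)"
    by (simp add: d_def map_poly_pCons)
  also have "\<dots> = 0"
    by (simp add: complex_eq_iff power2_eq_square algebra_simps)
  finally have dz: "poly (map_poly of_real d) z = 0" .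
  define r where "r = p mod d"
  have "degree r < 2 \<or> r = 0"
    using degree_mod_less[of d p] deg by (force simp: r_def)
  then have degr: "degree r \<le> 1" by auto
  have "p = d * (p div d) + r" by (simp add: r_def)
  then have "0 = poly (map_poly of_real d) z * poly (map_poly of_real (p div d)) z + poly (map_poly of_real r) z"
    using root by (metis poly_map_of_real_add poly_map_of_real_mult)
  then have rz: "poly (map_poly of_real r) z = 0"
    using dz by simp
  have "r = [:coeff r 0, coeff r 1:]"
    using degr by (intro poly_eqI) (auto simp: coeff_pCons coeff_eq_0 split: nat.split)
  then obtain c0 c1 where r: "r = [:c0, c1:]" by blast
  have "of_real c0 + z * of_real c1 = 0"
    using rz by (simp add: r map_poly_pCons)
  then have "c1 = 0" "c0 = 0"
    using im by (auto simp: complex_eq_iff)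
  then have "r = 0" by (simp add: r)
  then show ?thesis by (simp add: r_def d_def mod_eq_0_iff_dvd)
qed

text \<open>Induction on the degree, splitting off the factor of one complex root. Strict positivity
  keeps real roots outside the interval, so a linear factor has constant sign on it; a conjugate
  pair gives \<open>(t - Re z)^2 + (Im z)^2\<close>. Up to sign the cofactor is then again positive
  on the interval.\<close>

lemma pos_cert_of_positive:
  assumes M: "0 < M"
  shows "(\<And>t. t \<in> {-M..M} \<Longrightarrow> 0 < poly p t) \<Longrightarrow> pos_cert M p"
proof (induction "degree p" arbitrary: p rule: less_induct)
  case less
  have M_in: "M \<in> {-M..M}" using M by auto
  show ?case
  proof (cases "degree p = 0")
    case True
    then obtain c where p: "p = [:c:]" by (metis degree_0_id)
    have "0 < c" using less.prems[OF M_in] by (simp add: p)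
    then show ?thesis by (simp add: p pos_cert_const)
  next
    case False
    have "\<not> constant (poly (map_poly of_real p :: complex poly))"
      using False by (simp add: constant_degree degree_map_poly)
    then obtain z where z: "poly (map_poly of_real p :: complex poly) z = 0"
      using fundamental_theorem_of_algebra by blast
    show ?thesis
    proof (cases "Im z = 0")
      case True
      define a where "a = Re z"
      have za: "z = of_real a" using True by (simp add: a_def complex_eq_iff)
      have pa: "poly p a = 0" using z unfolding za by (simp add: poly_map_of_real_of_real)
      then obtain q where q: "p = [:- a, 1:] * q"
        by (metis dvdE poly_eq_0_iff_dvd)
      have q0: "q \<noteq> 0" using False q by auto
      have deg: "degree p = Suc (degree q)"
        unfolding q using q0 by (subst degree_mult_eq) auto
      have "a \<notin> {-M..M}" using less.prems pa by force
      then consider "a < - M" | "M < a" by fastforce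
      then show ?thesis
      proof cases
        case 1
        have "pos_cert M q"
        proof (rule less.hyps)
          fix t assume t: "t \<in> {-M..M}"
          then have "0 < (t - a) * poly q t" "0 < t - a"
            using less.prems[OF t] 1 by (auto simp: q algebra_simps)
          then show "0 < poly q t" by (simp add: zero_less_mult_iff)
        qed (simp add: deg)
        then show ?thesis unfolding q using 1 M by (intro pos_cert_mult pos_cert_left) auto
      next
        case 2
        have "pos_cert M (- q)"
        proof (rule less.hyps)
          fix t assume t: "t \<in> {-M..M}"
          then have "0 < (t - a) * poly q t" "t - a < 0"
            using less.prems[OF t] 2 by (auto simp: q algebra_simps)
          then show "0 < poly (- q) t" by (simp add: zero_less_mult_iff)
        qed (simp add: deg)
        moreover have "p = [:a, -1:] * (- q)" by (simp add: q)
        ultimately show ?thesis using 2 M by (metis pos_cert_mult pos_cert_right less_imp_le)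
      qed
    next
      case False
      define d where "d = [:(Re z)\<^sup>2 + (Im z)\<^sup>2, - 2 * Re z, 1:]"
      obtain q where q: "p = d * q"
        using real_poly_conj_root_dvd[OF z False] by (auto simp: d_def)
      have d: "d = [:- Re z, 1:] * [:- Re z, 1:] + [:(Im z)\<^sup>2:]"
        by (simp add: d_def power2_eq_square)
      have cd: "pos_cert M d"
        unfolding d by (intro pos_cert.add pos_cert.square pos_cert_const) simp
      have pd: "0 < poly d t" for t
      proof -
        have "poly d t = (t - Re z)\<^sup>2 + (Im z)\<^sup>2"
          unfolding d by (simp add: power2_eq_square algebra_simps)
        then show ?thesis using False by (simp add: add_nonneg_pos)
      qed
      have q0: "q \<noteq> 0" using \<open>degree p \<noteq> 0\<close> q by auto
      have deg: "degree p = 2 + degree q"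
        unfolding q using q0 by (subst degree_mult_eq) (auto simp: d_def)
      have "pos_cert M q"
      proof (rule less.hyps)
        fix t assume t: "t \<in> {-M..M}"
        have "0 < poly d t * poly q t" using less.prems[OF t] by (simp add: q)
        then show "0 < poly q t" using pd[of t] by (simp add: zero_less_mult_iff)
      qed (simp add: deg)
      then show ?thesis unfolding q using cd by (rule pos_cert_mult[rotated])
    qed
  qed
qed

section \<open>Continuous functional calculus\<close>

lemma real_polynomial_approx:
  fixes f :: "real \<Rightarrow> real"
  assumes "continuous_on {a..b} f" "0 < e"
  obtains p :: "real poly" where "\<And>t. t \<in> {a..b} \<Longrightarrow> \<bar>f t - poly p t\<bar> \<le> e"
proof -
  obtain g where g: "real_polynomial_function g" "\<And>x. x \<in> {a..b} \<Longrightarrow> \<bar>f x - g x\<bar> < e"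
    using Stone_Weierstrass_real_polynomial_function[OF compact_Icc assms] by blast
  then obtain c n where gs: "g = (\<lambda>x. \<Sum>i\<le>n. c i * x ^ i)"
    by (auto simp: real_polynomial_function_iff_sum)
  define p where "p = (\<Sum>i\<le>n. monom (c i) i)"
  have "poly p x = g x" for x
    by (simp add: p_def gs poly_sum poly_monom)
  with g(2) show ?thesis by (intro that[of p]) force
qed

lemma continuous_on_interval_bounded:
  fixes f :: "real \<Rightarrow> real"
  assumes "continuous_on {a..b} f"
  obtains s where "\<And>t. t \<in> {a..b} \<Longrightarrow> \<bar>f t\<bar> \<le> s"
proof -
  have "bounded (f ` {a..b})"
    by (intro compact_imp_bounded compact_continuous_image assms compact_Icc)
  then obtain s where "\<forall>y\<in>f ` {a..b}. norm y \<le> s" unfolding bounded_iff by blast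
  then show ?thesis by (intro that[of s]) auto
qed

lemma real_polynomial_sequence:
  fixes f :: "real \<Rightarrow> real"
  assumes f: "continuous_on {a..b} f"
  obtains p s where "\<And>n t. t \<in> {a..b} \<Longrightarrow> \<bar>f t - poly (p n) t\<bar> \<le> s n" "s \<longlonglongrightarrow> (0::real)"
proof -
  have "\<exists>q. \<forall>t\<in>{a..b}. \<bar>f t - poly q t\<bar> \<le> 1 / real (Suc n)" for n
    using real_polynomial_approx[OF f, of "1 / real (Suc n)"] by (metis zero_less_divide_1_iff of_nat_0_less_iff zero_less_Suc)
  then obtain p where "\<And>n t. t \<in> {a..b} \<Longrightarrow> \<bar>f t - poly (p n) t\<bar> \<le> 1 / real (Suc n)"
    by metis
  then show ?thesis using LIMSEQ_Suc[OF lim_1_over_n] by (rule that)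
qed

text \<open>The calculus is first built for real functions over a real inner product. On
  \<open>state\<close> this product is the real part of the complex one; complex functions are
  assembled later from real and imaginary parts.\<close>

locale symmetric_operator =
  fixes A :: "'a::{real_inner, banach} \<Rightarrow> 'a" and M :: real
  assumes lin: "linear A"
    and sym: "A x \<bullet> y = x \<bullet> A y"
    and M_pos: "0 < M"
    and norm_le: "norm (A x) \<le> M * norm x"
begin

lemma poly_op_sym: "poly_op A p x \<bullet> y = x \<bullet> poly_op A p y"
proof (induction p arbitrary: x y)
  case (pCons a p)
  then show ?case
    by (simp add: poly_op_pCons[OF lin] inner_add_left inner_add_right sym
        flip: poly_op_intertwine[OF lin lin])
qed (simp add: poly_op_0)

text \<open>Symmetry turns \<open>p * p\<close> into the squared norm of
  \<open>y = poly_op A p x\<close>. The weighted case becomes \<open>M^2 |y|^2 - |A y|^2\<close>,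
  which is nonnegative by the norm bound on \<open>A\<close>.\<close>

lemma poly_op_pos_cert: "pos_cert M q \<Longrightarrow> 0 \<le> x \<bullet> poly_op A q x"
proof (induction rule: pos_cert.induct)
  case (square p)
  have "x \<bullet> poly_op A (p * p) x = poly_op A p x \<bullet> poly_op A p x"
    by (simp only: poly_op_mult[OF lin] poly_op_sym)
  then show ?case by simp
next
  case (weighted p)
  define y where "y = poly_op A p x"
  have "x \<bullet> poly_op A ([:M\<^sup>2, 0, -1:] * (p * p)) x = x \<bullet> poly_op A (p * ([:M\<^sup>2, 0, -1:] * p)) x"
    by (simp only: ac_simps)
  also have "\<dots> = y \<bullet> poly_op A [:M\<^sup>2, 0, -1:] y"
    by (simp only: poly_op_mult[OF lin] y_def poly_op_sym)
  also have "\<dots> = (M * norm y)\<^sup>2 - (norm (A y))\<^sup>2"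
    by (simp add: poly_op_pCons[OF lin] poly_op_0 linear_0[OF lin] linear_neg[OF lin] inner_diff_right power2_norm_eq_inner
        inner_add_right power_mult_distrib flip: sym)
  also have "\<dots> \<ge> 0"
    using norm_le[of y] by (simp add: power_mono)
  finally show ?case .
next
  case (add p q)
  then show ?case by (simp add: poly_op_add inner_add_right)
qed

lemma poly_op_nonneg:
  assumes "\<And>t. t \<in> {-M..M} \<Longrightarrow> 0 \<le> poly q t"
  shows "0 \<le> x \<bullet> poly_op A q x"
proof (rule field_le_epsilon)
  fix e :: real assume e: "0 < e"
  \<comment> \<open>Certificates exist for strictly positive polynomials, so a constant
    \<open>d\<close> is added; this choice makes its contribution to the quadratic form at most
    \<open>e\<close>, also for \<open>x = 0\<close>.\<close>
  define d where "d = e / (1 + x \<bullet> x)"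
  have den: "0 < 1 + x \<bullet> x" by (simp add: add_pos_nonneg)
  have d: "0 < d" using e den by (simp add: d_def)
  have "pos_cert M (q + [:d:])"
    using M_pos assms d by (intro pos_cert_of_positive) (auto intro: add_nonneg_pos)
  then have "0 \<le> x \<bullet> poly_op A q x + d * (x \<bullet> x)"
    using poly_op_pos_cert[of "q + [:d:]" x] by (simp add: poly_op_add poly_op_const inner_add_right)
  moreover have "d * (x \<bullet> x) \<le> e"
    using e den by (simp add: d_def field_simps)
  ultimately show "0 \<le> x \<bullet> poly_op A q x + e" by linarith
qed

text \<open>Apply nonnegativity to the polynomial \<open>s^2 - p^2\<close>: its quadratic form at
  \<open>x\<close> is \<open>s^2 |x|^2 - |p(A) x|^2\<close>.\<close>

lemma norm_poly_op_le:
  assumes "0 \<le> s" and "\<And>t. t \<in> {-M..M} \<Longrightarrow> \<bar>poly p t\<bar> \<le> s"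
  shows "norm (poly_op A p x) \<le> s * norm x"
proof -
  have "0 \<le> x \<bullet> poly_op A ([:s\<^sup>2:] - p * p) x"
  proof (rule poly_op_nonneg)
    fix t assume "t \<in> {-M..M}"
    from power_mono[OF assms(2)[OF this], of 2]
    show "0 \<le> poly ([:s\<^sup>2:] - p * p) t" by (simp add: power2_eq_square flip: abs_mult)
  qed
  also have "\<dots> = s\<^sup>2 * (x \<bullet> x) - poly_op A p x \<bullet> poly_op A p x"
    by (simp add: poly_op_diff poly_op_const poly_op_mult[OF lin] inner_diff_right poly_op_sym)
  finally have "(norm (poly_op A p x))\<^sup>2 \<le> (s * norm x)\<^sup>2"
    by (simp add: power2_norm_eq_inner power_mult_distrib)
  then show ?thesis
    using assms(1) by (simp add: abs_le_square_iff[symmetric])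
qed

text \<open>The limit of \<open>poly_op A p x\<close> as \<open>p\<close> tends to \<open>f\<close> uniformly on \<open>[-M, M]\<close>; unspecified unless \<open>f\<close> is continuous there.\<close>

definition cfun :: "(real \<Rightarrow> real) \<Rightarrow> 'a \<Rightarrow> 'a" where
  "cfun f x = (THE y. \<forall>p s. (\<forall>t\<in>{-M..M}. \<bar>f t - poly p t\<bar> \<le> s) \<longrightarrow> norm (y - poly_op A p x) \<le> s * norm x)"

text \<open>Both vectors are close to p(A) x for every good \<open>p\<close>. The rate for
  \<open>z\<close> may carry an arbitrary constant \<open>c\<close>, so that a candidate can be
  tested with whatever constant is at hand; \<open>cfun_eqI\<close> inherits this freedom.\<close>

lemma cfun_unique:
  assumes f: "continuous_on {-M..M} f"
    and "\<And>p s. (\<And>t. t \<in> {-M..M} \<Longrightarrow> \<bar>f t - poly p t\<bar> \<le> s) \<Longrightarrow> norm (y - poly_op A p x) \<le> s * norm x"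
    and "\<And>p s. (\<And>t. t \<in> {-M..M} \<Longrightarrow> \<bar>f t - poly p t\<bar> \<le> s) \<Longrightarrow> norm (z - poly_op A p x) \<le> c * s"
  shows "y = z"
proof -
  have "norm (y - z) \<le> 0"
  proof (rule field_le_epsilon)
    fix e :: real assume "0 < e"
    define d where "d = e / (1 + norm x + \<bar>c\<bar>)"
    have den: "0 < 1 + norm x + \<bar>c\<bar>" by (smt (verit) norm_ge_zero abs_ge_zero)
    then have d: "0 < d" using \<open>0 < e\<close> by (simp add: d_def)
    obtain p where p: "\<And>t. t \<in> {-M..M} \<Longrightarrow> \<bar>f t - poly p t\<bar> \<le> d"
      using real_polynomial_approx[OF f d] by blast
    have "norm (y - z) \<le> norm (y - poly_op A p x) + norm (z - poly_op A p x)"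
      by (metis norm_triangle_ineq4 diff_diff_eq2 diff_add_cancel add_diff_eq)
    also have "\<dots> \<le> d * norm x + c * d"
      by (intro add_mono assms(2,3) p)
    also have "\<dots> \<le> d * (1 + norm x + \<bar>c\<bar>)"
    proof -
      have "c * d \<le> \<bar>c\<bar> * d" using d by (intro mult_right_mono) auto
      then show ?thesis using d by (simp only: distrib_left mult.commute[of d])
    qed
    also have "\<dots> = e" using den by (simp add: d_def)
    finally show "norm (y - z) \<le> 0 + e" by simp
  qed
  then show ?thesis by simp
qed

text \<open>Any two good polynomials differ by at most the sum of their errors, so
  \<open>norm_poly_op_le\<close> makes a sequence of approximations Cauchy. Its limit satisfies the
  estimate for every \<open>p\<close>, not only along the sequence, and hence is the vector
  described in \<open>cfun\<close>.\<close>

lemma cfun_approx: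
  assumes f: "continuous_on {-M..M} f"
    and p: "\<And>t. t \<in> {-M..M} \<Longrightarrow> \<bar>f t - poly p t\<bar> \<le> s"
  shows "norm (cfun f x - poly_op A p x) \<le> s * norm x"
proof -
  have s_nonneg: "0 \<le> s'" if "\<And>t. t \<in> {-M..M} \<Longrightarrow> \<bar>f t - poly p' t\<bar> \<le> s'" for p' s'
    using that[of M] M_pos by force
  have diff: "norm (poly_op A p1 x - poly_op A p2 x) \<le> (s1 + s2) * norm x"
    if "\<And>t. t \<in> {-M..M} \<Longrightarrow> \<bar>f t - poly p1 t\<bar> \<le> s1" "\<And>t. t \<in> {-M..M} \<Longrightarrow> \<bar>f t - poly p2 t\<bar> \<le> s2"
    for p1 p2 s1 s2
  proof -
    have "norm (poly_op A (p1 - p2) x) \<le> (s1 + s2) * norm x"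
    proof (rule norm_poly_op_le)
      show "0 \<le> s1 + s2" using s_nonneg[OF that(1)] s_nonneg[OF that(2)] by simp
      fix t assume t: "t \<in> {-M..M}"
      show "\<bar>poly (p1 - p2) t\<bar> \<le> s1 + s2"
        using that(1)[OF t] that(2)[OF t] by simp
    qed
    then show ?thesis by (simp add: poly_op_diff)
  qed
  obtain q r where q: "\<And>n t. t \<in> {-M..M} \<Longrightarrow> \<bar>f t - poly (q n) t\<bar> \<le> r n" and r: "r \<longlonglongrightarrow> 0"
    using real_polynomial_sequence[OF f] by blast
  have "Cauchy (\<lambda>n. poly_op A (q n) x)"
  proof (rule metric_CauchyI)
    fix e :: real assume e: "0 < e"
    have "(\<lambda>n. r n * norm x) \<longlonglongrightarrow> 0" using tendsto_mult_left_zero[OF r] .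
    then obtain N where N: "\<And>n. N \<le> n \<Longrightarrow> r n * norm x < e / 2"
      using e by (metis order_tendstoD(2) eventually_sequentially half_gt_zero)
    have "dist (poly_op A (q m) x) (poly_op A (q n) x) < e" if "N \<le> m" "N \<le> n" for m n
    proof -
      have "dist (poly_op A (q m) x) (poly_op A (q n) x) \<le> (r m + r n) * norm x"
        unfolding dist_norm by (rule diff) (rule q, assumption)+
      also have "\<dots> < e" using N[OF that(1)] N[OF that(2)] by (simp add: distrib_right)
      finally show ?thesis .
    qed
    then show "\<exists>N. \<forall>m\<ge>N. \<forall>n\<ge>N. dist (poly_op A (q m) x) (poly_op A (q n) x) < e" by blast
  qed
  then obtain y where y: "(\<lambda>n. poly_op A (q n) x) \<longlonglongrightarrow> y"
    using Cauchy_convergent_iff convergent_def by blast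
  have ex: "norm (y - poly_op A p x) \<le> s * norm x"
    if p: "\<And>t. t \<in> {-M..M} \<Longrightarrow> \<bar>f t - poly p t\<bar> \<le> s" for p s
  proof (rule LIMSEQ_le)
    show "(\<lambda>n. norm (poly_op A (q n) x - poly_op A p x)) \<longlonglongrightarrow> norm (y - poly_op A p x)"
      by (intro tendsto_intros y)
    have "(\<lambda>n. (r n + s) * norm x) \<longlonglongrightarrow> (0 + s) * norm x"
      by (intro tendsto_intros r)
    then show "(\<lambda>n. (r n + s) * norm x) \<longlonglongrightarrow> s * norm x" by simp
    show "\<exists>N. \<forall>n\<ge>N. norm (poly_op A (q n) x - poly_op A p x) \<le> (r n + s) * norm x"
      using diff[OF q p] by blast
  qed
  have "\<forall>p s. (\<forall>t\<in>{-M..M}. \<bar>f t - poly p t\<bar> \<le> s) \<longrightarrow> norm (cfun f x - poly_op A p x) \<le> s * norm x"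
    unfolding cfun_def
  proof (rule theI[of _ y])
    show "\<forall>p s. (\<forall>t\<in>{-M..M}. \<bar>f t - poly p t\<bar> \<le> s) \<longrightarrow> norm (y - poly_op A p x) \<le> s * norm x"
      using ex by blast
    fix z assume z: "\<forall>p s. (\<forall>t\<in>{-M..M}. \<bar>f t - poly p t\<bar> \<le> s) \<longrightarrow> norm (z - poly_op A p x) \<le> s * norm x"
    show "z = y"
      by (rule cfun_unique[OF f, where x = x and c = "norm x"]) (use z ex in \<open>auto simp: mult.commute\<close>)
  qed
  then show ?thesis using p by blast
qed

lemma cfun_eqI:
  assumes f: "continuous_on {-M..M} f"
    and "\<And>p s. (\<And>t. t \<in> {-M..M} \<Longrightarrow> \<bar>f t - poly p t\<bar> \<le> s) \<Longrightarrow> norm (z - poly_op A p x) \<le> c * s"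
  shows "cfun f x = z"
  by (rule cfun_unique[OF f, where x = x and c = c]) (use cfun_approx[OF f] assms(2) in auto)

lemma cfun_poly: "cfun (poly p) x = poly_op A p x"
proof (rule cfun_eqI[where c = "norm x"])
  show "continuous_on {-M..M} (poly p)" by (intro continuous_intros)
  fix q s assume q: "\<And>t. t \<in> {-M..M} \<Longrightarrow> \<bar>poly p t - poly q t\<bar> \<le> s"
  have "0 \<le> s" using q[of M] M_pos by force
  then show "norm (poly_op A p x - poly_op A q x) \<le> norm x * s"
    using norm_poly_op_le[of s "p - q" x] q by (simp add: poly_op_diff mult.commute)
qed

lemma cfun_cong:
  assumes "\<And>t. t \<in> {-M..M} \<Longrightarrow> f t = g t"
  shows "cfun f x = cfun g x"
proof -
  have "(\<forall>t\<in>{-M..M}. \<bar>f t - poly p t\<bar> \<le> s) \<longleftrightarrow> (\<forall>t\<in>{-M..M}. \<bar>g t - poly p t\<bar> \<le> s)" for p s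
    using assms by simp
  then show ?thesis unfolding cfun_def by presburger
qed

lemma cfun_tendsto:
  assumes f: "continuous_on {-M..M} f"
    and p: "\<And>n t. t \<in> {-M..M} \<Longrightarrow> \<bar>f t - poly (p n) t\<bar> \<le> s n" and s: "s \<longlonglongrightarrow> 0"
  shows "(\<lambda>n. poly_op A (p n) x) \<longlonglongrightarrow> cfun f x"
proof (subst tendsto_dist_iff, rule tendsto_sandwich[OF _ _ tendsto_const])
  show "(\<lambda>n. s n * norm x) \<longlonglongrightarrow> 0" using tendsto_mult_left_zero[OF s] .
  show "\<forall>\<^sub>F n in sequentially. dist (poly_op A (p n) x) (cfun f x) \<le> s n * norm x"
    by (intro always_eventually allI, subst dist_commute) (simp only: dist_norm cfun_approx[OF f p])
qed auto

lemma norm_cfun_le: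
  assumes f: "continuous_on {-M..M} f" and s: "\<And>t. t \<in> {-M..M} \<Longrightarrow> \<bar>f t\<bar> \<le> s"
  shows "norm (cfun f x) \<le> s * norm x"
  using cfun_approx[OF f, of 0 s x] s by (simp add: poly_op_0)

lemma cfun_add:
  assumes f: "continuous_on {-M..M} f" and g: "continuous_on {-M..M} g"
  shows "cfun (\<lambda>t. f t + g t) x = cfun f x + cfun g x"
proof -
  obtain p s where p: "\<And>n t. t \<in> {-M..M} \<Longrightarrow> \<bar>f t - poly (p n) t\<bar> \<le> s n" "s \<longlonglongrightarrow> 0"
    using real_polynomial_sequence[OF f] by blast
  obtain q r where q: "\<And>n t. t \<in> {-M..M} \<Longrightarrow> \<bar>g t - poly (q n) t\<bar> \<le> r n" "r \<longlonglongrightarrow> 0"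
    using real_polynomial_sequence[OF g] by blast
  have "(\<lambda>n. poly_op A (p n + q n) x) \<longlonglongrightarrow> cfun (\<lambda>t. f t + g t) x"
  proof (rule cfun_tendsto)
    show "\<bar>f t + g t - poly (p n + q n) t\<bar> \<le> s n + r n" if "t \<in> {-M..M}" for n t
      using p(1)[OF that, of n] q(1)[OF that, of n] by simp
    show "(\<lambda>n. s n + r n) \<longlonglongrightarrow> 0" using tendsto_add[OF p(2) q(2)] by simp
  qed (intro continuous_intros f g)
  moreover have "(\<lambda>n. poly_op A (p n + q n) x) \<longlonglongrightarrow> cfun f x + cfun g x"
    unfolding poly_op_add by (intro tendsto_add cfun_tendsto[OF f p] cfun_tendsto[OF g q])
  ultimately show ?thesis by (rule LIMSEQ_unique)
qed

lemma cfun_scale: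
  assumes f: "continuous_on {-M..M} f"
  shows "cfun (\<lambda>t. c * f t) x = c *\<^sub>R cfun f x"
proof -
  obtain p s where p: "\<And>n t. t \<in> {-M..M} \<Longrightarrow> \<bar>f t - poly (p n) t\<bar> \<le> s n" "s \<longlonglongrightarrow> 0"
    using real_polynomial_sequence[OF f] by blast
  have "(\<lambda>n. poly_op A (smult c (p n)) x) \<longlonglongrightarrow> cfun (\<lambda>t. c * f t) x"
  proof (rule cfun_tendsto)
    show "\<bar>c * f t - poly (smult c (p n)) t\<bar> \<le> \<bar>c\<bar> * s n" if "t \<in> {-M..M}" for n t
      using mult_left_mono[OF p(1)[OF that, of n], of "\<bar>c\<bar>"]
      by (simp add: right_diff_distrib flip: abs_mult)
    show "(\<lambda>n. \<bar>c\<bar> * s n) \<longlonglongrightarrow> 0" using tendsto_mult_left[OF p(2)] by simp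
  qed (intro continuous_intros f)
  moreover have "(\<lambda>n. poly_op A (smult c (p n)) x) \<longlonglongrightarrow> c *\<^sub>R cfun f x"
    unfolding poly_op_smult by (intro tendsto_intros cfun_tendsto[OF f p])
  ultimately show ?thesis by (rule LIMSEQ_unique)
qed

lemma linear_cfun:
  assumes f: "continuous_on {-M..M} f"
  shows "linear (cfun f)"
proof -
  obtain p s where p: "\<And>n t. t \<in> {-M..M} \<Longrightarrow> \<bar>f t - poly (p n) t\<bar> \<le> s n" "s \<longlonglongrightarrow> 0"
    using real_polynomial_sequence[OF f] by blast
  note lim = cfun_tendsto[OF f p]
  note lp = linear_poly_op[OF lin]
  show ?thesis
  proof (rule linearI)
    fix x y c
    have "(\<lambda>n. poly_op A (p n) x + poly_op A (p n) y) \<longlonglongrightarrow> cfun f (x + y)"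
      using lim[of "x + y"] by (simp add: linear_add[OF lp])
    moreover have "(\<lambda>n. poly_op A (p n) x + poly_op A (p n) y) \<longlonglongrightarrow> cfun f x + cfun f y"
      by (intro tendsto_intros lim)
    ultimately show "cfun f (x + y) = cfun f x + cfun f y" by (rule LIMSEQ_unique)
    have "(\<lambda>n. c *\<^sub>R poly_op A (p n) x) \<longlonglongrightarrow> cfun f (c *\<^sub>R x)"
      using lim[of "c *\<^sub>R x"] by (simp add: linear_scale[OF lp])
    moreover have "(\<lambda>n. c *\<^sub>R poly_op A (p n) x) \<longlonglongrightarrow> c *\<^sub>R cfun f x"
      by (intro tendsto_intros lim)
    ultimately show "cfun f (c *\<^sub>R x) = c *\<^sub>R cfun f x" by (rule LIMSEQ_unique)
  qed
qed

lemma bounded_linear_cfun: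
  assumes f: "continuous_on {-M..M} f"
  shows "bounded_linear (cfun f)"
proof -
  obtain s where "\<And>t. t \<in> {-M..M} \<Longrightarrow> \<bar>f t\<bar> \<le> s"
    using continuous_on_interval_bounded[OF f] by blast
  then show ?thesis
    using norm_cfun_le[OF f] linear_cfun[OF f]
    by (intro bounded_linear_intro[where K = s]) (auto simp: linear_add linear_scale mult.commute)
qed

lemma cfun_sym:
  assumes f: "continuous_on {-M..M} f"
  shows "cfun f x \<bullet> y = x \<bullet> cfun f y"
proof -
  obtain p s where p: "\<And>n t. t \<in> {-M..M} \<Longrightarrow> \<bar>f t - poly (p n) t\<bar> \<le> s n" "s \<longlonglongrightarrow> 0"
    using real_polynomial_sequence[OF f] by blast
  have "(\<lambda>n. poly_op A (p n) x \<bullet> y) \<longlonglongrightarrow> cfun f x \<bullet> y"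
    by (intro tendsto_inner tendsto_const cfun_tendsto[OF f p])
  moreover have "(\<lambda>n. x \<bullet> poly_op A (p n) y) \<longlonglongrightarrow> x \<bullet> cfun f y"
    by (intro tendsto_inner tendsto_const cfun_tendsto[OF f p])
  ultimately show ?thesis unfolding poly_op_sym by (rule LIMSEQ_unique)
qed

text \<open>Applied with \<open>J\<close> multiplication by the imaginary unit, which makes the
  calculus complex linear, and with \<open>J\<close> a polynomial in \<open>A\<close>, which gives
  multiplicativity.\<close>

lemma cfun_intertwine:
  assumes f: "continuous_on {-M..M} f"
    and J: "bounded_linear J" and comm: "\<And>x. J (A x) = A (J x)"
  shows "J (cfun f x) = cfun f (J x)"
proof -
  obtain p s where p: "\<And>n t. t \<in> {-M..M} \<Longrightarrow> \<bar>f t - poly (p n) t\<bar> \<le> s n" "s \<longlonglongrightarrow> 0"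
    using real_polynomial_sequence[OF f] by blast
  have "(\<lambda>n. J (poly_op A (p n) x)) \<longlonglongrightarrow> J (cfun f x)"
    by (intro bounded_linear.tendsto[OF J] cfun_tendsto[OF f p])
  moreover have "(\<lambda>n. J (poly_op A (p n) x)) \<longlonglongrightarrow> cfun f (J x)"
    unfolding poly_op_intertwine[OF lin bounded_linear.linear[OF J] comm]
    by (intro cfun_tendsto[OF f p])
  ultimately show ?thesis by (rule LIMSEQ_unique)
qed

text \<open>Two limits taken one after the other: with a polynomial in the place of
  \<open>f\<close>, the function \<open>g\<close> is approximated; afterwards \<open>f\<close> is
  approximated with \<open>g\<close> fixed. In the first limit polynomials are commuted, so that the
  limit is taken at a fixed vector.\<close>

lemma cfun_mult:
  assumes f: "continuous_on {-M..M} f" and g: "continuous_on {-M..M} g"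
  shows "cfun (\<lambda>t. f t * g t) x = cfun f (cfun g x)"
proof -
  have *: "cfun (\<lambda>t. poly q t * g t) x = poly_op A q (cfun g x)" for q
  proof -
    obtain p s where p: "\<And>n t. t \<in> {-M..M} \<Longrightarrow> \<bar>g t - poly (p n) t\<bar> \<le> s n" "s \<longlonglongrightarrow> 0"
      using real_polynomial_sequence[OF g] by blast
    obtain c where c: "\<And>t. t \<in> {-M..M} \<Longrightarrow> \<bar>poly q t\<bar> \<le> c"
      using continuous_on_interval_bounded[of "-M" M "poly q"] continuous_on_poly[OF continuous_on_id, of _ q]
      by blast
    have "(\<lambda>n. poly_op A (q * p n) x) \<longlonglongrightarrow> cfun (\<lambda>t. poly q t * g t) x"
    proof (rule cfun_tendsto)
      show "\<bar>poly q t * g t - poly (q * p n) t\<bar> \<le> c * s n" if "t \<in> {-M..M}" for n t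
        using mult_mono[OF c[OF that] p(1)[OF that, of n]] order_trans[OF abs_ge_zero c[OF that]]
        by (simp add: right_diff_distrib flip: abs_mult)
      show "(\<lambda>n. c * s n) \<longlonglongrightarrow> 0" using tendsto_mult_left[OF p(2)] by simp
    qed (intro continuous_intros g)
    moreover have "(\<lambda>n. poly_op A (p n) (poly_op A q x)) \<longlonglongrightarrow> cfun g (poly_op A q x)"
      by (intro cfun_tendsto[OF g p])
    moreover have "poly_op A (q * p n) x = poly_op A (p n) (poly_op A q x)" for n
      by (simp add: poly_op_mult[OF lin] poly_op_commute[OF lin])
    ultimately have "cfun (\<lambda>t. poly q t * g t) x = cfun g (poly_op A q x)"
      by (simp add: LIMSEQ_unique)
    also have "continuous_on {-M..M} (poly q)" by (intro continuous_intros)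
    then have "bounded_linear (poly_op A q)"
      using bounded_linear_cfun[of "poly q"] by (simp only: cfun_poly[abs_def])
    then have "cfun g (poly_op A q x) = poly_op A q (cfun g x)"
      by (intro cfun_intertwine[OF g, symmetric] poly_op_intertwine[OF lin lin, symmetric]) auto
    finally show ?thesis .
  qed
  obtain p s where p: "\<And>n t. t \<in> {-M..M} \<Longrightarrow> \<bar>f t - poly (p n) t\<bar> \<le> s n" "s \<longlonglongrightarrow> 0"
    using real_polynomial_sequence[OF f] by blast
  obtain c where c: "\<And>t. t \<in> {-M..M} \<Longrightarrow> \<bar>g t\<bar> \<le> c"
    using continuous_on_interval_bounded[OF g] by blast
  have "(\<lambda>n. cfun (\<lambda>t. poly (p n) t * g t) x) \<longlonglongrightarrow> cfun (\<lambda>t. f t * g t) x"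
  proof (subst tendsto_dist_iff, rule tendsto_sandwich[OF _ _ tendsto_const])
    show "(\<lambda>n. (s n * c) * norm x) \<longlonglongrightarrow> 0"
      by (intro tendsto_mult_left_zero p(2))
    have "dist (cfun (\<lambda>t. poly (p n) t * g t) x) (cfun (\<lambda>t. f t * g t) x) \<le> (s n * c) * norm x" for n
    proof -
      have "cfun (\<lambda>t. poly (p n) t * g t + (-1) * (f t * g t)) x
          = cfun (\<lambda>t. poly (p n) t * g t) x + (-1) *\<^sub>R cfun (\<lambda>t. f t * g t) x"
        using cfun_add[of "\<lambda>t. poly (p n) t * g t" "\<lambda>t. (-1) * (f t * g t)" x] cfun_scale[of "\<lambda>t. f t * g t" "-1" x]
        by (simp only: continuous_intros f g)
      then have "dist (cfun (\<lambda>t. poly (p n) t * g t) x) (cfun (\<lambda>t. f t * g t) x)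
          = norm (cfun (\<lambda>t. poly (p n) t * g t + (-1) * (f t * g t)) x)"
        by (simp add: dist_norm)
      also have "\<dots> \<le> (s n * c) * norm x"
      proof (rule norm_cfun_le)
        fix t assume t: "t \<in> {-M..M}"
        have "\<bar>poly (p n) t * g t + (-1) * (f t * g t)\<bar> = \<bar>f t - poly (p n) t\<bar> * \<bar>g t\<bar>"
          by (simp add: abs_minus_commute flip: abs_mult) (simp add: algebra_simps)
        also have "\<dots> \<le> s n * c"
          using p(1)[OF t, of n] by (intro mult_mono c[OF t]) auto
        finally show "\<bar>poly (p n) t * g t + (-1) * (f t * g t)\<bar> \<le> s n * c" .
      qed (intro continuous_intros f g)
      finally show ?thesis .
    qed
    then show "\<forall>\<^sub>F n in sequentially. dist (cfun (\<lambda>t. poly (p n) t * g t) x) (cfun (\<lambda>t. f t * g t) x) \<le> (s n * c) * norm x"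
      by simp
  qed auto
  then show ?thesis
    unfolding * using cfun_tendsto[OF f p] by (rule LIMSEQ_unique)
qed

lemma cfun_id: "cfun (\<lambda>t. t) x = A x"
proof -
  have "cfun (\<lambda>t. t) x = cfun (poly [:0, 1:]) x" by (rule cfun_cong) simp
  then show ?thesis by (simp add: cfun_poly poly_op_pCons[OF lin] poly_op_0 linear_0[OF lin])
qed

lemma cfun_const: "cfun (\<lambda>t. c) x = c *\<^sub>R x"
proof -
  have "cfun (\<lambda>t. c) x = cfun (poly [:c:]) x" by (rule cfun_cong) simp
  then show ?thesis by (simp add: cfun_poly poly_op_const)
qed

end

section \<open>Equidistribution of irrational rotations\<close>

text \<open>Dirichlet's theorem bounds the denominator only from above. Since \<alpha> is
  irrational, the distances from its multiples up to \<open>K\<close> to the integers have a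
  positive minimum; asking for a better approximation than this forces \<open>K < k\<close>.\<close>

lemma approx_coprime_large_denominator:
  fixes \<alpha> :: real and K :: nat
  assumes "\<alpha> \<notin> \<rat>"
  obtains h :: int and k :: nat where "coprime h (int k)" "K < k" "\<bar>real k * \<alpha> - of_int h\<bar> < 1 / real k"
proof -
  have pos: "0 < \<bar>real k * \<alpha> - of_int (round (real k * \<alpha>))\<bar>" if "0 < k" for k :: nat
  proof (rule ccontr)
    assume "\<not> ?thesis"
    then have "\<alpha> = of_int (round (real k * \<alpha>)) / real k" using that by (simp add: field_simps)
    then have "\<alpha> \<in> \<rat>" by (metis Rats_divide Rats_of_int Rats_of_nat)
    with assms show False by simp
  qed
  \<comment> \<open>The extra element 1 keeps the set nonempty when \<open>K = 0\<close>.\<close>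
  define D where "D = insert 1 ((\<lambda>k::nat. \<bar>real k * \<alpha> - of_int (round (real k * \<alpha>))\<bar>) ` {1..K})"
  have D: "finite D" "D \<noteq> {}" by (auto simp: D_def)
  have "0 < Min D" using pos D by (auto simp: D_def Min_gr_iff)
  then obtain N :: nat where N: "1 / Min D < real N" using reals_Archimedean2 by blast
  have N0: "0 < N" using N \<open>0 < Min D\<close> by (metis divide_nonneg_pos gr0I less_le_not_le of_nat_0 zero_le_one)
  have N': "1 / real N < Min D" using N \<open>0 < Min D\<close> N0 by (simp add: field_simps)
  obtain h k where hk: "coprime h k" "0 < k" "k \<le> int N" "\<bar>of_int k * \<alpha> - of_int h\<bar> < 1 / real N"
    using Dirichlet_approx_coprime[OF N0] by blast
  define m where "m = nat k"
  have m: "k = int m" "0 < m" using hk(2) by (auto simp: m_def)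
  have "K < m"
  proof (rule ccontr)
    assume "\<not> K < m"
    then have "\<bar>real m * \<alpha> - of_int (round (real m * \<alpha>))\<bar> \<in> D" using m by (auto simp: D_def)
    then have "Min D \<le> \<bar>real m * \<alpha> - of_int (round (real m * \<alpha>))\<bar>" using D by simp
    also have "\<dots> \<le> \<bar>real m * \<alpha> - of_int h\<bar>"
      using round_diff_minimal[of "real m * \<alpha>" h] .
    also have "\<dots> < 1 / real N" using hk(4) by (simp add: m)
    finally show False using N' by simp
  qed
  moreover have "1 / real N \<le> 1 / real m" using hk(3) m by (simp add: frac_le)
  ultimately show ?thesis using hk m by (intro that[of h m]) auto
qed

lemma bij_betw_mult_mod:
  assumes "coprime h (int k)" "0 < k"
  shows "bij_betw (\<lambda>j. nat ((int j * h) mod int k)) {..<k} {..<k}"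
proof -
  have "inj_on (\<lambda>j. nat ((int j * h) mod int k)) {..<k}"
  proof (rule inj_onI)
    fix i j assume ij: "i \<in> {..<k}" "j \<in> {..<k}" and eq: "nat ((int i * h) mod int k) = nat ((int j * h) mod int k)"
    then have "(int i * h) mod int k = (int j * h) mod int k"
      using assms(2) by (simp add: eq_nat_nat_iff)
    then have "int k dvd (int i - int j) * h"
      by (simp add: mod_eq_dvd_iff algebra_simps)
    then have "int k dvd int i - int j"
      using assms(1) by (simp add: coprime_dvd_mult_left_iff coprime_commute)
    then have "int i mod int k = int j mod int k" by (simp add: mod_eq_dvd_iff)
    then show "i = j" using ij by simp
  qed
  moreover have "(\<lambda>j. nat ((int j * h) mod int k)) ` {..<k} \<subseteq> {..<k}"
    using assms(2) by (auto simp: nat_less_iff)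
  ultimately show ?thesis
    by (simp add: bij_betw_def endo_inj_surj)
qed

locale continuous_periodic =
  fixes f :: "real \<Rightarrow> real"
  assumes cont: "continuous_on UNIV f" and per: "f (x + 1) = f x"
begin

lemma per_nat: "f (x + real n) = f x"
proof (induction n)
  case (Suc n)
  have "x + real (Suc n) = (x + real n) + 1" by simp
  then show ?case using per[of "x + real n"] Suc by metis
qed simp

lemma per_int: "f (x + of_int n) = f x"
proof (cases "0 \<le> n")
  case True
  then show ?thesis using per_nat[of x "nat n"] by simp
next
  case False
  then show ?thesis using per_nat[of "x + of_int n" "nat (- n)"] by simp
qed

lemma integrable: "f integrable_on {a..b}"
  by (rule integrable_continuous_interval) (rule continuous_on_subset[OF cont], simp)

lemma integral_period: "integral {x..x+1} f = integral {0..1} f"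
proof -
  define n where "n = \<lfloor>x\<rfloor>"
  define y where "y = x - of_int n"
  have y: "0 \<le> y" "y \<le> 1" by (simp_all add: y_def n_def) linarith
  have shift: "integral {a + of_int m..b + of_int m} f = integral {a..b} f" for a b m
    using integral_shift_real_ivl[where f = f and c = "of_int m" and a = "a + of_int m" and b = "b + of_int m"] by (simp add: per_int)
  have "integral {x..x+1} f = integral {y..y+1} f"
    using shift[of y n "y + 1"] by (simp add: y_def)
  also have "\<dots> = integral {y..1} f + integral {1..y+1} f"
    by (rule Henstock_Kurzweil_Integration.integral_combine[symmetric]) (use y integrable in auto)
  also have "integral {1..y+1} f = integral {0..y} f"
    using shift[of 0 1 y] by simp
  also have "integral {y..1} f + integral {0..y} f = integral {0..1} f"
    using Henstock_Kurzweil_Integration.integral_combine[of 0 y 1 f] y integrable by simp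
  finally show ?thesis .
qed

lemma uniformly_continuous:
  assumes "0 < e"
  obtains d where "0 < d" "\<And>x y. \<bar>x - y\<bar> < d \<Longrightarrow> \<bar>f x - f y\<bar> < e"
proof -
  have "uniformly_continuous_on {-1..2} f"
    by (intro compact_uniformly_continuous continuous_on_subset[OF cont]) auto
  then obtain d where d: "0 < d" "\<And>x y. x \<in> {-1..2} \<Longrightarrow> y \<in> {-1..2} \<Longrightarrow> dist x y < d \<Longrightarrow> dist (f x) (f y) < e"
    using assms unfolding uniformly_continuous_on_def by metis
  show ?thesis
  proof (rule that[of "min d 1"])
    show "0 < min d 1" using d by simp
    fix x y :: real assume xy: "\<bar>x - y\<bar> < min d 1"
    define n where "n = \<lfloor>x\<rfloor>"
    have n: "0 \<le> x - of_int n" "x - of_int n < 1" by (simp_all add: n_def) linarith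
    have "dist (f (x + of_int (- n))) (f (y + of_int (- n))) < e"
      by (rule d(2)) (use xy n in \<open>auto simp: dist_real_def\<close>)
    then show "\<bar>f x - f y\<bar> < e" unfolding per_int by (simp add: dist_real_def)
  qed
qed

text \<open>Each of the \<open>k\<close> cells of length \<open>1 / k\<close> contributes an error
  of at most \<open>e / k\<close> to the integral, and by periodicity the cells starting at any
  \<open>x\<close> cover one full period.\<close>

lemma riemann_sum:
  assumes k: "0 < k" and osc: "\<And>x y. \<bar>x - y\<bar> \<le> 1 / real k \<Longrightarrow> \<bar>f x - f y\<bar> \<le> e"
  shows "\<bar>(\<Sum>r<k. f (x + real r / real k)) - real k * integral {0..1} f\<bar> \<le> real k * e"
proof -
  let ?I = "\<lambda>r. {x + real r / real k..x + real (Suc r) / real k}"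
  have split: "(\<Sum>r<m. integral (?I r) f) = integral {x..x + real m / real k} f" for m
  proof (induction m)
    case (Suc m)
    then show ?case
      using Henstock_Kurzweil_Integration.integral_combine[of x "x + real m / real k" "x + real (Suc m) / real k" f]
        integrable k by (simp add: field_simps)
  qed simp
  have part: "\<bar>f (x + real r / real k) / real k - integral (?I r) f\<bar> \<le> e / real k" for r
  proof -
    let ?y = "x + real r / real k"
    have len: "x + real (Suc r) / real k - ?y = 1 / real k" using k by (simp add: field_simps)
    have le: "?y \<le> x + real (Suc r) / real k" using k by (simp add: field_simps)
    have i: "integral (?I r) (\<lambda>t. f ?y) = f ?y / real k"
      using len le by simp
    have "norm (integral (?I r) (\<lambda>t. f ?y - f t)) \<le> e * (x + real (Suc r) / real k - ?y)"
    proof (rule integral_bound[OF le])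
      show "continuous_on (?I r) (\<lambda>t. f ?y - f t)"
        by (intro continuous_intros continuous_on_subset[OF cont]) auto
      fix t assume "t \<in> ?I r"
      then have "\<bar>?y - t\<bar> \<le> 1 / real k" using len by auto
      then show "norm (f ?y - f t) \<le> e" using osc by simp
    qed
    then show ?thesis
      unfolding len using i by (subst (asm) integral_diff) (auto intro: integrable)
  qed
  have "\<bar>(\<Sum>r<k. f (x + real r / real k) / real k - integral (?I r) f)\<bar> \<le> (\<Sum>r<k. e / real k)"
    by (rule order_trans[OF sum_abs]) (intro sum_mono part)
  also have "\<dots> = e" using k by simp
  also have "(\<Sum>r<k. f (x + real r / real k) / real k - integral (?I r) f)
      = (\<Sum>r<k. f (x + real r / real k)) / real k - integral {0..1} f"
    unfolding sum_subtractf split using k by (simp add: integral_period sum_divide_distrib)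
  finally have "real k * \<bar>(\<Sum>r<k. f (x + real r / real k)) / real k - integral {0..1} f\<bar> \<le> real k * e"
    by (intro mult_left_mono) auto
  then show ?thesis using k by (simp add: abs_mult[of "real k", simplified, symmetric] right_diff_distrib)
qed

text \<open>If \<open>\<alpha>\<close> is within \<open>1 / k\<^sup>2\<close> of the reduced fraction \<open>h / k\<close>, then \<open>k\<close> consecutive points of the rotation are within \<open>1 / k\<close> of the \<open>k\<close> equally spaced points \<open>x + r / k\<close>.\<close>

lemma rotation_block:
  assumes hk: "coprime h (int k)" "0 < k" "\<bar>real k * \<alpha> - of_int h\<bar> < 1 / real k"
    and osc: "\<And>x y. \<bar>x - y\<bar> \<le> 1 / real k \<Longrightarrow> \<bar>f x - f y\<bar> \<le> e"
  shows "\<bar>(\<Sum>j<k. f (x + real j * \<alpha>)) - real k * integral {0..1} f\<bar> \<le> 2 * real k * e"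
proof -
  let ?r = "\<lambda>j. nat ((int j * h) mod int k)"
  have near: "\<bar>f (x + real j * \<alpha>) - f (x + real (?r j) / real k)\<bar> \<le> e" if "j < k" for j
  proof -
    have "real j * of_int h = of_int ((int j * h) div int k * int k + (int j * h) mod int k)"
      by (simp only: div_mult_mod_eq of_int_mult of_int_of_nat_eq)
    also have "\<dots> = of_int ((int j * h) div int k) * real k + of_int ((int j * h) mod int k)"
      by (simp only: of_int_add of_int_mult of_int_of_nat_eq)
    also have "of_int ((int j * h) mod int k) = real (?r j)"
      using hk(2) by simp
    finally have "real j * of_int h / real k = of_int ((int j * h) div int k) + real (?r j) / real k"
      using hk(2) by (simp add: add_divide_distrib)
    then have eq: "f (x + real (?r j) / real k) = f (x + real j * of_int h / real k)"
      using per_int[of "x + real (?r j) / real k" "(int j * h) div int k"] by (simp add: algebra_simps)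
    have "x + real j * \<alpha> - (x + real j * of_int h / real k) = real j / real k * (real k * \<alpha> - of_int h)"
      using hk(2) by (simp add: field_simps)
    also have "\<bar>\<dots>\<bar> \<le> 1 * (1 / real k)"
      unfolding abs_mult using hk that by (intro mult_mono) auto
    finally show ?thesis unfolding eq by (intro osc) simp
  qed
  have "(\<Sum>j<k. f (x + real (?r j) / real k)) = (\<Sum>r<k. f (x + real r / real k))"
    by (rule sum.reindex_bij_betw[OF bij_betw_mult_mod[OF hk(1,2)]])
  then have "\<bar>(\<Sum>j<k. f (x + real j * \<alpha>)) - (\<Sum>r<k. f (x + real r / real k))\<bar>
      = \<bar>\<Sum>j<k. f (x + real j * \<alpha>) - f (x + real (?r j) / real k)\<bar>"
    by (simp add: sum_subtractf)
  also have "\<dots> \<le> (\<Sum>j<k. e)"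
    by (rule order_trans[OF sum_abs]) (intro sum_mono near, simp)
  finally show ?thesis using riemann_sum[OF hk(2) osc, of x] by simp
qed

text \<open>One good denominator \<open>k\<close>, depending on \<open>e\<close> alone, suffices:
  the orbit is cut into blocks of \<open>k\<close> points, each with an average close to the
  integral, and an incomplete block of bounded total error. The estimate \<open>main\<close> is
  uniform in the starting point because removing a block moves it.\<close>

lemma equidistribution:
  assumes "\<alpha> \<notin> \<rat>"
  shows "(\<lambda>N. (\<Sum>n<N. f (x + real n * \<alpha>)) / real N) \<longlonglongrightarrow> integral {0..1} f"
proof (rule LIMSEQ_I)
  fix e :: real assume e: "0 < e"
  let ?I = "integral {0..1} f"
  obtain d where d: "0 < d" "\<And>x y. \<bar>x - y\<bar> < d \<Longrightarrow> \<bar>f x - f y\<bar> < e / 4"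
    using uniformly_continuous[of "e / 4"] e by auto
  obtain K :: nat where K: "1 / d < real K" using reals_Archimedean2 by blast
  obtain h k where hk: "coprime h (int k)" "K < k" "\<bar>real k * \<alpha> - of_int h\<bar> < 1 / real k"
    using approx_coprime_large_denominator[OF assms, of K] by blast
  have k: "0 < k" using hk(2) by simp
  have "1 / d < real k" using K hk(2) by simp
  then have kd: "1 / real k < d" using d(1) k by (simp add: field_simps)
  have osc: "\<bar>f x - f y\<bar> \<le> e / 4" if "\<bar>x - y\<bar> \<le> 1 / real k" for x y
    using d(2)[of x y] that kd by force
  have "bounded (f ` {0..1})"
    by (intro compact_imp_bounded compact_continuous_image continuous_on_subset[OF cont]) auto
  then obtain B where B: "\<And>t. t \<in> {0..1} \<Longrightarrow> \<bar>f t\<bar> \<le> B"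
    by (metis bounded_iff image_eqI real_norm_def)
  have Bf: "\<bar>f t - ?I\<bar> \<le> B + \<bar>?I\<bar>" for t
  proof -
    have "\<bar>f t\<bar> = \<bar>f (t + of_int (- \<lfloor>t\<rfloor>))\<bar>" by (simp only: per_int)
    also have "\<dots> \<le> B" by (intro B) (auto, linarith)
    finally show ?thesis by linarith
  qed
  define C where "C = B + \<bar>?I\<bar>"
  have C: "0 \<le> C" using Bf[of 0] by (simp add: C_def)
  have main: "\<bar>(\<Sum>n<N. f (y + real n * \<alpha>)) - real N * ?I\<bar> \<le> real N * (e / 2) + real k * C" for N y
  proof (induction N arbitrary: y rule: less_induct)
    case (less N)
    show ?case
    proof (cases "N < k")
      case True
      have "\<bar>(\<Sum>n<N. f (y + real n * \<alpha>)) - real N * ?I\<bar> = \<bar>\<Sum>n<N. f (y + real n * \<alpha>) - ?I\<bar>"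
        by (simp add: sum_subtractf)
      also have "\<dots> \<le> (\<Sum>n<N. C)"
        by (rule order_trans[OF sum_abs]) (intro sum_mono, simp add: C_def Bf)
      also have "\<dots> \<le> real k * C" using True C by (simp add: mult_right_mono)
      finally show ?thesis using e by (smt (verit) mult_nonneg_nonneg of_nat_0_le_iff half_gt_zero)
    next
      case False
      then obtain m where N: "N = k + m" using le_Suc_ex by (metis not_less)
      have "(\<Sum>n<N. f (y + real n * \<alpha>)) = (\<Sum>n<k. f (y + real n * \<alpha>)) + (\<Sum>n<m. f (y + real (k + n) * \<alpha>))"
        unfolding N by (induction m) (simp_all add: add.assoc)
      also have "(\<Sum>n<m. f (y + real (k + n) * \<alpha>)) = (\<Sum>n<m. f ((y + real k * \<alpha>) + real n * \<alpha>))"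
        by (simp add: algebra_simps)
      finally have split: "(\<Sum>n<N. f (y + real n * \<alpha>)) = (\<Sum>n<k. f (y + real n * \<alpha>)) + (\<Sum>n<m. f ((y + real k * \<alpha>) + real n * \<alpha>))" .
      show ?thesis
      proof -
        define S1 where "S1 = (\<Sum>n<k. f (y + real n * \<alpha>))"
        define S2 where "S2 = (\<Sum>n<m. f ((y + real k * \<alpha>) + real n * \<alpha>))"
        have "\<bar>S1 - real k * ?I\<bar> \<le> real k * (e / 2)"
          using rotation_block[OF hk(1) k hk(3) osc, of y] by (simp add: S1_def mult.commute)
        moreover have "\<bar>S2 - real m * ?I\<bar> \<le> real m * (e / 2) + real k * C"
          unfolding S2_def by (rule less.IH) (simp add: N k)
        moreover have "(S1 + S2) - real N * ?I = (S1 - real k * ?I) + (S2 - real m * ?I)"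
          by (simp add: N algebra_simps)
        moreover have "real N * (e / 2) = real k * (e / 2) + real m * (e / 2)"
          by (simp add: N algebra_simps)
        ultimately show ?thesis
          unfolding split S1_def[symmetric] S2_def[symmetric] by linarith
      qed
    qed
  qed
  obtain N0 :: nat where N0: "2 * real k * C / e < real N0" using reals_Archimedean2 by blast
  show "\<exists>no. \<forall>N\<ge>no. norm ((\<Sum>n<N. f (x + real n * \<alpha>)) / real N - ?I) < e"
  proof (intro exI[of _ "Suc N0"] allI impI)
    fix N assume N: "Suc N0 \<le> N"
    have "real k * C < real N * (e / 2)"
    proof -
      have "2 * real k * C < real N0 * e" using N0 e by (simp add: field_simps)
      also have "\<dots> \<le> real N * e" using N e by simp
      finally show ?thesis by simp
    qed
    with main[where N = N and y = x]
    have "\<bar>(\<Sum>n<N. f (x + real n * \<alpha>)) - real N * ?I\<bar> < real N * e" by simp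
    then have "\<bar>(\<Sum>n<N. f (x + real n * \<alpha>)) - real N * ?I\<bar> / real N < e"
      using N by (simp add: divide_less_eq mult.commute)
    moreover have "(\<Sum>n<N. f (x + real n * \<alpha>)) / real N - ?I = ((\<Sum>n<N. f (x + real n * \<alpha>)) - real N * ?I) / real N"
      using N by (simp add: field_simps)
    ultimately show "norm ((\<Sum>n<N. f (x + real n * \<alpha>)) / real N - ?I) < e" by simp
  qed
qed

end

lemma equidistribution_period:
  fixes f :: "real \<Rightarrow> real"
  assumes cont: "continuous_on UNIV f" and p: "0 < p" and per: "\<And>x. f (x + p) = f x" and irr: "s / p \<notin> \<rat>"
  shows "(\<lambda>N. (\<Sum>n<N. f (x + real n * s)) / real N) \<longlonglongrightarrow> integral {0..p} f / p"
proof -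
  interpret g: continuous_periodic "\<lambda>t. f (p * t)"
  proof
    show "continuous_on UNIV (\<lambda>t. f (p * t))"
      by (rule continuous_on_compose2[OF cont]) (auto intro: continuous_intros)
    show "f (p * (t + 1)) = f (p * t)" for t using per[of "p * t"] by (simp add: distrib_left)
  qed
  have "f integrable_on {0..p}"
    by (rule integrable_continuous_interval) (rule continuous_on_subset[OF cont], simp)
  then have "((\<lambda>t. f (p * t)) has_integral (1 / \<bar>p\<bar>) *\<^sub>R integral {0..p} f) ((\<lambda>x. x / p) ` {0..p})"
    using has_integral_stretch_real[of f "integral {0..p} f" 0 p p] p by (simp add: integrable_integral)
  moreover have "(\<lambda>x. x / p) ` {0..p} = {0..1}"
    using p by (auto simp: image_iff field_simps intro!: bexI[of _ "p * x" for x])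
  ultimately have "integral {0..1} (\<lambda>t. f (p * t)) = integral {0..p} f / p"
    using p by (simp add: integral_unique)
  moreover have "p * (x / p + real n * (s / p)) = x + real n * s" for n
    using p by (simp add: field_simps)
  ultimately show ?thesis
    using g.equidistribution[OF irr, of "x / p"] by simp
qed

section \<open>A strong law of large numbers\<close>

text \<open>The variance of the N-th partial sum is \<open>O(N)\<close>, so the averages converge along \<open>N = j\<^sup>2\<close>, where the variances are summable; boundedness controls the averages between consecutive squares.\<close>

lemma (in prob_space) slln_finite_range:
  fixes Z :: "nat \<Rightarrow> 'a \<Rightarrow> real"
  assumes meas[measurable]: "\<And>n. Z n \<in> borel_measurable M"
    and bnd: "\<And>n. AE \<omega> in M. \<bar>Z n \<omega>\<bar> \<le> B" and B: "0 \<le> B"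
    and uncorr: "\<And>m n. m + D < n \<Longrightarrow> expectation (\<lambda>\<omega>. Z m \<omega> * Z n \<omega>) = 0"
  shows "AE \<omega> in M. (\<lambda>N. (\<Sum>n<N. Z n \<omega>) / real N) \<longlonglongrightarrow> 0"
proof -
  define S where "S N \<omega> = (\<Sum>n<N. Z n \<omega>)" for N \<omega>
  have S_meas[measurable]: "S N \<in> borel_measurable M" for N
    unfolding S_def by measurable
  have prod_bnd: "AE \<omega> in M. \<bar>Z m \<omega> * Z n \<omega>\<bar> \<le> B\<^sup>2" for m n
    using bnd[of m] bnd[of n]
  proof eventually_elim
    case (elim \<omega>)
    then show ?case using B unfolding abs_mult power2_eq_square by (intro mult_mono) auto
  qed
  have int: "integrable M (\<lambda>\<omega>. Z m \<omega> * Z n \<omega>)" for m n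
    by (rule integrable_const_bound[of _ "B\<^sup>2"]) (use prod_bnd in auto)
  have prod_le: "expectation (\<lambda>\<omega>. Z m \<omega> * Z n \<omega>) \<le> B\<^sup>2" for m n
  proof -
    have "expectation (\<lambda>\<omega>. Z m \<omega> * Z n \<omega>) \<le> expectation (\<lambda>\<omega>. B\<^sup>2)"
      by (rule integral_mono_AE) (use prod_bnd[of m n] int in auto)
    then show ?thesis by (simp add: prob_space)
  qed
  have S_sq: "(S N \<omega>)\<^sup>2 = (\<Sum>m<N. \<Sum>n<N. Z m \<omega> * Z n \<omega>)" for N \<omega>
    unfolding S_def power2_eq_square by (simp add: sum_product)
  have S_int: "integrable M (\<lambda>\<omega>. (S N \<omega>)\<^sup>2)" for N
    unfolding S_sq by (intro Bochner_Integration.integrable_sum int)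
  have var: "expectation (\<lambda>\<omega>. (S N \<omega>)\<^sup>2) \<le> real N * (real (2 * D + 1) * B\<^sup>2)" for N
  proof -
    have "expectation (\<lambda>\<omega>. (S N \<omega>)\<^sup>2) = (\<Sum>m<N. \<Sum>n<N. expectation (\<lambda>\<omega>. Z m \<omega> * Z n \<omega>))"
      unfolding S_sq using int by (simp add: Bochner_Integration.integral_sum)
    \<comment> \<open>Products at index distance above \<open>D\<close> have mean zero, so each
      \<open>m\<close> keeps at most \<open>2 * D + 1\<close> partners. The truncated subtraction
      only cuts off negative indices.\<close>
    also have "\<dots> \<le> (\<Sum>m<N. \<Sum>n<N. if n \<in> {m - D..m + D} then B\<^sup>2 else 0)"
    proof (intro sum_mono)
      fix m n
      have "n + D < m \<or> m + D < n" if "n \<notin> {m - D..m + D}" using that by auto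
      then show "expectation (\<lambda>\<omega>. Z m \<omega> * Z n \<omega>) \<le> (if n \<in> {m - D..m + D} then B\<^sup>2 else 0)"
        using prod_le[of m n] uncorr[of m n] uncorr[of n m] by (auto simp: mult.commute)
    qed
    also have "\<dots> = (\<Sum>m<N. B\<^sup>2 * real (card ({..<N} \<inter> {m - D..m + D})))"
      by (simp add: sum.If_cases mult.commute Collect_conj_eq atLeastAtMost_def atLeast_def atMost_def)
    also have "\<dots> \<le> (\<Sum>m<N. B\<^sup>2 * real (2 * D + 1))"
    proof (intro sum_mono mult_left_mono)
      fix m
      have "card ({..<N} \<inter> {m - D..m + D}) \<le> card {m - D..m + D}" by (intro card_mono) auto
      also have "\<dots> \<le> 2 * D + 1" by simp
      finally show "real (card ({..<N} \<inter> {m - D..m + D})) \<le> real (2 * D + 1)" by linarith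
    qed simp
    finally show ?thesis by (simp add: mult.commute)
  qed
  \<comment> \<open>Squared averages along the squares, started at 1 so that no denominator
    vanishes. Their expectations are \<open>O(1 / (j + 1)^2)\<close>.\<close>
  define T where "T j \<omega> = (S ((Suc j)\<^sup>2) \<omega> / real ((Suc j)\<^sup>2))\<^sup>2" for j \<omega>
  have T_meas[measurable]: "T j \<in> borel_measurable M" for j unfolding T_def by measurable
  have T_int: "integrable M (T j)" for j
  proof -
    have "T j = (\<lambda>\<omega>. (S ((Suc j)\<^sup>2) \<omega>)\<^sup>2 / (real ((Suc j)\<^sup>2))\<^sup>2)"
      by (simp add: T_def power_divide fun_eq_iff)
    then show ?thesis using S_int by simp
  qed
  define C where "C = real (2 * D + 1) * B\<^sup>2"
  have C0: "0 \<le> C" by (simp add: C_def)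
  have ET: "expectation (T j) \<le> C / (real (Suc j))\<^sup>2" for j
  proof -
    have "expectation (T j) = expectation (\<lambda>\<omega>. (S ((Suc j)\<^sup>2) \<omega>)\<^sup>2) / (real ((Suc j)\<^sup>2))\<^sup>2"
      by (simp add: T_def[abs_def] power_divide)
    also have "\<dots> \<le> real ((Suc j)\<^sup>2) * C / (real ((Suc j)\<^sup>2))\<^sup>2"
      using var[of "(Suc j)\<^sup>2"] unfolding C_def by (intro divide_right_mono) auto
    also have "\<dots> = C / (real (Suc j))\<^sup>2"
      by (simp only: of_nat_power) (simp add: power2_eq_square del: of_nat_Suc)
    finally show ?thesis .
  qed
  have "summable (\<lambda>j. C / (real (Suc j))\<^sup>2)"
    using summable_mult[OF summable_Suc_iff[THEN iffD2, OF inverse_power_summable[of 2, where 'a = real]], of C]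
    by (simp add: field_simps)
  moreover have "norm (expectation (T j)) \<le> C / (real (Suc j))\<^sup>2" for j
    using ET[of j] by (simp add: T_def[abs_def])
  ultimately have sm: "summable (\<lambda>j. expectation (T j))"
    by (intro summable_comparison_test[of "\<lambda>j. expectation (T j)" "\<lambda>j. C / (real (Suc j))\<^sup>2"]) auto
  have "(\<integral>\<^sup>+\<omega>. (\<Sum>j. ennreal (T j \<omega>)) \<partial>M) = (\<Sum>j. \<integral>\<^sup>+\<omega>. ennreal (T j \<omega>) \<partial>M)"
    by (rule nn_integral_suminf) measurable
  also have "\<dots> = (\<Sum>j. ennreal (expectation (T j)))"
    by (intro suminf_cong nn_integral_eq_integral T_int) (simp add: T_def)
  also have "\<dots> = ennreal (\<Sum>j. expectation (T j))"
    by (intro suminf_ennreal2 sm) (simp add: T_def[abs_def])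
  finally have "(\<integral>\<^sup>+\<omega>. (\<Sum>j. ennreal (T j \<omega>)) \<partial>M) \<noteq> \<infinity>" by simp
  \<comment> \<open>In place of a Borel-Cantelli argument: a sum with finite expectation is almost
    surely finite, so its terms tend to 0.\<close>
  then have "AE \<omega> in M. (\<Sum>j. ennreal (T j \<omega>)) \<noteq> \<infinity>"
    by (intro nn_integral_PInf_AE) measurable
  then have sub: "AE \<omega> in M. (\<lambda>j. S ((Suc j)\<^sup>2) \<omega> / real ((Suc j)\<^sup>2)) \<longlonglongrightarrow> 0"
  proof eventually_elim
    case (elim \<omega>)
    then have "summable (\<lambda>j. T j \<omega>)"
      by (intro summable_suminf_not_top) (auto simp: T_def)
    then have "(\<lambda>j. T j \<omega>) \<longlonglongrightarrow> 0" by (rule summable_LIMSEQ_zero)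
    then have "(\<lambda>j. sqrt (T j \<omega>)) \<longlonglongrightarrow> sqrt 0" by (intro tendsto_intros)
    then have "(\<lambda>j. \<bar>S ((Suc j)\<^sup>2) \<omega> / real ((Suc j)\<^sup>2)\<bar>) \<longlonglongrightarrow> 0"
      by (simp only: T_def real_sqrt_abs real_sqrt_zero)
    then show ?case by (rule tendsto_rabs_zero_cancel)
  qed
  have "AE \<omega> in M. \<forall>n. \<bar>Z n \<omega>\<bar> \<le> B" using bnd by (simp add: AE_all_countable)
  with sub show ?thesis
  proof eventually_elim
    case (elim \<omega>)
    have S_diff: "\<bar>S N \<omega> - S m \<omega>\<bar> \<le> real (N - m) * B" if "m \<le> N" for m N
    proof -
      have "S N \<omega> - S m \<omega> = (\<Sum>n\<in>{m..<N}. Z n \<omega>)"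
        unfolding S_def using that by (simp add: sum_diff_nat_ivl lessThan_atLeast0)
      also have "\<bar>\<dots>\<bar> \<le> (\<Sum>n\<in>{m..<N}. B)"
        by (rule order_trans[OF sum_abs]) (intro sum_mono, use elim in auto)
      finally show ?thesis by simp
    qed
    \<comment> \<open>For \<open>j^2 \<le> N < (j + 1)^2\<close> at most \<open>2 j + 1\<close>
      further terms, each bounded by \<open>B\<close>, separate the sum up to \<open>N\<close> from
      the sum up to \<open>j^2\<close>. Dividing by \<open>j^2\<close> gives the three
      summands.\<close>
    define a where "a j = \<bar>S (j\<^sup>2) \<omega> / real (j\<^sup>2)\<bar> + 2 * B / real j + B / (real j)\<^sup>2" for j
    have a: "a \<longlonglongrightarrow> 0"
    proof -
      have "(\<lambda>j. S (j\<^sup>2) \<omega> / real (j\<^sup>2)) \<longlonglongrightarrow> 0"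
        using elim(1) by (rule LIMSEQ_imp_Suc)
      then have 1: "(\<lambda>j. \<bar>S (j\<^sup>2) \<omega> / real (j\<^sup>2)\<bar>) \<longlonglongrightarrow> 0" by (rule tendsto_rabs_zero)
      have 2: "(\<lambda>j. 2 * B / real j) \<longlonglongrightarrow> 0" by (rule lim_const_over_n)
      have 3: "(\<lambda>j. B / (real j)\<^sup>2) \<longlonglongrightarrow> 0"
        using tendsto_mult_zero[OF lim_const_over_n[of B] lim_const_over_n[of 1]] by (simp add: power2_eq_square)
      show ?thesis unfolding a_def using tendsto_add[OF tendsto_add[OF 1 2] 3] by simp
    qed
    have "filterlim floor_sqrt at_top sequentially"
      unfolding filterlim_at_top eventually_sequentially by (metis le_floor_sqrt_iff)
    then have lim: "(\<lambda>N. a (floor_sqrt N)) \<longlonglongrightarrow> 0" using filterlim_compose[OF a] by blast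
    have "\<forall>\<^sub>F N in sequentially. norm (S N \<omega> / real N) \<le> a (floor_sqrt N)"
      using eventually_gt_at_top[of 0]
    proof eventually_elim
      case (elim N)
      define j where "j = floor_sqrt N"
      have j: "j\<^sup>2 \<le> N" "N < (Suc j)\<^sup>2" "0 < j"
        using elim by (simp_all add: j_def Suc_floor_sqrt_power2_gt)
      have N: "N - j\<^sup>2 \<le> 2 * j + 1" using j by (simp add: power2_eq_square)
      have jr: "0 < real (j\<^sup>2)" using j by simp
      have "\<bar>S N \<omega>\<bar> \<le> \<bar>S (j\<^sup>2) \<omega>\<bar> + real (N - j\<^sup>2) * B" using S_diff[OF j(1)] by linarith
      also have "\<dots> \<le> \<bar>S (j\<^sup>2) \<omega>\<bar> + real (2 * j + 1) * B"
        using N B by (intro add_left_mono mult_right_mono) (auto simp only: of_nat_le_iff)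
      finally have "\<bar>S N \<omega>\<bar> \<le> \<bar>S (j\<^sup>2) \<omega>\<bar> + real (2 * j + 1) * B" .
      then have "\<bar>S N \<omega>\<bar> / real N \<le> (\<bar>S (j\<^sup>2) \<omega>\<bar> + real (2 * j + 1) * B) / real (j\<^sup>2)"
        using j jr B by (intro frac_le) (auto simp only: of_nat_le_iff intro!: add_nonneg_nonneg mult_nonneg_nonneg)
      also have "\<dots> = a j"
        using jr by (simp add: a_def add_divide_distrib power2_eq_square distrib_right)
      finally show ?case by (simp add: j_def)
    qed
    then have "(\<lambda>N. S N \<omega> / real N) \<longlonglongrightarrow> 0"
      using lim by (rule Lim_null_comparison)
    then show ?case by (simp add: S_def)
  qed
qed

section \<open>The Hilbert space of the chain\<close>

lemma norm_ell2_sq: "(norm \<phi>)\<^sup>2 = (\<Sum>\<^sub>\<infinity>n. (cmod (entry \<phi> n))\<^sup>2)"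
  by (simp add: norm_eq_sqrt_inner inner_ell2_def power2_norm_eq_inner infsum_nonneg)

lemma norm_entry_le: "cmod (entry \<phi> n) \<le> norm \<phi>"
proof -
  have "(\<Sum>\<^sub>\<infinity>m\<in>{n}. (cmod (entry \<phi> m))\<^sup>2) \<le> (\<Sum>\<^sub>\<infinity>m. (cmod (entry \<phi> m))\<^sup>2)"
    using square_summable_entry[of \<phi>] unfolding square_summable_def
    by (intro infsum_mono_neutral) (auto simp: summable_on_finite)
  then have "(cmod (entry \<phi> n))\<^sup>2 \<le> (norm \<phi>)\<^sup>2" by (simp add: norm_ell2_sq)
  then show ?thesis by (simp add: power2_le_iff_abs_le)
qed

lemma norm_ell2_leI:
  assumes "\<And>F. finite F \<Longrightarrow> (\<Sum>n\<in>F. (cmod (entry \<phi> n))\<^sup>2) \<le> c\<^sup>2" and "0 \<le> c"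
  shows "norm \<phi> \<le> c"
proof -
  have "(\<Sum>\<^sub>\<infinity>n. (cmod (entry \<phi> n))\<^sup>2) \<le> c\<^sup>2"
    using square_summable_entry[of \<phi>] assms(1) unfolding square_summable_def
    by (intro infsum_le_finite_sums) auto
  then show ?thesis using assms(2) by (simp add: norm_ell2_sq[symmetric] power2_le_iff_abs_le)
qed

lemma sum_entry_le: "finite F \<Longrightarrow> (\<Sum>n\<in>F. (cmod (entry \<phi> n))\<^sup>2) \<le> (norm \<phi>)\<^sup>2"
  using square_summable_entry[of \<phi>] unfolding square_summable_def norm_ell2_sq
  by (intro finite_sum_le_infsum) auto

lemma square_summableI:
  assumes "\<And>F. finite F \<Longrightarrow> (\<Sum>n\<in>F. (cmod (\<phi> n))\<^sup>2) \<le> c"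
  shows "square_summable \<phi>"
  unfolding square_summable_def
  by (rule nonneg_bounded_partial_sums_imp_summable_on[where C = c]) (use assms in \<open>auto intro: eventually_finite_subsets_at_top_weakI\<close>)

lemma entry_Abs: "square_summable \<phi> \<Longrightarrow> entry (Abs_ell2 \<phi>) = \<phi>"
  by (simp add: Abs_ell2_inverse)

lemma ell2_eqI: "(\<And>n. entry \<phi> n = entry \<psi> n) \<Longrightarrow> \<phi> = \<psi>"
  by (simp add: entry_inject[symmetric] fun_eq_iff)

instance ell2 :: banach
proof
  fix X :: "nat \<Rightarrow> ell2" assume X: "Cauchy X"
  have "Cauchy (\<lambda>k. entry (X k) n)" for n
  proof (rule metric_CauchyI)
    fix e :: real assume "0 < e"
    then obtain N where N: "\<And>k l. N \<le> k \<Longrightarrow> N \<le> l \<Longrightarrow> dist (X k) (X l) < e"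
      using metric_CauchyD[OF X] by blast
    have "dist (entry (X k) n) (entry (X l) n) \<le> dist (X k) (X l)" for k l
      using norm_entry_le[of "X k - X l" n] by (simp add: dist_norm minus_ell2.rep_eq)
    then show "\<exists>N. \<forall>k\<ge>N. \<forall>l\<ge>N. dist (entry (X k) n) (entry (X l) n) < e"
      using N by (meson le_less_trans)
  qed
  then have "\<exists>l. (\<lambda>k. entry (X k) n) \<longlonglongrightarrow> l" for n
    by (simp add: Cauchy_convergent_iff convergent_def)
  then obtain \<phi> where \<phi>: "\<And>n. (\<lambda>k. entry (X k) n) \<longlonglongrightarrow> \<phi> n" by metis
  have lim: "(\<Sum>n\<in>F. (cmod (entry (X k) n - \<phi> n))\<^sup>2) \<le> e\<^sup>2"
    if "finite F" and k: "\<And>l. N \<le> l \<Longrightarrow> dist (X k) (X l) \<le> e" for F k N e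
  proof (rule LIMSEQ_le_const2)
    show "(\<lambda>l. \<Sum>n\<in>F. (cmod (entry (X k) n - entry (X l) n))\<^sup>2) \<longlonglongrightarrow> (\<Sum>n\<in>F. (cmod (entry (X k) n - \<phi> n))\<^sup>2)"
      by (intro tendsto_intros \<phi>)
    have "(\<Sum>n\<in>F. (cmod (entry (X k) n - entry (X l) n))\<^sup>2) \<le> e\<^sup>2" if "N \<le> l" for l
    proof -
      have "(\<Sum>n\<in>F. (cmod (entry (X k) n - entry (X l) n))\<^sup>2) \<le> (norm (X k - X l))\<^sup>2"
        using sum_entry_le[OF \<open>finite F\<close>, of "X k - X l"] by (simp add: minus_ell2.rep_eq)
      also have "\<dots> \<le> e\<^sup>2" using k[OF that] by (simp add: dist_norm power_mono)
      finally show ?thesis .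
    qed
    then show "\<exists>N. \<forall>l\<ge>N. (\<Sum>n\<in>F. (cmod (entry (X k) n - entry (X l) n))\<^sup>2) \<le> e\<^sup>2" by blast
  qed
  have sq: "square_summable \<phi>"
  proof -
    obtain N where N: "\<And>k l. N \<le> k \<Longrightarrow> N \<le> l \<Longrightarrow> dist (X k) (X l) < 1"
      using metric_CauchyD[OF X, of 1] by auto
    have "square_summable (\<lambda>n. entry (X N) n - \<phi> n)"
    proof (rule square_summableI)
      fix F :: "int set" assume "finite F"
      then show "(\<Sum>n\<in>F. (cmod (entry (X N) n - \<phi> n))\<^sup>2) \<le> 1\<^sup>2"
        by (rule lim) (use N[of N] in \<open>auto intro: less_imp_le\<close>)
    qed
    from square_summable_diff[OF square_summable_entry[of "X N"] this] show ?thesis by simp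
  qed
  have "X \<longlonglongrightarrow> Abs_ell2 \<phi>"
  proof (rule metric_LIMSEQ_I)
    fix e :: real assume e: "0 < e"
    then obtain N where N: "\<And>k l. N \<le> k \<Longrightarrow> N \<le> l \<Longrightarrow> dist (X k) (X l) < e / 2"
      using metric_CauchyD[OF X, of "e / 2"] by auto
    have "dist (X k) (Abs_ell2 \<phi>) \<le> e / 2" if "N \<le> k" for k
      unfolding dist_norm
    proof (rule norm_ell2_leI)
      fix F :: "int set" assume "finite F"
      then have "(\<Sum>n\<in>F. (cmod (entry (X k) n - \<phi> n))\<^sup>2) \<le> (e / 2)\<^sup>2"
        by (rule lim) (use N[OF that] in \<open>auto intro: less_imp_le\<close>)
      then show "(\<Sum>n\<in>F. (cmod (entry (X k - Abs_ell2 \<phi>) n))\<^sup>2) \<le> (e / 2)\<^sup>2"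
        by (simp add: minus_ell2.rep_eq entry_Abs[OF sq])
    qed (use e in simp)
    then show "\<exists>N. \<forall>k\<ge>N. dist (X k) (Abs_ell2 \<phi>) < e"
      using e by (intro exI[of _ N]) force
  qed
  then show "convergent X" by (auto simp: convergent_def)
qed

lemma scaleC_simps:
  "c *\<^sub>C (\<phi> + \<psi>) = c *\<^sub>C \<phi> + c *\<^sub>C \<psi>" "(c + d) *\<^sub>C \<psi> = c *\<^sub>C \<psi> + d *\<^sub>C \<psi>"
  "c *\<^sub>C (d *\<^sub>C \<psi>) = (c * d) *\<^sub>C \<psi>" "complex_of_real r *\<^sub>C \<psi> = r *\<^sub>R \<psi>" "c *\<^sub>C 0 = 0"
  by (auto simp: scaleC_def prod_eq_iff intro!: ell2_eqI
      simp: scaleC_ell2.rep_eq plus_ell2.rep_eq scaleR_ell2.rep_eq zero_ell2.rep_eq algebra_simps)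

lemma scaleC_Complex: "c *\<^sub>C \<psi> = Re c *\<^sub>R \<psi> + Im c *\<^sub>R (\<i> *\<^sub>C \<psi>)"
proof -
  have "c *\<^sub>C \<psi> = (of_real (Re c) + of_real (Im c) * \<i>) *\<^sub>C \<psi>"
    by (rule arg_cong[where f = "\<lambda>c. c *\<^sub>C \<psi>"]) (simp add: complex_eq_iff)
  then show ?thesis by (simp add: scaleC_simps flip: scaleC_simps(3,4))
qed

lemma inner_state: "\<phi> \<bullet> \<psi> = (\<Sum>\<^sub>\<infinity>n. entry (fst \<phi>) n \<bullet> entry (fst \<psi>) n) + (\<Sum>\<^sub>\<infinity>n. entry (snd \<phi>) n \<bullet> entry (snd \<psi>) n)"
  for \<phi> \<psi> :: state
  by (simp add: inner_prod_def inner_ell2_def)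

lemma entry_cnj_summable: "(\<lambda>n. cnj (entry \<phi> n) * entry \<psi> n) summable_on UNIV"
  by (rule abs_summable_summable, rule Infinite_Sum.abs_summable_on_comparison_test'[OF entry_summable_mult[of \<phi> \<psi>]])
     (simp add: norm_mult)

lemma Re_cinner: "Re (cinner \<phi> \<psi>) = \<phi> \<bullet> \<psi>"
  unfolding cinner_def inner_state plus_complex.sel
  by (simp add: infsum_Re[OF entry_cnj_summable, symmetric] inner_complex_def)

text \<open>\<open>cinner\<close> is conjugate linear in its first argument, so a factor i there
  becomes -i outside. Identities for \<open>cinner\<close> can thus be checked on the real inner
  product at \<open>\<phi>\<close> and at its multiple by i.\<close>

lemma Im_cinner: "Im (cinner \<phi> \<psi>) = (\<i> *\<^sub>C \<phi>) \<bullet> \<psi>"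
  unfolding cinner_def inner_state plus_complex.sel
  by (simp add: infsum_Im[OF entry_cnj_summable, symmetric] inner_complex_def scaleC_def scaleC_ell2.rep_eq)

lemma inner_i_i: "(\<i> *\<^sub>C \<phi>) \<bullet> (\<i> *\<^sub>C \<psi>) = \<phi> \<bullet> \<psi>"
  by (simp add: inner_state inner_complex_def scaleC_def scaleC_ell2.rep_eq)
    (simp add: add.commute)

lemma inner_i_left: "(\<i> *\<^sub>C \<phi>) \<bullet> \<psi> = - (\<phi> \<bullet> (\<i> *\<^sub>C \<psi>))"
proof -
  have "\<i> *\<^sub>C (\<i> *\<^sub>C \<psi>) = - \<psi>"
    using scaleC_simps(4)[of "-1" \<psi>] by (simp add: scaleC_simps(3))
  then show ?thesis using inner_i_i[of \<phi> "\<i> *\<^sub>C \<psi>"] by simp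
qed

lemma norm_scaleC_i: "norm (\<i> *\<^sub>C \<psi>) = norm \<psi>"
  by (simp add: norm_eq_sqrt_inner inner_i_i)

lemma bounded_linear_scaleC: "bounded_linear (\<lambda>\<psi>. c *\<^sub>C \<psi>)"
proof (rule bounded_linear_intro)
  show "c *\<^sub>C (\<phi> + \<psi>) = c *\<^sub>C \<phi> + c *\<^sub>C \<psi>" for \<phi> \<psi> by (rule scaleC_simps)
  show "c *\<^sub>C r *\<^sub>R \<psi> = r *\<^sub>R c *\<^sub>C \<psi>" for r \<psi>
    by (simp add: scaleC_simps(3) mult.commute flip: scaleC_simps(4))
  show "norm (c *\<^sub>C \<psi>) \<le> norm \<psi> * (\<bar>Re c\<bar> + \<bar>Im c\<bar>)" for \<psi>
    unfolding scaleC_Complex[of c]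
    by (rule order_trans[OF norm_triangle_ineq]) (simp add: norm_scaleC_i algebra_simps)
qed

lemma bounded_clinearI:
  assumes "bounded_linear B" "\<And>\<psi>. B (\<i> *\<^sub>C \<psi>) = \<i> *\<^sub>C B \<psi>"
  shows "bounded_clinear B"
  unfolding bounded_clinear_def
proof (intro conjI allI)
  interpret bounded_linear B by fact
  show "B (c *\<^sub>C \<psi>) = c *\<^sub>C B \<psi>" for c \<psi>
    by (simp only: scaleC_Complex[of c] add scale assms(2))
qed (rule assms)

section \<open>Uniqueness of the functional calculus\<close>

lemma C0_add: "f \<in> C0 \<Longrightarrow> g \<in> C0 \<Longrightarrow> (\<lambda>x. f x + g x) \<in> C0"
  unfolding C0_def using tendsto_add[of f 0 at_infinity g 0] by (auto intro: continuous_intros)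

lemma C0_mult: "f \<in> C0 \<Longrightarrow> g \<in> C0 \<Longrightarrow> (\<lambda>x. f x * g x) \<in> C0"
  unfolding C0_def using tendsto_mult[of f 0 at_infinity g 0] by (auto intro: continuous_intros)

lemma C0_scale: "f \<in> C0 \<Longrightarrow> (\<lambda>x. c * f x) \<in> C0"
  unfolding C0_def using tendsto_mult[OF tendsto_const, of f 0 at_infinity c] by (auto intro: continuous_intros)

lemma C0_cnj: "f \<in> C0 \<Longrightarrow> (\<lambda>x. cnj (f x)) \<in> C0"
  unfolding C0_def using tendsto_cnj[of f 0 at_infinity] by (auto intro: continuous_intros)

lemma C0_resolvent:
  assumes "Im z \<noteq> 0"
  shows "(\<lambda>x. 1 / (complex_of_real x - z)) \<in> C0"
proof -
  have nz: "complex_of_real x - z \<noteq> 0" for x using assms by (auto simp: complex_eq_iff)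
  have "filterlim (\<lambda>x::real. complex_of_real x) at_infinity at_infinity"
    by (rule filterlim_norm_at_top_imp_at_infinity)
      (use filterlim_at_infinity_imp_norm_at_top[OF filterlim_ident[of "at_infinity :: real filter"]] in simp)
  then have "filterlim (\<lambda>x. complex_of_real x - z) at_infinity at_infinity"
    using tendsto_add_filterlim_at_infinity'[OF _ tendsto_const, of complex_of_real at_infinity "- z"] by simp
  then have "((\<lambda>x. 1 / (complex_of_real x - z)) \<longlongrightarrow> 0) at_infinity"
    by (intro tendsto_divide_0[OF tendsto_const])
  moreover have "continuous_on UNIV (\<lambda>x. 1 / (complex_of_real x - z))"
    using nz by (intro continuous_intros) auto
  ultimately show ?thesis by (simp add: C0_def)
qed

lemma is_resolvent_unique:
  assumes "is_resolvent A z R" "is_resolvent A z R'"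
  shows "R = R'"
proof
  fix \<phi>
  obtain u where u: "A (R \<phi>) = Some u" "u - z *\<^sub>C R \<phi> = \<phi>"
    using assms(1) unfolding is_resolvent_def by blast
  then have "R' (u - z *\<^sub>C R \<phi>) = R \<phi>" using assms(2) unfolding is_resolvent_def by blast
  then show "R \<phi> = R' \<phi>" using u by simp
qed

lemma C0_calculusD:
  assumes "C0_calculus A \<Phi>" "f \<in> C0"
  shows "g \<in> C0 \<Longrightarrow> \<Phi> (\<lambda>x. f x + g x) \<psi> = \<Phi> f \<psi> + \<Phi> g \<psi>"
    and "\<Phi> (\<lambda>x. c * f x) \<psi> = c *\<^sub>C \<Phi> f \<psi>"
    and "g \<in> C0 \<Longrightarrow> \<Phi> (\<lambda>x. f x * g x) \<psi> = \<Phi> f (\<Phi> g \<psi>)"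
    and "cinner \<phi> (\<Phi> (\<lambda>x. cnj (f x)) \<psi>) = cinner (\<Phi> f \<phi>) \<psi>"
  using assms unfolding C0_calculus_def by (simp_all del: split_paired_All)

text \<open>With \<open>k = s - sqrt (s\<^sup>2 - \<bar>f\<bar>\<^sup>2)\<close>, which vanishes at infinity, \<open>s\<^sup>2 - \<bar>f\<bar>\<^sup>2 = (s - k)\<^sup>2\<close> is a square.\<close>

lemma C0_calculus_contractive:
  assumes \<Phi>: "C0_calculus A \<Phi>" and f: "f \<in> C0" and s: "\<And>x. cmod (f x) \<le> s"
  shows "norm (\<Phi> f \<psi>) \<le> s * norm \<psi>"
proof -
  have s0: "0 \<le> s" using s[of 0] norm_ge_zero order_trans by blast
  define k where "k x = complex_of_real (s - sqrt (s\<^sup>2 - (cmod (f x))\<^sup>2))" for x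
  have k: "k \<in> C0"
  proof -
    have "((\<lambda>x. complex_of_real (s - sqrt (s\<^sup>2 - (cmod (f x))\<^sup>2))) \<longlongrightarrow> complex_of_real (s - sqrt (s\<^sup>2 - (cmod 0)\<^sup>2))) at_infinity"
      using f by (intro tendsto_intros) (auto simp: C0_def)
    then have "(k \<longlongrightarrow> 0) at_infinity" using s0 by (simp add: k_def[abs_def])
    moreover have "continuous_on UNIV k"
      using f unfolding k_def[abs_def] C0_def by (auto intro!: continuous_intros)
    ultimately show ?thesis by (simp add: C0_def)
  qed
  \<comment> \<open>The constant \<open>s^2\<close> does not vanish at infinity, so the identity is
    solved for \<open>|f|^2 = 2 s k - k^2\<close>, all of whose terms lie in
    \<open>C0\<close>.\<close>
  have ff: "(\<lambda>x. cnj (f x) * f x) = (\<lambda>x. complex_of_real (2 * s) * k x + (-1) * (k x * k x))"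
  proof
    fix x
    have "(cmod (f x))\<^sup>2 \<le> s\<^sup>2" using s[of x] by (intro power_mono) auto
    then have "(sqrt (s\<^sup>2 - (cmod (f x))\<^sup>2))\<^sup>2 = s\<^sup>2 - (cmod (f x))\<^sup>2" by simp
    then have "2 * s * (s - sqrt (s\<^sup>2 - (cmod (f x))\<^sup>2)) - (s - sqrt (s\<^sup>2 - (cmod (f x))\<^sup>2))\<^sup>2 = (cmod (f x))\<^sup>2"
      by (simp add: power2_eq_square algebra_simps)
    then have "complex_of_real (2 * s) * k x + (-1) * (k x * k x) = complex_of_real ((cmod (f x))\<^sup>2)"
      unfolding k_def by (simp add: power2_eq_square flip: of_real_mult of_real_diff)
    then show "cnj (f x) * f x = complex_of_real (2 * s) * k x + (-1) * (k x * k x)"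
      by (simp only: complex_norm_square mult.commute)
  qed
  note add = C0_calculusD(1)[OF \<Phi>] and scale = C0_calculusD(2)[OF \<Phi>]
    and mult = C0_calculusD(3)[OF \<Phi>] and adj = C0_calculusD(4)[OF \<Phi>]
  have kcnj: "(\<lambda>x. cnj (k x)) = k" by (simp add: k_def fun_eq_iff)
  have "(norm (\<Phi> f \<psi>))\<^sup>2 = Re (cinner (\<Phi> f \<psi>) (\<Phi> f \<psi>))"
    by (simp add: Re_cinner power2_norm_eq_inner)
  also have "\<dots> = Re (cinner \<psi> (\<Phi> (\<lambda>x. cnj (f x) * f x) \<psi>))"
    using adj[OF f, of \<psi> "\<Phi> f \<psi>"] mult[OF C0_cnj[OF f] f, of \<psi>] by simp
  also have "\<dots> = \<psi> \<bullet> (\<Phi> (\<lambda>x. complex_of_real (2 * s) * k x + (-1) * (k x * k x)) \<psi>)"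
    by (simp only: ff Re_cinner)
  also have "\<dots> = \<psi> \<bullet> (complex_of_real (2 * s) *\<^sub>C \<Phi> k \<psi> + complex_of_real (-1) *\<^sub>C \<Phi> k (\<Phi> k \<psi>))"
    using add[OF C0_scale[OF k, of "complex_of_real (2 * s)"] C0_scale[OF C0_mult[OF k k], of "-1"], of \<psi>]
    by (simp only: scale[OF k] scale[OF C0_mult[OF k k]] mult[OF k k] of_real_minus of_real_1)
  also have "\<dots> = 2 * s * (\<psi> \<bullet> \<Phi> k \<psi>) - \<psi> \<bullet> \<Phi> k (\<Phi> k \<psi>)"
    by (simp only: scaleC_simps(4)) (simp add: inner_add_right inner_diff_right)
  also have "\<psi> \<bullet> \<Phi> k (\<Phi> k \<psi>) = \<Phi> k \<psi> \<bullet> \<Phi> k \<psi>"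
    using adj[OF k, of \<psi> "\<Phi> k \<psi>"] by (simp add: kcnj flip: Re_cinner)
  \<comment> \<open>Completing the square: the difference of the two sides is the squared norm of
    \<open>s *\<^sub>R \<psi> - \<Phi> k \<psi>\<close>.\<close>
  also have "2 * s * (\<psi> \<bullet> \<Phi> k \<psi>) - \<Phi> k \<psi> \<bullet> \<Phi> k \<psi> \<le> s\<^sup>2 * (\<psi> \<bullet> \<psi>)"
    using inner_ge_zero[of "s *\<^sub>R \<psi> - \<Phi> k \<psi>"]
    by (simp add: inner_diff_left inner_diff_right inner_commute power2_eq_square algebra_simps)
  finally have "(norm (\<Phi> f \<psi>))\<^sup>2 \<le> (s * norm \<psi>)\<^sup>2"
    by (simp add: power_mult_distrib power2_norm_eq_inner)
  then show ?thesis using s0 by (simp add: abs_le_square_iff[symmetric])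
qed

text \<open>Continuous functions vanishing at infinity are pulled back from the unit circle by the Cayley transform
  \<open>w x = (x - i) / (x + i)\<close>, which sends infinity to 1 and has real and imaginary parts \<open>1 - 2 / (x\<^sup>2 + 1)\<close> and \<open>-2 x / (x\<^sup>2 + 1)\<close>.\<close>

lemma C0_resolvent_dense:
  fixes E :: "(real \<Rightarrow> complex) set"
  assumes res: "(\<lambda>x. 1 / (complex_of_real x - \<i>)) \<in> E" "(\<lambda>x. 1 / (complex_of_real x + \<i>)) \<in> E"
    and add: "\<And>f g. f \<in> E \<Longrightarrow> g \<in> E \<Longrightarrow> (\<lambda>x. f x + g x) \<in> E"
    and mult: "\<And>f g. f \<in> E \<Longrightarrow> g \<in> E \<Longrightarrow> (\<lambda>x. f x * g x) \<in> E"
    and scale: "\<And>c f. f \<in> E \<Longrightarrow> (\<lambda>x. c * f x) \<in> E"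
    and E: "E \<subseteq> C0"
    and g: "g \<in> C0" and e: "0 < e"
  shows "\<exists>f\<in>E. \<forall>x. cmod (g x - f x) \<le> e"
proof -
  define w where "w x = (complex_of_real x - \<i>) / (complex_of_real x + \<i>)" for x :: real
  have nz: "complex_of_real x + \<i> \<noteq> 0" "complex_of_real x - \<i> \<noteq> 0" for x by (auto simp: complex_eq_iff)
  \<comment> \<open>The inverse of the Cayley transform; on the unit circle the quotient is real,
    and the real part extends it to a real function elsewhere.\<close>
  define v where "v z = Re (\<i> * (1 + z) / (1 - z))" for z :: complex
  have w1: "w x \<noteq> 1" for x using nz[of x] by (auto simp: w_def divide_eq_1_iff dest: arg_cong[where f = Im])
  have vw: "v (w x) = x" for x
  proof -
    have "\<i> * (1 + w x) / (1 - w x) = complex_of_real x"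
      using nz[of x] w1[of x] by (simp add: w_def field_simps)
    then show ?thesis by (simp add: v_def)
  qed
  have real_case: "\<exists>f\<in>E. \<forall>x. cmod (complex_of_real (r x) - f x) \<le> e"
    if r: "continuous_on UNIV r" "(r \<longlongrightarrow> 0) at_infinity" and e: "0 < e" for r :: "real \<Rightarrow> real" and e :: real
  proof -
    define S where "S = sphere (0::complex) 1"
    have wS: "w x \<in> S" for x
    proof -
      have "cmod (complex_of_real x - \<i>) = cmod (complex_of_real x + \<i>)" by (simp add: cmod_def)
      then show ?thesis using nz[of x] by (simp add: S_def w_def norm_divide)
    qed
    \<comment> \<open>The point 1 of the circle stands for infinity, where \<open>r\<close> has
      limit 0.\<close>
    define F where "F z = (if z = 1 then 0 else r (v z))" for z
    have "continuous_on S F"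
      unfolding continuous_on_eq_continuous_within
    proof
      fix z assume z: "z \<in> S"
      show "continuous (at z within S) F"
      proof (cases "z = 1")
        case False
        have "isCont v z"
          unfolding v_def[abs_def] using False by (intro isCont_Re continuous_intros) simp
        moreover have "isCont r (v z)"
          using r(1) by (simp add: continuous_on_eq_continuous_at)
        ultimately have "isCont (\<lambda>z. r (v z)) z" by (rule isCont_o2)
        moreover have "\<forall>\<^sub>F y in nhds z. F y = r (v y)"
          using t1_space_nhds[OF False] by eventually_elim (simp add: F_def)
        ultimately have "isCont F z" by (simp add: isCont_cong)
        then show ?thesis by (rule continuous_at_imp_continuous_at_within)
      next
        case True
        have "filterlim v at_infinity (at 1 within S)"
        proof -
          have "filterlim (\<lambda>z::complex. \<i> * (1 + z) / (1 - z)) at_infinity (at 1 within S)"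
          proof (rule filterlim_divide_at_infinity)
            show "((\<lambda>z. \<i> * (1 + z)) \<longlongrightarrow> \<i> * (1 + 1)) (at 1 within S)" by (intro tendsto_intros)
            show "filterlim (\<lambda>z. 1 - z) (at (0::complex)) (at 1 within S)"
              unfolding filterlim_at by (auto intro!: tendsto_eq_intros simp: eventually_at_filter)
          qed simp
          then have lim: "filterlim (\<lambda>z::complex. norm (\<i> * (1 + z) / (1 - z))) at_top (at 1 within S)"
            by (rule filterlim_at_infinity_imp_norm_at_top)
          \<comment> \<open>The quotient tends to infinity at 1; since it is real on the circle, its
            real part \<open>v\<close> does so too.\<close>
          have "\<forall>\<^sub>F z in at 1 within S. norm (\<i> * (1 + z) / (1 - z)) = norm (v z)"
            unfolding eventually_at_filter
          proof (intro always_eventually allI impI)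
            fix z :: complex assume "z \<noteq> 1" "z \<in> S"
            then have "(Re z)\<^sup>2 + (Im z)\<^sup>2 = 1" by (simp add: S_def cmod_def)
            then have "Im (\<i> * (1 + z) / (1 - z)) = 0"
              by (simp add: Im_divide power2_eq_square algebra_simps)
            then show "norm (\<i> * (1 + z) / (1 - z)) = norm (v z)"
              unfolding v_def by (simp only: cmod_def) simp
          qed
          from filterlim_cong[OF refl refl this] lim
          have "filterlim (\<lambda>z. norm (v z)) at_top (at 1 within S)" by (rule iffD1)
          then show ?thesis by (rule filterlim_norm_at_top_imp_at_infinity)
        qed
        then have "((\<lambda>z. r (v z)) \<longlongrightarrow> 0) (at 1 within S)" by (rule filterlim_compose[OF r(2)])
        moreover have "\<forall>\<^sub>F z in at 1 within S. r (v z) = F z"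
          unfolding eventually_at_filter by (simp add: F_def)
        ultimately have "(F \<longlongrightarrow> 0) (at 1 within S)" by (rule Lim_transform_eventually)
        then show ?thesis by (simp add: True continuous_within F_def)
      qed
    qed
    moreover have "compact S" by (simp add: S_def)
    ultimately obtain p where p: "real_polynomial_function p" "\<And>z. z \<in> S \<Longrightarrow> \<bar>F z - p z\<bar> < e / 2"
      using Stone_Weierstrass_real_polynomial_function[of S F "e / 2"] e by auto
    \<comment> \<open>Constants do not belong to \<open>C0\<close>, so polynomials in
      \<open>w\<close> are only obtained as a constant plus an element of \<open>E\<close>; this
      form survives sums and products.\<close>
    have "\<exists>c. \<exists>f\<in>E. \<forall>x. complex_of_real (p (w x)) = c + f x"
      using p(1)
    proof (induction rule: real_polynomial_function.induct)
      case (linear q)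
      let ?a = "\<lambda>x. 1 / (complex_of_real x - \<i>)" and ?b = "\<lambda>x. 1 / (complex_of_real x + \<i>)"
      have wx: "Re (w x) = 1 - 2 / (x\<^sup>2 + 1)" "Im (w x) = - 2 * x / (x\<^sup>2 + 1)" for x
      proof -
        have pos: "x\<^sup>2 + 1 \<noteq> 0" by (metis add_nonneg_eq_0_iff zero_le_power2 zero_le_one zero_neq_one)
        have "w x = Complex (1 - 2 / (x\<^sup>2 + 1)) (- 2 * x / (x\<^sup>2 + 1))"
        proof -
          have "complex_of_real x - \<i> = Complex (1 - 2 / (x\<^sup>2 + 1)) (- 2 * x / (x\<^sup>2 + 1)) * (complex_of_real x + \<i>)"
            using pos by (simp add: complex_eq_iff divide_simps) (simp add: power2_eq_square algebra_simps)
          then show ?thesis unfolding w_def using nz(1)[of x] by (metis nonzero_mult_div_cancel_right)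
        qed
        then show "Re (w x) = 1 - 2 / (x\<^sup>2 + 1)" "Im (w x) = - 2 * x / (x\<^sup>2 + 1)" by simp_all
      qed
      have ab: "complex_of_real (1 / (x\<^sup>2 + 1)) = ?a x * ?b x"
        "complex_of_real (x / (x\<^sup>2 + 1)) = (1 / 2) * (?a x + ?b x)" for x
      proof -
        have "(complex_of_real x - \<i>) * (complex_of_real x + \<i>) = complex_of_real (x\<^sup>2 + 1)"
          by (simp add: power2_eq_square algebra_simps)
        then show "complex_of_real (1 / (x\<^sup>2 + 1)) = ?a x * ?b x" by simp
        have "?a x + ?b x = 2 * complex_of_real x * (?a x * ?b x)"
          using nz[of x] by (simp add: field_simps)
        also have "?a x * ?b x = complex_of_real (1 / (x\<^sup>2 + 1))"
          using \<open>complex_of_real (1 / (x\<^sup>2 + 1)) = ?a x * ?b x\<close> by simp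
        finally show "complex_of_real (x / (x\<^sup>2 + 1)) = (1 / 2) * (?a x + ?b x)" by simp
      qed
      have q: "q z = Re z * q 1 + Im z * q \<i>" for z
      proof -
        have "q (Re z *\<^sub>R 1 + Im z *\<^sub>R \<i>) = Re z * q 1 + Im z * q \<i>"
          using linear by (simp only: bounded_linear.linear linear_add linear_scale real_scaleR_def)
        moreover have "Re z *\<^sub>R 1 + Im z *\<^sub>R \<i> = z" by (simp add: complex_eq_iff)
        ultimately show ?thesis by simp
      qed
      let ?f = "\<lambda>x. complex_of_real (- 2 * q 1) * (?a x * ?b x) + complex_of_real (- q \<i>) * (?a x + ?b x)"
      have fE: "?f \<in> E" by (intro add scale mult res)
      have "complex_of_real (q (w x)) = complex_of_real (q 1) + ?f x" for x
      proof -
        have "q (w x) = q 1 + (- 2 * q 1) * (1 / (x\<^sup>2 + 1)) + (- 2 * q \<i>) * (x / (x\<^sup>2 + 1))"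
          by (subst q) (simp add: wx algebra_simps)
        then have "complex_of_real (q (w x)) = complex_of_real (q 1) + complex_of_real (- 2 * q 1) * complex_of_real (1 / (x\<^sup>2 + 1))
            + complex_of_real (- 2 * q \<i>) * complex_of_real (x / (x\<^sup>2 + 1))"
          by (simp only: of_real_add of_real_mult)
        moreover have "complex_of_real (- 2 * q \<i>) * ((1 / 2) * y) = complex_of_real (- q \<i>) * y" for y by simp
        ultimately show ?thesis unfolding ab by (simp only: add.assoc)
      qed
      then show ?case by (intro exI[of _ "complex_of_real (q 1)"] bexI[of _ ?f] allI fE)
    next
      case (const c)
      have "(\<lambda>x. 0) \<in> E" using scale[OF res(1), of 0] by simp
      then show ?case by (intro exI[of _ "complex_of_real c"] bexI[of _ "\<lambda>x. 0"]) auto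
    next
      case (add p q)
      then obtain c f d h where "f \<in> E" "h \<in> E" "\<And>x. complex_of_real (p (w x)) = c + f x" "\<And>x. complex_of_real (q (w x)) = d + h x"
        by blast
      then show ?case
        by (intro exI[of _ "c + d"] bexI[of _ "\<lambda>x. f x + h x"]) (auto intro: assms(3))
    next
      case (mult p q)
      then obtain c f d h where fh: "f \<in> E" "h \<in> E" "\<And>x. complex_of_real (p (w x)) = c + f x" "\<And>x. complex_of_real (q (w x)) = d + h x"
        by blast
      have "(\<lambda>x. (c * h x + d * f x) + f x * h x) \<in> E"
        by (intro assms(3) assms(4) scale fh)
      then show ?case
        by (intro exI[of _ "c * d"] bexI[of _ "\<lambda>x. (c * h x + d * f x) + f x * h x"]) (auto simp: fh algebra_simps)
    qed
    then obtain c f where f: "f \<in> E" "\<And>x. complex_of_real (p (w x)) = c + f x" by blast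
    have close: "cmod (complex_of_real (r x) - f x - c) \<le> e / 2" for x
    proof -
      have "F (w x) = r x" using w1 by (simp add: F_def vw)
      then have "complex_of_real (r x) - f x - c = complex_of_real (F (w x) - p (w x))"
        by (simp add: f(2))
      then show ?thesis using p(2)[OF wS[of x]] by (simp only: norm_of_real)
    qed
    \<comment> \<open>Both \<open>r\<close> and \<open>f\<close> vanish at infinity, so the
      approximation evaluated there bounds the unwanted constant itself. It can then be dropped at
      the price of another \<open>e / 2\<close>.\<close>
    have "((\<lambda>x. cmod (complex_of_real (r x) - f x - c)) \<longlongrightarrow> cmod (complex_of_real 0 - 0 - c)) at_infinity"
      using f(1) E r(2) by (intro tendsto_intros) (auto simp: C0_def)
    then have "cmod (complex_of_real 0 - 0 - c) \<le> e / 2"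
      using close by (intro tendsto_upperbound[OF _ always_eventually]) (auto simp: trivial_limit_at_infinity)
    then have "cmod c \<le> e / 2" by simp
    have "cmod (complex_of_real (r x) - f x) \<le> e" for x
    proof -
      have "cmod (complex_of_real (r x) - f x) \<le> cmod (complex_of_real (r x) - f x - c) + cmod c"
        by (metis norm_triangle_sub add.commute)
      then show ?thesis using close[of x] \<open>cmod c \<le> e / 2\<close> by linarith
    qed
    then show ?thesis using f(1) by blast
  qed
  have cont: "continuous_on UNIV g" and lim: "(g \<longlongrightarrow> 0) at_infinity" using g by (auto simp: C0_def)
  obtain f1 where f1: "f1 \<in> E" "\<And>x. cmod (complex_of_real (Re (g x)) - f1 x) \<le> e / 2"
    using real_case[of "\<lambda>x. Re (g x)" "e / 2"] cont tendsto_Re[OF lim] e by (auto intro: continuous_intros)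
  obtain f2 where f2: "f2 \<in> E" "\<And>x. cmod (complex_of_real (Im (g x)) - f2 x) \<le> e / 2"
    using real_case[of "\<lambda>x. Im (g x)" "e / 2"] cont tendsto_Im[OF lim] e by (auto intro: continuous_intros)
  have "cmod (g x - (f1 x + \<i> * f2 x)) \<le> e" for x
  proof -
    have "g x - (f1 x + \<i> * f2 x) = (complex_of_real (Re (g x)) - f1 x) + \<i> * (complex_of_real (Im (g x)) - f2 x)"
      using complex_eq[of "g x"] by (simp add: algebra_simps)
    also have "cmod \<dots> \<le> e / 2 + e / 2"
      by (rule norm_triangle_mono) (use f1(2)[of x] f2(2)[of x] in \<open>simp_all add: norm_mult\<close>)
    finally show ?thesis by simp
  qed
  then show ?thesis
    by (intro bexI[OF _ add[OF f1(1) scale[OF f2(1), of \<i>]]] allI)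
qed

text \<open>The functions on which two calculi agree form an algebra. It contains the resolvent
  functions at i and -i, because a resolvent is determined by the operator, and so it is uniformly
  dense; contractivity of both calculi extends the agreement to its closure.\<close>

lemma C0_calculus_unique:
  assumes \<Phi>: "C0_calculus A \<Phi>" and \<Psi>: "C0_calculus A \<Psi>" and g: "g \<in> C0"
  shows "\<Phi> g = \<Psi> g"
proof
  fix \<psi>
  define E where "E = {f \<in> C0. \<Phi> f = \<Psi> f}"
  have res: "(\<lambda>x. 1 / (complex_of_real x - z)) \<in> E" if "Im z \<noteq> 0" for z
  proof -
    have "\<Phi> (\<lambda>x. 1 / (complex_of_real x - z)) = \<Psi> (\<lambda>x. 1 / (complex_of_real x - z))"
      by (rule is_resolvent_unique[of A z]) (use \<Phi> \<Psi> that in \<open>simp_all add: C0_calculus_def\<close>)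
    then show ?thesis using C0_resolvent[OF that] by (simp add: E_def)
  qed
  have add: "(\<lambda>x. f x + h x) \<in> E" if "f \<in> E" "h \<in> E" for f h
    using that by (auto intro!: ext simp del: split_paired_All simp: E_def C0_add C0_calculusD(1)[OF \<Phi>] C0_calculusD(1)[OF \<Psi>])
  have mult: "(\<lambda>x. f x * h x) \<in> E" if "f \<in> E" "h \<in> E" for f h
    using that by (auto intro!: ext simp del: split_paired_All simp: E_def C0_mult C0_calculusD(3)[OF \<Phi>] C0_calculusD(3)[OF \<Psi>])
  have scale: "(\<lambda>x. c * f x) \<in> E" if "f \<in> E" for f c
    using that by (auto intro!: ext simp del: split_paired_All simp: E_def C0_scale C0_calculusD(2)[OF \<Phi>] C0_calculusD(2)[OF \<Psi>])
  have "norm (\<Phi> g \<psi> - \<Psi> g \<psi>) \<le> 0"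
  proof (rule field_le_epsilon)
    fix e :: real assume "0 < e"
    define K where "K = 1 + norm \<psi>"
    have K: "0 < K" "norm \<psi> \<le> K" by (simp_all add: K_def add_pos_nonneg)
    define d where "d = e / 2 / K"
    have d: "0 < d" using \<open>0 < e\<close> K by (simp add: d_def)
    obtain f where f: "f \<in> E" "\<And>x. cmod (g x - f x) \<le> d"
      using C0_resolvent_dense[of E g d] res[of \<i>] res[of "- \<i>"] add mult scale g d by (auto simp: E_def)
    have diff: "\<Theta> (\<lambda>x. g x + (-1) * f x) \<psi> = \<Theta> g \<psi> - \<Theta> f \<psi>" if \<Theta>: "C0_calculus A \<Theta>" for \<Theta>
    proof -
      have "\<Theta> (\<lambda>x. g x + (-1) * f x) \<psi> = \<Theta> g \<psi> + \<Theta> (\<lambda>x. (-1) * f x) \<psi>"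
        using f(1) by (intro C0_calculusD(1)[OF \<Theta> g] C0_scale) (simp add: E_def)
      also have "\<Theta> (\<lambda>x. (-1) * f x) \<psi> = complex_of_real (-1) *\<^sub>C \<Theta> f \<psi>"
        using C0_calculusD(2)[OF \<Theta>, of f "-1" \<psi>] f(1) by (simp add: E_def)
      finally show ?thesis by (simp only: scaleC_simps(4)) simp
    qed
    have bnd: "norm (\<Theta> g \<psi> - \<Theta> f \<psi>) \<le> d * norm \<psi>" if \<Theta>: "C0_calculus A \<Theta>" for \<Theta>
      unfolding diff[OF \<Theta>, symmetric]
    proof (rule C0_calculus_contractive[OF \<Theta>])
      show "(\<lambda>x. g x + (-1) * f x) \<in> C0"
        using f(1) by (intro C0_add[OF g] C0_scale) (simp add: E_def)
    qed (use f(2) in simp)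
    have "\<Phi> g \<psi> - \<Psi> g \<psi> = (\<Phi> g \<psi> - \<Phi> f \<psi>) - (\<Psi> g \<psi> - \<Psi> f \<psi>)"
      using f(1) by (simp add: E_def)
    also have "norm \<dots> \<le> d * norm \<psi> + d * norm \<psi>"
      by (rule order_trans[OF norm_triangle_ineq4]) (intro add_mono bnd \<Phi> \<Psi>)
    also have "\<dots> \<le> d * K + d * K" using d K by (intro add_mono mult_left_mono) auto
    also have "\<dots> = e" using K by (simp add: d_def)
    finally show "norm (\<Phi> g \<psi> - \<Psi> g \<psi>) \<le> 0 + e" by simp
  qed
  then show "\<Phi> g \<psi> = \<Psi> g \<psi>" by simp
qed

lemma fun_of_op_eq:
  assumes "C0_calculus A \<Phi>" "g \<in> C0"
  shows "fun_of_op g A = \<Phi> g"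
  unfolding fun_of_op_def
  by (rule the_equality) (use assms C0_calculus_unique in blast)+

section \<open>Existence of the functional calculus\<close>

locale self_adjoint_operator = symmetric_operator A M for A :: "state \<Rightarrow> state" and M +
  assumes comm_i: "A (\<i> *\<^sub>C \<psi>) = \<i> *\<^sub>C A \<psi>"
begin

definition calc :: "(real \<Rightarrow> complex) \<Rightarrow> state \<Rightarrow> state" where
  "calc f \<psi> = cfun (\<lambda>t. Re (f t)) \<psi> + \<i> *\<^sub>C cfun (\<lambda>t. Im (f t)) \<psi>"

lemma cfun_i: "continuous_on {-M..M} f \<Longrightarrow> cfun f (\<i> *\<^sub>C \<psi>) = \<i> *\<^sub>C cfun f \<psi>"
  by (rule cfun_intertwine[symmetric]) (auto simp: comm_i bounded_linear_scaleC)

lemma cont_Re_Im: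
  assumes "continuous_on {-M..M} f"
  shows "continuous_on {-M..M} (\<lambda>t. Re (f t))" "continuous_on {-M..M} (\<lambda>t. Im (f t))"
  using assms by (auto intro: continuous_intros)

lemma cfun_lincomb:
  assumes "continuous_on {-M..M} f" "continuous_on {-M..M} g"
  shows "cfun (\<lambda>t. a * f t + b * g t) \<psi> = a *\<^sub>R cfun f \<psi> + b *\<^sub>R cfun g \<psi>"
  using assms by (simp add: cfun_add cfun_scale continuous_intros)

lemma scaleC_i_i: "\<i> *\<^sub>C \<i> *\<^sub>C \<psi> = - \<psi>"
  using scaleC_simps(4)[of "-1" \<psi>] by (simp add: scaleC_simps(3))

lemma scaleC_i_real: "\<i> *\<^sub>C (r *\<^sub>R \<psi>) = r *\<^sub>R (\<i> *\<^sub>C \<psi>)"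
  by (simp add: scaleC_simps(3) mult.commute flip: scaleC_simps(4))

lemma calc_cong:
  assumes "\<And>t. t \<in> {-M..M} \<Longrightarrow> f t = g t"
  shows "calc f \<psi> = calc g \<psi>"
proof -
  have "cfun (\<lambda>t. Re (f t)) \<psi> = cfun (\<lambda>t. Re (g t)) \<psi>" "cfun (\<lambda>t. Im (f t)) \<psi> = cfun (\<lambda>t. Im (g t)) \<psi>"
    by (intro cfun_cong, simp add: assms)+
  then show ?thesis by (simp add: calc_def)
qed

lemma calc_add:
  assumes "continuous_on {-M..M} f" "continuous_on {-M..M} g"
  shows "calc (\<lambda>x. f x + g x) \<psi> = calc f \<psi> + calc g \<psi>"
  unfolding calc_def using cont_Re_Im[OF assms(1)] cont_Re_Im[OF assms(2)]
  by (simp add: cfun_add scaleC_simps)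

lemma calc_scale:
  assumes f: "continuous_on {-M..M} f"
  shows "calc (\<lambda>x. c * f x) \<psi> = c *\<^sub>C calc f \<psi>"
proof -
  note c = cont_Re_Im[OF f]
  have "cfun (\<lambda>t. Re (c * f t)) \<psi> = Re c *\<^sub>R cfun (\<lambda>t. Re (f t)) \<psi> + (- Im c) *\<^sub>R cfun (\<lambda>t. Im (f t)) \<psi>"
    using cfun_lincomb[OF c, of "Re c" "- Im c"] by simp
  moreover have "cfun (\<lambda>t. Im (c * f t)) \<psi> = Re c *\<^sub>R cfun (\<lambda>t. Im (f t)) \<psi> + Im c *\<^sub>R cfun (\<lambda>t. Re (f t)) \<psi>"
    using cfun_lincomb[OF c(2,1), of "Re c" "Im c"] by simp
  ultimately show ?thesis
    unfolding calc_def scaleC_Complex[of c]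
    by (simp add: scaleC_simps(1) scaleC_i_real scaleC_i_i algebra_simps)
qed

lemma bounded_clinear_calc:
  assumes f: "continuous_on {-M..M} f"
  shows "bounded_clinear (calc f)"
proof (rule bounded_clinearI)
  note c = cont_Re_Im[OF f]
  show "bounded_linear (calc f)"
    unfolding calc_def[abs_def]
    by (intro bounded_linear_add bounded_linear_cfun c bounded_linear_compose[OF bounded_linear_scaleC])
  show "calc f (\<i> *\<^sub>C \<psi>) = \<i> *\<^sub>C calc f \<psi>" for \<psi>
    by (simp add: calc_def cfun_i c scaleC_simps(1))
qed

lemma calc_mult:
  assumes f: "continuous_on {-M..M} f" and g: "continuous_on {-M..M} g"
  shows "calc (\<lambda>x. f x * g x) \<psi> = calc f (calc g \<psi>)"
proof -
  note c = cont_Re_Im[OF f] cont_Re_Im[OF g]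
  have "cfun (\<lambda>t. Re (f t * g t)) \<psi> = cfun (\<lambda>t. 1 * (Re (f t) * Re (g t)) + (-1) * (Im (f t) * Im (g t))) \<psi>"
    by simp
  also have "\<dots> = cfun (\<lambda>t. Re (f t)) (cfun (\<lambda>t. Re (g t)) \<psi>) - cfun (\<lambda>t. Im (f t)) (cfun (\<lambda>t. Im (g t)) \<psi>)"
    using c by (subst cfun_lincomb) (auto simp: cfun_mult intro!: continuous_intros)
  finally have re: "cfun (\<lambda>t. Re (f t * g t)) \<psi> = \<dots>" .
  have "cfun (\<lambda>t. Im (f t * g t)) \<psi> = cfun (\<lambda>t. 1 * (Re (f t) * Im (g t)) + 1 * (Im (f t) * Re (g t))) \<psi>"
    by simp
  also have "\<dots> = cfun (\<lambda>t. Re (f t)) (cfun (\<lambda>t. Im (g t)) \<psi>) + cfun (\<lambda>t. Im (f t)) (cfun (\<lambda>t. Re (g t)) \<psi>)"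
    using c by (subst cfun_lincomb) (auto simp: cfun_mult intro!: continuous_intros)
  finally have im: "cfun (\<lambda>t. Im (f t * g t)) \<psi> = \<dots>" .
  show ?thesis
    unfolding calc_def re im
    by (simp add: linear_add[OF linear_cfun] c cfun_i scaleC_simps(1) scaleC_i_i)
qed

lemma calc_adjoint:
  assumes f: "continuous_on {-M..M} f"
  shows "cinner \<phi> (calc (\<lambda>x. cnj (f x)) \<psi>) = cinner (calc f \<phi>) \<psi>"
proof -
  note c = cont_Re_Im[OF f]
  \<comment> \<open>Equality of real parts for every \<phi> suffices: by \<open>Im_cinner\<close>
    the imaginary parts are the real parts at i times \<phi>.\<close>
  have real: "\<phi> \<bullet> calc (\<lambda>x. cnj (f x)) \<psi> = calc f \<phi> \<bullet> \<psi>" for \<phi>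
    unfolding calc_def using c cfun_scale[OF c(2), of "-1" \<psi>] scaleC_i_real[of "-1"]
    by (simp add: inner_add_left inner_add_right inner_diff_right inner_i_left cfun_sym cfun_i)
  have "calc f (\<i> *\<^sub>C \<phi>) = \<i> *\<^sub>C calc f \<phi>"
    using bounded_clinear_calc[OF f] by (simp add: bounded_clinear_def del: split_paired_All)
  then show ?thesis
    using real[of \<phi>] real[of "\<i> *\<^sub>C \<phi>"] by (simp add: complex_eq_iff Re_cinner Im_cinner)
qed

lemma calc_id: "calc complex_of_real \<psi> = A \<psi>"
  by (simp add: calc_def cfun_id cfun_const scaleC_simps)

lemma calc_const: "calc (\<lambda>x. c) \<psi> = c *\<^sub>C \<psi>"
  by (simp add: calc_def cfun_const scaleC_i_real flip: scaleC_Complex)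

lemma C0_calculus_calc: "C0_calculus (\<lambda>\<psi>. Some (A \<psi>)) calc"
  unfolding C0_calculus_def
proof (intro conjI ballI allI impI)
  have cont: "continuous_on {-M..M} f" if "f \<in> C0" for f :: "real \<Rightarrow> complex"
    using that continuous_on_subset by (auto simp: C0_def)
  show "bounded_clinear (calc f)" if "f \<in> C0" for f by (rule bounded_clinear_calc[OF cont[OF that]])
  show "calc (\<lambda>x. f x + g x) \<psi> = calc f \<psi> + calc g \<psi>" if "f \<in> C0" "g \<in> C0" for f g \<psi>
    by (intro calc_add cont that)
  show "calc (\<lambda>x. c * f x) \<psi> = c *\<^sub>C calc f \<psi>" if "f \<in> C0" for c f \<psi>
    by (intro calc_scale cont that)
  show "calc (\<lambda>x. f x * g x) \<psi> = calc f (calc g \<psi>)" if "f \<in> C0" "g \<in> C0" for f g \<psi>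
    by (intro calc_mult cont that)
  show "cinner \<phi> (calc (\<lambda>x. cnj (f x)) \<psi>) = cinner (calc f \<phi>) \<psi>" if "f \<in> C0" for f \<phi> \<psi>
    by (intro calc_adjoint cont that)
  fix z :: complex assume z: "Im z \<noteq> 0"
  let ?r = "\<lambda>x. 1 / (complex_of_real x - z)" and ?s = "\<lambda>x. complex_of_real x + (- z)"
  have nz: "?s x \<noteq> 0" for x using z by (auto simp: complex_eq_iff)
  have cr: "continuous_on {-M..M} ?r" by (rule cont) (rule C0_resolvent[OF z])
  have cs: "continuous_on {-M..M} ?s" by (intro continuous_intros)
  have s: "calc ?s \<psi> = A \<psi> - z *\<^sub>C \<psi>" for \<psi>
  proof -
    have "(- z) *\<^sub>C \<psi> = complex_of_real (-1) *\<^sub>C z *\<^sub>C \<psi>" unfolding scaleC_simps(3) by simp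
    also have "\<dots> = - (z *\<^sub>C \<psi>)" by (simp only: scaleC_simps(4)) simp
    finally show ?thesis by (subst calc_add) (auto simp: calc_id calc_const intro: continuous_intros)
  qed
  have "calc ?r (calc ?s \<psi>) = \<psi>" "calc ?s (calc ?r \<psi>) = \<psi>" for \<psi>
  proof -
    have "calc (\<lambda>x. ?r x * ?s x) \<psi> = calc (\<lambda>x. 1) \<psi>" "calc (\<lambda>x. ?s x * ?r x) \<psi> = calc (\<lambda>x. 1) \<psi>"
      using nz by (auto intro!: calc_cong)
    moreover have "calc (\<lambda>x. 1) \<psi> = \<psi>" using scaleC_simps(4)[of 1 \<psi>] by (simp add: calc_const)
    ultimately show "calc ?r (calc ?s \<psi>) = \<psi>" "calc ?s (calc ?r \<psi>) = \<psi>"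
      by (simp_all only: calc_mult[OF cr cs] calc_mult[OF cs cr])
  qed
  then show "is_resolvent (\<lambda>\<psi>. Some (A \<psi>)) z (calc ?r)"
    unfolding is_resolvent_def s using bounded_clinear_calc[OF cr] by simp
qed

text \<open>For real \<open>f\<close> the operator \<open>cfun f\<close> is symmetric and commutes
  with i, so its diagonal matrix elements are real. Complex \<open>g\<close> is thereby reduced to
  two real functions, for which all limits are taken.\<close>

lemma cinner_fun_of_op:
  assumes g: "g \<in> C0"
  shows "cinner \<psi> (fun_of_op g (\<lambda>\<psi>. Some (A \<psi>)) \<psi>)
    = complex_of_real (\<psi> \<bullet> cfun (\<lambda>t. Re (g t)) \<psi>) + \<i> * complex_of_real (\<psi> \<bullet> cfun (\<lambda>t. Im (g t)) \<psi>)"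
proof -
  have "continuous_on {-M..M} g" using g continuous_on_subset by (auto simp: C0_def)
  note c = cont_Re_Im[OF this]
  have zero: "(\<i> *\<^sub>C \<psi>) \<bullet> cfun f \<psi> = 0" if "continuous_on {-M..M} f" for f
  proof -
    have "(\<i> *\<^sub>C \<psi>) \<bullet> cfun f \<psi> = - (\<psi> \<bullet> cfun f (\<i> *\<^sub>C \<psi>))"
      using that by (simp add: inner_i_left cfun_i)
    also have "\<dots> = - (cfun f \<psi> \<bullet> (\<i> *\<^sub>C \<psi>))"
      using that by (simp only: cfun_sym)
    finally show ?thesis by (simp add: inner_commute)
  qed
  show ?thesis
    unfolding fun_of_op_eq[OF C0_calculus_calc g] calc_def
    using zero[OF c(1)] zero[OF c(2)]
    by (simp add: complex_eq_iff Re_cinner Im_cinner inner_add_right inner_i_i) (simp add: inner_i_left)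
qed

end

section \<open>Kernel operators\<close>

lemma sum_power_abs_le:
  fixes q :: real
  assumes q: "0 \<le> q" "q < 1" and F: "finite F"
  shows "(\<Sum>k\<in>F. q ^ nat \<bar>k :: int\<bar>) \<le> 2 / (1 - q)"
proof -
  have part: "(\<Sum>k\<in>G. q ^ nat \<bar>k\<bar>) \<le> 1 / (1 - q)" if "finite G" "inj_on (\<lambda>k. nat \<bar>k\<bar>) G" for G :: "int set"
  proof -
    have "(\<Sum>k\<in>G. q ^ nat \<bar>k\<bar>) = (\<Sum>j\<in>(\<lambda>k. nat \<bar>k\<bar>) ` G. q ^ j)"
      by (simp add: sum.reindex[OF that(2)])
    also have "\<dots> \<le> (\<Sum>j. q ^ j)"
      using that(1) q by (intro sum_le_suminf summable_geometric) auto
    also have "\<dots> = 1 / (1 - q)" using q by (simp add: suminf_geometric)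
    finally show ?thesis .
  qed
  have "F = {k \<in> F. 0 \<le> k} \<union> {k \<in> F. k < 0}" by auto
  then have "(\<Sum>k\<in>F. q ^ nat \<bar>k\<bar>) = (\<Sum>k\<in>{k \<in> F. 0 \<le> k}. q ^ nat \<bar>k\<bar>) + (\<Sum>k\<in>{k \<in> F. k < 0}. q ^ nat \<bar>k\<bar>)"
    using F by (subst sum.union_disjoint[symmetric]) auto
  also have "\<dots> \<le> 1 / (1 - q) + 1 / (1 - q)"
    by (intro add_mono part) (use F in \<open>auto simp: inj_on_def\<close>)
  finally show ?thesis by simp
qed

text \<open>Recentering at the integer nearest to \<open>\<beta> / \<alpha>\<close> costs a factor
  \<open>exp (c * \<alpha>)\<close> and leaves a two-sided geometric series. The bound is uniform in
  \<beta>, so later estimates do not depend on the site or the offset.\<close>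

lemma exp_sum_bounded:
  fixes \<alpha> c :: real
  assumes \<alpha>: "0 < \<alpha>" and c: "0 < c"
  obtains S where "0 < S" "\<And>\<beta> F. finite F \<Longrightarrow> (\<Sum>n\<in>F. exp (- c * \<bar>\<beta> - \<alpha> * real_of_int n\<bar>)) \<le> S"
proof
  define q where "q = exp (- c * \<alpha>)"
  have q: "0 \<le> q" "q < 1" using assms by (simp_all add: q_def)
  show "0 < exp (c * \<alpha>) * (2 / (1 - q))" using q by simp
  fix \<beta> :: real and F :: "int set" assume F: "finite F"
  define m where "m = round (\<beta> / \<alpha>)"
  have "\<bar>of_int m - \<beta> / \<alpha>\<bar> \<le> 1" using of_int_round_abs_le[of "\<beta> / \<alpha>"] by (simp add: m_def)
  then have "\<bar>\<alpha> * (of_int m - \<beta> / \<alpha>)\<bar> \<le> \<alpha> * 1"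
    unfolding abs_mult using \<alpha> by (intro mult_mono) auto
  then have m: "\<bar>\<alpha> * of_int m - \<beta>\<bar> \<le> \<alpha>" using \<alpha> by (simp add: right_diff_distrib)
  have "exp (- c * \<bar>\<beta> - \<alpha> * real_of_int n\<bar>) \<le> exp (c * \<alpha>) * q ^ nat \<bar>n - m\<bar>" for n
  proof -
    have "\<alpha> * \<bar>real_of_int (n - m)\<bar> = \<bar>\<alpha> * real_of_int n - \<alpha> * real_of_int m\<bar>"
      using \<alpha> by (simp add: abs_mult flip: right_diff_distrib)
    also have "\<dots> \<le> \<bar>\<beta> - \<alpha> * real_of_int n\<bar> + \<alpha>" using m by linarith
    finally have "c * (\<alpha> * \<bar>real_of_int (n - m)\<bar>) \<le> c * (\<bar>\<beta> - \<alpha> * real_of_int n\<bar> + \<alpha>)"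
      using c by (intro mult_left_mono) auto
    then have "- c * \<bar>\<beta> - \<alpha> * real_of_int n\<bar> \<le> c * \<alpha> + real (nat \<bar>n - m\<bar>) * (- c * \<alpha>)"
      by (simp add: algebra_simps)
    then have "exp (- c * \<bar>\<beta> - \<alpha> * real_of_int n\<bar>) \<le> exp (c * \<alpha> + real (nat \<bar>n - m\<bar>) * (- c * \<alpha>))" by simp
    also have "\<dots> = exp (c * \<alpha>) * q ^ nat \<bar>n - m\<bar>"
      unfolding exp_add q_def exp_of_nat_mult ..
    finally show ?thesis .
  qed
  then have "(\<Sum>n\<in>F. exp (- c * \<bar>\<beta> - \<alpha> * real_of_int n\<bar>)) \<le> exp (c * \<alpha>) * (\<Sum>n\<in>F. q ^ nat \<bar>n - m\<bar>)"
    unfolding sum_distrib_left by (intro sum_mono)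
  also have "(\<Sum>n\<in>F. q ^ nat \<bar>n - m\<bar>) = (\<Sum>k\<in>(\<lambda>n. n - m) ` F. q ^ nat \<bar>k\<bar>)"
    by (subst sum.reindex) (auto simp: inj_on_def)
  also have "exp (c * \<alpha>) * \<dots> \<le> exp (c * \<alpha>) * (2 / (1 - q))"
    by (intro mult_left_mono sum_power_abs_le q finite_imageI F) simp
  finally show "(\<Sum>n\<in>F. exp (- c * \<bar>\<beta> - \<alpha> * real_of_int n\<bar>)) \<le> exp (c * \<alpha>) * (2 / (1 - q))" by simp
qed

definition kernel_op :: "(int \<Rightarrow> int \<Rightarrow> real) \<Rightarrow> ell2 \<Rightarrow> ell2" where
  "kernel_op t \<phi> = Abs_ell2 (\<lambda>n. \<Sum>\<^sub>\<infinity>n'. complex_of_real (t n n') * entry \<phi> n')"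

definition row_bounded :: "(int \<Rightarrow> int \<Rightarrow> real) \<Rightarrow> real \<Rightarrow> bool" where
  "row_bounded t S \<longleftrightarrow> (\<forall>n F. finite F \<longrightarrow> (\<Sum>n'\<in>F. \<bar>t n n'\<bar>) \<le> S)"

locale schur_kernel =
  fixes t :: "int \<Rightarrow> int \<Rightarrow> real" and S :: real
  assumes row: "row_bounded t S" and col: "row_bounded (\<lambda>n' n. t n n') S"
begin

lemma S_nonneg: "0 \<le> S"
  using row unfolding row_bounded_def by (metis finite.emptyI sum.empty)

lemma kernel_summable: "(\<lambda>n'. \<bar>t n n'\<bar>) summable_on UNIV"
  by (rule nonneg_bounded_partial_sums_imp_summable_on[where C = S])
    (use row in \<open>auto simp: row_bounded_def intro: eventually_finite_subsets_at_top_weakI\<close>)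

lemma action_abs_summable: "(\<lambda>n'. norm (complex_of_real (t n n') * entry \<phi> n')) summable_on UNIV"
proof (rule Infinite_Sum.abs_summable_on_comparison_test')
  show "(\<lambda>n'. \<bar>t n n'\<bar> * norm \<phi>) summable_on UNIV"
    by (intro summable_on_cmult_left kernel_summable)
  show "norm (complex_of_real (t n n') * entry \<phi> n') \<le> \<bar>t n n'\<bar> * norm \<phi>" for n'
    by (simp add: norm_mult norm_entry_le mult_left_mono)
qed

lemma action_summable: "(\<lambda>n'. complex_of_real (t n n') * entry \<phi> n') summable_on UNIV"
  using action_abs_summable by (rule abs_summable_summable)

lemma partial_schur:
  assumes F: "finite F" and G: "finite G"
  shows "(\<Sum>n\<in>F. (cmod (\<Sum>n'\<in>G. complex_of_real (t n n') * entry \<phi> n'))\<^sup>2) \<le> (S * norm \<phi>)\<^sup>2"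
proof -
  have "(cmod (\<Sum>n'\<in>G. complex_of_real (t n n') * entry \<phi> n'))\<^sup>2
      \<le> S * (\<Sum>n'\<in>G. \<bar>t n n'\<bar> * (cmod (entry \<phi> n'))\<^sup>2)" for n
  proof -
    \<comment> \<open>Schur's trick: Cauchy-Schwarz with the kernel split into two square roots. One
      factor is controlled by a row sum; the other is controlled by column sums once summed over
      \<open>n\<close>.\<close>
    have "cmod (\<Sum>n'\<in>G. complex_of_real (t n n') * entry \<phi> n')
        \<le> (\<Sum>n'\<in>G. sqrt \<bar>t n n'\<bar> * (sqrt \<bar>t n n'\<bar> * cmod (entry \<phi> n')))"
      by (rule order_trans[OF norm_sum]) (simp add: norm_mult flip: mult.assoc)
    then have "(cmod (\<Sum>n'\<in>G. complex_of_real (t n n') * entry \<phi> n'))\<^sup>2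
        \<le> (\<Sum>n'\<in>G. sqrt \<bar>t n n'\<bar> * (sqrt \<bar>t n n'\<bar> * cmod (entry \<phi> n')))\<^sup>2"
      by (intro power_mono) auto
    also have "\<dots> \<le> (\<Sum>n'\<in>G. (sqrt \<bar>t n n'\<bar>)\<^sup>2) * (\<Sum>n'\<in>G. (sqrt \<bar>t n n'\<bar> * cmod (entry \<phi> n'))\<^sup>2)"
      by (rule Cauchy_Schwarz_ineq_sum)
    also have "\<dots> = (\<Sum>n'\<in>G. \<bar>t n n'\<bar>) * (\<Sum>n'\<in>G. \<bar>t n n'\<bar> * (cmod (entry \<phi> n'))\<^sup>2)"
      by (simp add: power_mult_distrib)
    also have "\<dots> \<le> S * (\<Sum>n'\<in>G. \<bar>t n n'\<bar> * (cmod (entry \<phi> n'))\<^sup>2)"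
      using row G by (intro mult_right_mono sum_nonneg) (auto simp: row_bounded_def)
    finally show ?thesis .
  qed
  then have le: "(\<Sum>n\<in>F. (cmod (\<Sum>n'\<in>G. complex_of_real (t n n') * entry \<phi> n'))\<^sup>2)
      \<le> S * (\<Sum>n\<in>F. \<Sum>n'\<in>G. \<bar>t n n'\<bar> * (cmod (entry \<phi> n'))\<^sup>2)"
    unfolding sum_distrib_left by (intro sum_mono)
  have "(\<Sum>n\<in>F. \<Sum>n'\<in>G. \<bar>t n n'\<bar> * (cmod (entry \<phi> n'))\<^sup>2)
      = (\<Sum>n'\<in>G. (\<Sum>n\<in>F. \<bar>t n n'\<bar>) * (cmod (entry \<phi> n'))\<^sup>2)"
    by (subst sum.swap) (simp add: sum_distrib_right)
  also have "\<dots> \<le> (\<Sum>n'\<in>G. S * (cmod (entry \<phi> n'))\<^sup>2)"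
    using col F by (intro sum_mono mult_right_mono) (auto simp: row_bounded_def)
  also have "\<dots> = S * (\<Sum>n'\<in>G. (cmod (entry \<phi> n'))\<^sup>2)" by (simp add: sum_distrib_left)
  also have "\<dots> \<le> S * (norm \<phi>)\<^sup>2"
    using S_nonneg sum_entry_le[OF G, of \<phi>] by (intro mult_left_mono) auto
  finally have "S * (\<Sum>n\<in>F. \<Sum>n'\<in>G. \<bar>t n n'\<bar> * (cmod (entry \<phi> n'))\<^sup>2) \<le> S * (S * (norm \<phi>)\<^sup>2)"
    using S_nonneg by (rule mult_left_mono)
  with le show ?thesis by (simp add: power_mult_distrib power2_eq_square mult.assoc mult.left_commute)
qed

lemma schur_test:
  assumes F: "finite F"
  shows "(\<Sum>n\<in>F. (cmod (\<Sum>\<^sub>\<infinity>n'. complex_of_real (t n n') * entry \<phi> n'))\<^sup>2) \<le> (S * norm \<phi>)\<^sup>2"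
proof (rule tendsto_upperbound)
  show "((\<lambda>G. \<Sum>n\<in>F. (cmod (\<Sum>n'\<in>G. complex_of_real (t n n') * entry \<phi> n'))\<^sup>2)
      \<longlongrightarrow> (\<Sum>n\<in>F. (cmod (\<Sum>\<^sub>\<infinity>n'. complex_of_real (t n n') * entry \<phi> n'))\<^sup>2)) (finite_subsets_at_top UNIV)"
    using has_sum_infsum[OF action_summable] by (intro tendsto_intros) (simp add: has_sum_def)
  show "\<forall>\<^sub>F G in finite_subsets_at_top UNIV.
      (\<Sum>n\<in>F. (cmod (\<Sum>n'\<in>G. complex_of_real (t n n') * entry \<phi> n'))\<^sup>2) \<le> (S * norm \<phi>)\<^sup>2"
    by (intro eventually_finite_subsets_at_top_weakI partial_schur F)
qed simp

lemma square_summable_action: "square_summable (\<lambda>n. \<Sum>\<^sub>\<infinity>n'. complex_of_real (t n n') * entry \<phi> n')"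
  by (rule square_summableI) (rule schur_test)

lemma entry_kernel_op: "entry (kernel_op t \<phi>) n = (\<Sum>\<^sub>\<infinity>n'. complex_of_real (t n n') * entry \<phi> n')"
  by (simp add: kernel_op_def entry_Abs square_summable_action)

lemma norm_kernel_op_le: "norm (kernel_op t \<phi>) \<le> S * norm \<phi>"
  by (rule norm_ell2_leI) (use schur_test S_nonneg in \<open>simp_all add: entry_kernel_op\<close>)

lemma linear_kernel_op: "linear (kernel_op t)"
proof (rule linearI)
  show "kernel_op t (\<phi> + \<psi>) = kernel_op t \<phi> + kernel_op t \<psi>" for \<phi> \<psi>
    by (rule ell2_eqI) (simp add: entry_kernel_op plus_ell2.rep_eq distrib_left infsum_add action_summable)
  show "kernel_op t (r *\<^sub>R \<phi>) = r *\<^sub>R kernel_op t \<phi>" for r \<phi>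
    by (rule ell2_eqI) (simp add: entry_kernel_op scaleR_ell2.rep_eq mult.left_commute infsum_cmult_right' )
qed

lemma kernel_op_scaleC: "kernel_op t (scaleC_ell2 c \<phi>) = scaleC_ell2 c (kernel_op t \<phi>)"
  by (rule ell2_eqI) (simp add: entry_kernel_op scaleC_ell2.rep_eq mult.left_commute infsum_cmult_right')

text \<open>Absolute summability over pairs of indices is what permits exchanging the two sums in
  \<open>kernel_op_adjoint\<close>. The product of entries is bounded by the sum of their squares,
  so the column bound handles one part and the row bound the other.\<close>

lemma kernel_form_summable: "(\<lambda>(n, n'). t n n' * (entry \<phi> n' \<bullet> entry \<psi> n)) summable_on UNIV \<times> UNIV"
proof (rule abs_summable_summable)
  have "(\<lambda>x. case x of (n, n') \<Rightarrow> \<bar>t n n'\<bar> * (cmod (entry \<phi> n') * cmod (entry \<psi> n))) summable_on UNIV \<times> UNIV"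
  proof (rule nonneg_bounded_partial_sums_imp_summable_on[where C = "S * (norm \<phi>)\<^sup>2 + S * (norm \<psi>)\<^sup>2"])
    have "(\<Sum>(n, n')\<in>G. \<bar>t n n'\<bar> * (cmod (entry \<phi> n') * cmod (entry \<psi> n))) \<le> S * (norm \<phi>)\<^sup>2 + S * (norm \<psi>)\<^sup>2"
      if G: "finite G" for G
    proof -
      define F F' where "F = fst ` G" and "F' = snd ` G"
      have fin: "finite F" "finite F'" using G by (auto simp: F_def F'_def)
      have sub: "G \<subseteq> F \<times> F'" by (auto simp: F_def F'_def image_iff split: prod.splits) force+
      have ab: "x * y \<le> x\<^sup>2 + y\<^sup>2" for x y :: real
        using zero_le_power2[of "x - y"] zero_le_power2[of "x + y"] by (simp add: power2_eq_square algebra_simps)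
      have "(\<Sum>(n, n')\<in>G. \<bar>t n n'\<bar> * (cmod (entry \<phi> n') * cmod (entry \<psi> n)))
          \<le> (\<Sum>(n, n')\<in>F \<times> F'. \<bar>t n n'\<bar> * (cmod (entry \<phi> n') * cmod (entry \<psi> n)))"
        using fin sub by (intro sum_mono2) auto
      also have "\<dots> \<le> (\<Sum>(n, n')\<in>F \<times> F'. \<bar>t n n'\<bar> * ((cmod (entry \<phi> n'))\<^sup>2 + (cmod (entry \<psi> n))\<^sup>2))"
        by (intro sum_mono) (auto intro!: mult_left_mono ab)
      also have "\<dots> = (\<Sum>n'\<in>F'. (\<Sum>n\<in>F. \<bar>t n n'\<bar>) * (cmod (entry \<phi> n'))\<^sup>2) + (\<Sum>n\<in>F. (\<Sum>n'\<in>F'. \<bar>t n n'\<bar>) * (cmod (entry \<psi> n))\<^sup>2)"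
        unfolding sum.cartesian_product[symmetric] distrib_left sum.distrib
        by (subst sum.swap) (simp add: sum_distrib_right)
      also have "\<dots> \<le> (\<Sum>n'\<in>F'. S * (cmod (entry \<phi> n'))\<^sup>2) + (\<Sum>n\<in>F. S * (cmod (entry \<psi> n))\<^sup>2)"
        using row col fin by (intro add_mono sum_mono mult_right_mono) (auto simp: row_bounded_def)
      also have "\<dots> = S * (\<Sum>n'\<in>F'. (cmod (entry \<phi> n'))\<^sup>2) + S * (\<Sum>n\<in>F. (cmod (entry \<psi> n))\<^sup>2)"
        by (simp add: sum_distrib_left)
      also have "\<dots> \<le> S * (norm \<phi>)\<^sup>2 + S * (norm \<psi>)\<^sup>2"
        using S_nonneg fin by (intro add_mono mult_left_mono sum_entry_le) auto
      finally show ?thesis .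
    qed
    then show "\<forall>\<^sub>F G in finite_subsets_at_top (UNIV \<times> UNIV).
        (\<Sum>(n, n')\<in>G. \<bar>t n n'\<bar> * (cmod (entry \<phi> n') * cmod (entry \<psi> n))) \<le> S * (norm \<phi>)\<^sup>2 + S * (norm \<psi>)\<^sup>2"
      by (intro eventually_finite_subsets_at_top_weakI)
  qed auto
  then show "(\<lambda>x. norm (case x of (n, n') \<Rightarrow> t n n' * (entry \<phi> n' \<bullet> entry \<psi> n))) summable_on UNIV \<times> UNIV"
  proof (rule Infinite_Sum.abs_summable_on_comparison_test')
    fix x :: "int \<times> int"
    show "norm (case x of (n, n') \<Rightarrow> t n n' * (entry \<phi> n' \<bullet> entry \<psi> n))
        \<le> (case x of (n, n') \<Rightarrow> \<bar>t n n'\<bar> * (cmod (entry \<phi> n') * cmod (entry \<psi> n)))"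
      by (cases x) (simp add: abs_mult mult_left_mono Cauchy_Schwarz_ineq2)
  qed
qed

lemma inner_kernel_op: "kernel_op t \<phi> \<bullet> \<psi> = (\<Sum>\<^sub>\<infinity>n. \<Sum>\<^sub>\<infinity>n'. t n n' * (entry \<phi> n' \<bullet> entry \<psi> n))"
proof -
  have "entry (kernel_op t \<phi>) n \<bullet> entry \<psi> n = (\<Sum>\<^sub>\<infinity>n'. t n n' * (entry \<phi> n' \<bullet> entry \<psi> n))" for n
  proof -
    have "(\<Sum>\<^sub>\<infinity>n'. complex_of_real (t n n') * entry \<phi> n') \<bullet> entry \<psi> n
        = (\<Sum>\<^sub>\<infinity>n'. (complex_of_real (t n n') * entry \<phi> n') \<bullet> entry \<psi> n)"
      using has_sum_bounded_linear[OF bounded_linear_inner_left has_sum_infsum[OF action_summable]]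
      by (metis infsumI)
    then show ?thesis by (simp add: entry_kernel_op flip: scaleR_conv_of_real)
  qed
  then show ?thesis by (simp add: inner_ell2_def)
qed

end

lemma schur_kernel_transpose: "schur_kernel t S \<Longrightarrow> schur_kernel (\<lambda>n n'. t n' n) S"
  by (simp add: schur_kernel_def)

lemma kernel_op_adjoint:
  assumes "schur_kernel t S"
  shows "kernel_op t \<phi> \<bullet> \<psi> = \<phi> \<bullet> kernel_op (\<lambda>n n'. t n' n) \<psi>"
proof -
  interpret schur_kernel t S by fact
  interpret T: schur_kernel "\<lambda>n n'. t n' n" S using assms by (rule schur_kernel_transpose)
  have "kernel_op t \<phi> \<bullet> \<psi> = (\<Sum>\<^sub>\<infinity>n. \<Sum>\<^sub>\<infinity>n'. t n n' * (entry \<phi> n' \<bullet> entry \<psi> n))"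
    by (rule inner_kernel_op)
  also have "\<dots> = (\<Sum>\<^sub>\<infinity>n'. \<Sum>\<^sub>\<infinity>n. t n n' * (entry \<phi> n' \<bullet> entry \<psi> n))"
    by (rule infsum_swap_banach) (rule kernel_form_summable)
  also have "\<dots> = kernel_op (\<lambda>n n'. t n' n) \<psi> \<bullet> \<phi>"
  proof -
    have c: "entry \<phi> n' \<bullet> entry \<psi> n = entry \<psi> n \<bullet> entry \<phi> n'" for n n' by (rule inner_commute)
    show ?thesis unfolding c by (rule T.inner_kernel_op[symmetric])
  qed
  also have "\<dots> = \<phi> \<bullet> kernel_op (\<lambda>n n'. t n' n) \<psi>" by (rule inner_commute)
  finally show ?thesis .
qed

lemma kernel_op_diff:
  assumes "schur_kernel s S" "schur_kernel t T"
  shows "kernel_op (\<lambda>n n'. s n n' - t n n') \<phi> = kernel_op s \<phi> - kernel_op t \<phi>"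
proof -
  interpret s: schur_kernel s S by fact
  interpret t: schur_kernel t T by fact
  have "(\<Sum>\<^sub>\<infinity>n'. complex_of_real (s n n' - t n n') * entry \<phi> n')
      = (\<Sum>\<^sub>\<infinity>n'. complex_of_real (s n n') * entry \<phi> n') - (\<Sum>\<^sub>\<infinity>n'. complex_of_real (t n n') * entry \<phi> n')" for n
    using infsum_add[OF s.action_summable[of n \<phi>] summable_on_uminus[THEN iffD2, OF t.action_summable[of n \<phi>]]]
    by (simp add: left_diff_distrib infsum_uminus)
  then have "kernel_op (\<lambda>n n'. s n n' - t n n') \<phi> = Abs_ell2 (entry (kernel_op s \<phi> - kernel_op t \<phi>))"
    unfolding kernel_op_def[of "\<lambda>n n'. s n n' - t n n'"]
    by (intro arg_cong[where f = Abs_ell2]) (simp add: fun_eq_iff minus_ell2.rep_eq s.entry_kernel_op t.entry_kernel_op)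
  then show ?thesis by (simp add: entry_inverse)
qed

section \<open>The Hamiltonian and its truncations\<close>

text \<open>The tridiagonal matrix of minus the Laplacian plus the potential \<open>w\<close>.
  Writing it as a kernel lets the Schur estimates and the adjoint formula treat it like the
  couplings.\<close>

definition onsite :: "(int \<Rightarrow> real) \<Rightarrow> int \<Rightarrow> int \<Rightarrow> real" where
  "onsite w n n' = (if n' = n then 2 + w n else 0) + (if n' = n + 1 then - 1 else 0) + (if n' = n - 1 then - 1 else 0)"

lemma onsite_sym: "onsite w n n' = onsite w n' n"
  by (auto simp: onsite_def)

lemma schur_kernel_onsite:
  assumes w: "\<And>n. \<bar>w n\<bar> \<le> K"
  shows "schur_kernel (onsite w) (K + 4)"
proof -
  have K: "0 \<le> K" using w[of 0] abs_ge_zero order_trans by blast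
  have "(\<Sum>n'\<in>F. \<bar>onsite w n n'\<bar>) \<le> K + 4" if F: "finite F" for n F
  proof -
    have "(\<Sum>n'\<in>F. \<bar>onsite w n n'\<bar>)
        \<le> (\<Sum>n'\<in>F. (if n' = n then 2 + K else 0) + (if n' = n + 1 then 1 else 0) + (if n' = n - 1 then 1 else 0))"
      using w[of n] K by (intro sum_mono) (auto simp: onsite_def)
    also have "\<dots> \<le> K + 4" using F K by (simp add: sum.distrib sum.delta')
    finally show ?thesis .
  qed
  then have "row_bounded (onsite w) (K + 4)" by (simp add: row_bounded_def)
  moreover have "(\<lambda>n' n. onsite w n n') = onsite w" by (simp add: fun_eq_iff onsite_sym)
  ultimately show ?thesis by (simp add: schur_kernel_def)
qed

lemma entry_kernel_op_onsite:
  assumes "\<And>n. \<bar>w n\<bar> \<le> K"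
  shows "entry (kernel_op (onsite w) \<phi>) n = - laplacian (entry \<phi>) n + complex_of_real (w n) * entry \<phi> n"
proof -
  interpret schur_kernel "onsite w" "K + 4" by (rule schur_kernel_onsite[OF assms])
  have "(\<Sum>\<^sub>\<infinity>n'. complex_of_real (onsite w n n') * entry \<phi> n')
      = (\<Sum>\<^sub>\<infinity>n'\<in>{n - 1, n, n + 1}. complex_of_real (onsite w n n') * entry \<phi> n')"
    by (rule infsum_cong_neutral) (auto simp: onsite_def)
  also have "\<dots> = - laplacian (entry \<phi>) n + complex_of_real (w n) * entry \<phi> n"
    by (simp add: onsite_def laplacian_def algebra_simps)
  finally show ?thesis by (simp add: entry_kernel_op)
qed

text \<open>Rows and columns of a coupling run over lattices with different spacings, 1 - \<theta>
  and 1. The supremum over \<beta> absorbs both the row index and the offset.\<close>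

definition interlayer_bound :: "real \<Rightarrow> (real \<Rightarrow> real) \<Rightarrow> real \<Rightarrow> bool" where
  "interlayer_bound \<theta> h S \<longleftrightarrow> (\<forall>\<beta> F. finite F \<longrightarrow>
     (\<Sum>n\<in>F. \<bar>h (\<beta> - real_of_int n)\<bar>) \<le> S \<and> (\<Sum>n\<in>F. \<bar>h (\<beta> - (1 - \<theta>) * real_of_int n)\<bar>) \<le> S)"

definition kernel12 :: "real \<Rightarrow> (real \<Rightarrow> real) \<Rightarrow> real \<Rightarrow> int \<Rightarrow> int \<Rightarrow> real" where
  "kernel12 \<theta> h b n n' = h (real_of_int n - (1 - \<theta>) * real_of_int n' - b)"

definition kernel21 :: "real \<Rightarrow> (real \<Rightarrow> real) \<Rightarrow> real \<Rightarrow> int \<Rightarrow> int \<Rightarrow> real" where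
  "kernel21 \<theta> h b n n' = h ((1 - \<theta>) * real_of_int n + b - real_of_int n')"

definition bounded_disorder :: "real \<Rightarrow> real \<times> (int \<Rightarrow> real) \<times> (int \<Rightarrow> real) \<Rightarrow> bool" where
  "bounded_disorder K x \<longleftrightarrow> (\<forall>n. \<bar>fst (snd x) n\<bar> \<le> K \<and> \<bar>snd (snd x) n\<bar> \<le> K)"

definition hamiltonian ::
  "real \<Rightarrow> (real \<Rightarrow> real) \<Rightarrow> real \<times> (int \<Rightarrow> real) \<times> (int \<Rightarrow> real) \<Rightarrow> state \<Rightarrow> state" where
  "hamiltonian \<theta> h x \<psi> =
     (kernel_op (onsite (fst (snd x))) (fst \<psi>) + kernel_op (kernel12 \<theta> h (fst x)) (snd \<psi>),
      kernel_op (onsite (snd (snd x))) (snd \<psi>) + kernel_op (kernel21 \<theta> h (fst x)) (fst \<psi>))"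

locale interlayer =
  fixes \<theta> :: real and h :: "real \<Rightarrow> real" and S :: real
  assumes even: "h (- \<eta>) = h \<eta>" and bound: "interlayer_bound \<theta> h S"
begin

lemma S_nonneg: "0 \<le> S"
  using bound unfolding interlayer_bound_def by (metis finite.emptyI sum.empty)

text \<open>Evenness of \<open>h\<close> makes the two couplings transposes of each other, hence the
  Hamiltonian symmetric, and one Schur estimate covers both.\<close>

lemma kernel21_eq: "kernel21 \<theta> h b = (\<lambda>n n'. kernel12 \<theta> h b n' n)"
proof (intro ext)
  fix n n'
  have "(1 - \<theta>) * real_of_int n + b - real_of_int n' = - (real_of_int n' - (1 - \<theta>) * real_of_int n - b)" by simp
  then show "kernel21 \<theta> h b n n' = kernel12 \<theta> h b n' n"
    unfolding kernel12_def kernel21_def by (simp only: even)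
qed

lemma schur_kernel12: "schur_kernel (kernel12 \<theta> h b) S"
proof
  show "row_bounded (kernel12 \<theta> h b) S"
  proof -
    have eq: "real_of_int n - (1 - \<theta>) * real_of_int n' - b = (real_of_int n - b) - (1 - \<theta>) * real_of_int n'" for n n'
      by simp
    show ?thesis
      using bound unfolding row_bounded_def interlayer_bound_def kernel12_def eq by blast
  qed
  show "row_bounded (\<lambda>n' n. kernel12 \<theta> h b n n') S"
    unfolding kernel21_eq[symmetric]
    using bound unfolding row_bounded_def interlayer_bound_def kernel21_def by blast
qed

lemma schur_kernel21: "schur_kernel (kernel21 \<theta> h b) S"
  unfolding kernel21_eq by (rule schur_kernel_transpose[OF schur_kernel12])

lemma H_R_eq:
  assumes "bounded_disorder K x"
  shows "H_R \<theta> h x = (\<lambda>\<psi>. Some (hamiltonian \<theta> h x \<psi>))"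
proof
  fix \<psi>
  obtain b \<omega>\<^sub>1 \<omega>\<^sub>2 where x: "x = (b, \<omega>\<^sub>1, \<omega>\<^sub>2)" by (cases x)
  have w: "\<And>n. \<bar>\<omega>\<^sub>1 n\<bar> \<le> K" "\<And>n. \<bar>\<omega>\<^sub>2 n\<bar> \<le> K" using assms by (auto simp: bounded_disorder_def x)
  have "H_action1 \<theta> h b \<omega>\<^sub>1 \<psi> = entry (fst (hamiltonian \<theta> h x \<psi>))"
    by (simp add: fun_eq_iff H_action1_def hamiltonian_def x plus_ell2.rep_eq entry_kernel_op_onsite[OF w(1)]
        schur_kernel.entry_kernel_op[OF schur_kernel12] kernel12_def)
  moreover have "H_action2 \<theta> h b \<omega>\<^sub>2 \<psi> = entry (snd (hamiltonian \<theta> h x \<psi>))"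
    by (simp add: fun_eq_iff H_action2_def hamiltonian_def x plus_ell2.rep_eq entry_kernel_op_onsite[OF w(2)]
        schur_kernel.entry_kernel_op[OF schur_kernel21] kernel21_def)
  ultimately show "H_R \<theta> h x \<psi> = Some (hamiltonian \<theta> h x \<psi>)"
    by (simp add: H_R_def x square_summable_entry entry_inverse)
qed

text \<open>Each component is bounded by the Schur constants \<open>K + 4\<close> on its own layer
  and \<open>S\<close> from the other; the factor 2 comes from estimating the norm of a pair by the
  sum of the norms.\<close>

lemma self_adjoint_hamiltonian:
  assumes x: "bounded_disorder K x"
  shows "self_adjoint_operator (hamiltonian \<theta> h x) (2 * (K + 4 + S))"
proof (intro self_adjoint_operator.intro symmetric_operator.intro self_adjoint_operator_axioms.intro)
  have w: "\<And>n. \<bar>fst (snd x) n\<bar> \<le> K" "\<And>n. \<bar>snd (snd x) n\<bar> \<le> K" using x by (auto simp: bounded_disorder_def)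
  have K: "0 \<le> K" using w(1)[of 0] abs_ge_zero order_trans by blast
  interpret o1: schur_kernel "onsite (fst (snd x))" "K + 4" by (rule schur_kernel_onsite[OF w(1)])
  interpret o2: schur_kernel "onsite (snd (snd x))" "K + 4" by (rule schur_kernel_onsite[OF w(2)])
  interpret k12: schur_kernel "kernel12 \<theta> h (fst x)" S by (rule schur_kernel12)
  interpret k21: schur_kernel "kernel21 \<theta> h (fst x)" S by (rule schur_kernel21)
  note lins = o1.linear_kernel_op o2.linear_kernel_op k12.linear_kernel_op k21.linear_kernel_op
  show "linear (hamiltonian \<theta> h x)"
    by (rule linearI) (simp_all add: hamiltonian_def lins[THEN linear_add] lins[THEN linear_scale] scaleR_add_right)
  show "0 < 2 * (K + 4 + S)" using K S_nonneg by simp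
  have on: "(\<lambda>n n'. onsite w n' n) = onsite w" for w by (simp add: fun_eq_iff onsite_sym)
  show "hamiltonian \<theta> h x \<phi> \<bullet> \<psi> = \<phi> \<bullet> hamiltonian \<theta> h x \<psi>" for \<phi> \<psi>
    using kernel_op_adjoint[OF o1.schur_kernel_axioms] kernel_op_adjoint[OF o2.schur_kernel_axioms]
      kernel_op_adjoint[OF k12.schur_kernel_axioms] kernel_op_adjoint[OF k21.schur_kernel_axioms]
    by (simp add: hamiltonian_def inner_prod_def inner_add_left inner_add_right on kernel21_eq)
  show "norm (hamiltonian \<theta> h x \<psi>) \<le> 2 * (K + 4 + S) * norm \<psi>" for \<psi>
  proof -
    have f: "norm (fst \<psi>) \<le> norm \<psi>" "norm (snd \<psi>) \<le> norm \<psi>"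
      by (metis norm_fst_le prod.collapse, metis norm_snd_le prod.collapse)
    have "norm (hamiltonian \<theta> h x \<psi>) \<le> norm (fst (hamiltonian \<theta> h x \<psi>)) + norm (snd (hamiltonian \<theta> h x \<psi>))"
      by (metis norm_Pair_le prod.collapse)
    also have "\<dots> \<le> ((K + 4) * norm (fst \<psi>) + S * norm (snd \<psi>)) + ((K + 4) * norm (snd \<psi>) + S * norm (fst \<psi>))"
      unfolding hamiltonian_def fst_conv snd_conv
      by (intro add_mono order_trans[OF norm_triangle_ineq] o1.norm_kernel_op_le o2.norm_kernel_op_le
          k12.norm_kernel_op_le k21.norm_kernel_op_le)
    also have "\<dots> \<le> ((K + 4) * norm \<psi> + S * norm \<psi>) + ((K + 4) * norm \<psi> + S * norm \<psi>)"
      using f K S_nonneg by (intro add_mono mult_left_mono) auto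
    finally show ?thesis by (simp add: algebra_simps)
  qed
  show "hamiltonian \<theta> h x (\<i> *\<^sub>C \<psi>) = \<i> *\<^sub>C hamiltonian \<theta> h x \<psi>" for \<psi>
    by (simp add: hamiltonian_def scaleC_def o1.kernel_op_scaleC o2.kernel_op_scaleC k12.kernel_op_scaleC k21.kernel_op_scaleC)
      (auto intro!: ell2_eqI simp: scaleC_ell2.rep_eq plus_ell2.rep_eq distrib_left)
qed

end

text \<open>The on-site parts cancel, so only the Schur bound of the difference of the couplings
  enters.\<close>

lemma hamiltonian_diff:
  assumes "interlayer \<theta> h S" "interlayer \<theta> h' S'" "interlayer \<theta> (\<lambda>\<eta>. h \<eta> - h' \<eta>) D"
  shows "norm (hamiltonian \<theta> h x \<psi> - hamiltonian \<theta> h' x \<psi>) \<le> 2 * D * norm \<psi>"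
proof -
  interpret h: interlayer \<theta> h S by fact
  interpret h': interlayer \<theta> h' S' by fact
  interpret d: interlayer \<theta> "\<lambda>\<eta>. h \<eta> - h' \<eta>" D by fact
  let ?d = "\<lambda>\<eta>. h \<eta> - h' \<eta>"
  have "kernel12 \<theta> ?d b = (\<lambda>n n'. kernel12 \<theta> h b n n' - kernel12 \<theta> h' b n n')"
    "kernel21 \<theta> ?d b = (\<lambda>n n'. kernel21 \<theta> h b n n' - kernel21 \<theta> h' b n n')" for b
    by (simp_all add: kernel12_def kernel21_def fun_eq_iff)
  then have "hamiltonian \<theta> h x \<psi> - hamiltonian \<theta> h' x \<psi>
      = (kernel_op (kernel12 \<theta> ?d (fst x)) (snd \<psi>), kernel_op (kernel21 \<theta> ?d (fst x)) (fst \<psi>))"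
    by (simp add: hamiltonian_def kernel_op_diff[OF h.schur_kernel12 h'.schur_kernel12] kernel_op_diff[OF h.schur_kernel21 h'.schur_kernel21])
  also have "norm \<dots> \<le> D * norm (snd \<psi>) + D * norm (fst \<psi>)"
    by (rule order_trans[OF norm_Pair_le])
      (intro add_mono schur_kernel.norm_kernel_op_le d.schur_kernel12 d.schur_kernel21)
  also have "\<dots> \<le> D * norm \<psi> + D * norm \<psi>"
    using d.S_nonneg norm_fst_le[of "fst \<psi>" "snd \<psi>"] norm_snd_le[of "snd \<psi>" "fst \<psi>"]
    by (intro add_mono mult_left_mono) auto
  finally show ?thesis by simp
qed

lemma linear_proj_Lambda: "linear (proj_Lambda \<theta> b L)"
  by (rule linearI) (auto simp: proj_Lambda_def intro!: ell2_eqI simp: restrict_ell2.rep_eq plus_ell2.rep_eq scaleR_ell2.rep_eq)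

lemma inner_restrict_ell2: "restrict_ell2 A \<phi> \<bullet> \<psi> = \<phi> \<bullet> restrict_ell2 A \<psi>"
  unfolding inner_ell2_def by (rule infsum_cong) (simp add: restrict_ell2.rep_eq)

lemma restrict_ell2_idem: "restrict_ell2 A (restrict_ell2 A \<phi>) = restrict_ell2 A \<phi>"
  by (rule ell2_eqI) (simp add: restrict_ell2.rep_eq)

lemma inner_proj_Lambda: "proj_Lambda \<theta> b L \<phi> \<bullet> \<psi> = \<phi> \<bullet> proj_Lambda \<theta> b L \<psi>"
  by (simp add: proj_Lambda_def inner_prod_def inner_restrict_ell2)

lemma norm_proj_Lambda_le: "norm (proj_Lambda \<theta> b L \<psi>) \<le> norm \<psi>"
proof -
  let ?P = "proj_Lambda \<theta> b L"
  have "?P (?P \<psi>) = ?P \<psi>" by (simp add: proj_Lambda_def restrict_ell2_idem)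
  then have "(norm (?P \<psi>))\<^sup>2 = \<psi> \<bullet> ?P \<psi>"
    by (simp add: power2_norm_eq_inner inner_proj_Lambda)
  also have "\<dots> \<le> norm \<psi> * norm (?P \<psi>)" by (rule norm_cauchy_schwarz)
  finally show ?thesis
    by (cases "?P \<psi> = 0") (simp_all add: power2_eq_square)
qed

lemma self_adjoint_compression:
  assumes "self_adjoint_operator A M"
  shows "self_adjoint_operator (\<lambda>\<psi>. proj_Lambda \<theta> b L (A (proj_Lambda \<theta> b L \<psi>))) M"
proof -
  interpret self_adjoint_operator A M by fact
  let ?P = "proj_Lambda \<theta> b L"
  show ?thesis
  proof (intro self_adjoint_operator.intro symmetric_operator.intro self_adjoint_operator_axioms.intro)
    show "linear (\<lambda>\<psi>. ?P (A (?P \<psi>)))"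
      using linear_compose[OF linear_compose[OF linear_proj_Lambda lin] linear_proj_Lambda] by (simp add: o_def)
    show "?P (A (?P \<phi>)) \<bullet> \<psi> = \<phi> \<bullet> ?P (A (?P \<psi>))" for \<phi> \<psi>
      by (simp add: inner_proj_Lambda sym)
    show "0 < M" by (rule M_pos)
    show "norm (?P (A (?P \<psi>))) \<le> M * norm \<psi>" for \<psi>
      by (meson M_pos norm_le norm_proj_Lambda_le order_trans less_imp_le mult_left_mono)
    have "?P (\<i> *\<^sub>C \<psi>) = \<i> *\<^sub>C ?P \<psi>" for \<psi>
      by (auto simp: proj_Lambda_def scaleC_def intro!: ell2_eqI simp: restrict_ell2.rep_eq scaleC_ell2.rep_eq)
    then show "?P (A (?P (\<i> *\<^sub>C \<psi>))) = \<i> *\<^sub>C ?P (A (?P \<psi>))" for \<psi> by (simp add: comm_i)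
  qed
qed

definition truncated_hamiltonian ::
  "real \<Rightarrow> (real \<Rightarrow> real) \<Rightarrow> real \<Rightarrow> real \<times> (int \<Rightarrow> real) \<times> (int \<Rightarrow> real) \<Rightarrow> state \<Rightarrow> state" where
  "truncated_hamiltonian \<theta> h L x \<psi> = proj_Lambda \<theta> (fst x) L (hamiltonian \<theta> h x (proj_Lambda \<theta> (fst x) L \<psi>))"

lemma (in interlayer) self_adjoint_truncated_hamiltonian:
  "bounded_disorder K x \<Longrightarrow> self_adjoint_operator (truncated_hamiltonian \<theta> h L x) (2 * (K + 4 + S))"
  unfolding truncated_hamiltonian_def[abs_def]
  by (rule self_adjoint_compression) (rule self_adjoint_hamiltonian)

lemma (in interlayer) H_RL_eq:
  "bounded_disorder K x \<Longrightarrow> H_RL \<theta> h L x = (\<lambda>\<psi>. Some (truncated_hamiltonian \<theta> h L x \<psi>))"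
  by (simp add: H_RL_def H_R_eq lmult_def rmult_def truncated_hamiltonian_def fun_eq_iff)

lemma truncated_hamiltonian_diff:
  assumes "interlayer \<theta> h S" "interlayer \<theta> h' S'" "interlayer \<theta> (\<lambda>\<eta>. h \<eta> - h' \<eta>) D"
  shows "norm (truncated_hamiltonian \<theta> h L x \<psi> - truncated_hamiltonian \<theta> h' L x \<psi>) \<le> 2 * D * norm \<psi>"
proof -
  let ?P = "proj_Lambda \<theta> (fst x) L"
  have "norm (truncated_hamiltonian \<theta> h L x \<psi> - truncated_hamiltonian \<theta> h' L x \<psi>)
      = norm (?P (hamiltonian \<theta> h x (?P \<psi>) - hamiltonian \<theta> h' x (?P \<psi>)))"
    by (simp add: truncated_hamiltonian_def linear_diff[OF linear_proj_Lambda])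
  also have "\<dots> \<le> 2 * D * norm (?P \<psi>)"
    by (rule order_trans[OF norm_proj_Lambda_le hamiltonian_diff[OF assms]])
  also have "\<dots> \<le> 2 * D * norm \<psi>"
    using interlayer.S_nonneg[OF assms(3)] by (intro mult_left_mono norm_proj_Lambda_le) simp
  finally show ?thesis .
qed

section \<open>Finite range interactions and amplitudes\<close>

text \<open>The site \<open>(i, n)\<close> is the n-th site of layer 1 for \<open>i = False\<close> and of layer 2 for \<open>i = True\<close>.\<close>

type_synonym site = "bool \<times> int"

definition pos :: "real \<Rightarrow> real \<Rightarrow> site \<Rightarrow> real" where
  "pos \<theta> b y = (if fst y then (1 - \<theta>) * real_of_int (snd y) + b else real_of_int (snd y))"

definition site_vec :: "site \<Rightarrow> state" where
  "site_vec y = (if fst y then delta2 (snd y) else delta1 (snd y))"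

definition disorder :: "(int \<Rightarrow> real) \<times> (int \<Rightarrow> real) \<Rightarrow> site \<Rightarrow> real" where
  "disorder \<omega> y = (if fst y then snd \<omega> (snd y) else fst \<omega> (snd y))"

text \<open>The couplings \<open>h(n - (1 - \<theta>) n' - b)\<close> and \<open>h((1 - \<theta>) n + b - n')\<close> are both \<open>h(pos y - pos z)\<close>, for \<open>y\<close> the site with index \<open>n\<close> and \<open>z\<close> the site with index \<open>n'\<close> in the other layer.\<close>

definition hop :: "real \<Rightarrow> (real \<Rightarrow> real) \<Rightarrow> real \<Rightarrow> (site \<Rightarrow> real) \<Rightarrow> (site \<Rightarrow> real) \<Rightarrow> site \<Rightarrow> real" where
  "hop \<theta> h b \<omega> v y = 2 * v y - v (fst y, snd y + 1) - v (fst y, snd y - 1) + \<omega> y * v y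
     + (\<Sum>\<^sub>\<infinity>m. h (pos \<theta> b y - pos \<theta> b (\<not> fst y, m)) * v (\<not> fst y, m))"

text \<open>The matrix element between \<open>x\<close> and \<open>y\<close> of the k-th power of
  the Hamiltonian, by \<open>amplitude_eq\<close>. As a recursion on real functions of the site it
  makes sense for every disorder configuration, and locality, continuity and measurability can be
  shown by induction on \<open>k\<close> without reference to operators.\<close>

definition amplitude :: "real \<Rightarrow> (real \<Rightarrow> real) \<Rightarrow> nat \<Rightarrow> real \<Rightarrow> (site \<Rightarrow> real) \<Rightarrow> site \<Rightarrow> site \<Rightarrow> real" where
  "amplitude \<theta> h k b \<omega> x = (hop \<theta> h b \<omega> ^^ k) (\<lambda>y. if y = x then 1 else 0)"

lemma amplitude_0: "amplitude \<theta> h 0 b \<omega> x y = (if y = x then 1 else 0)"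
  by (simp add: amplitude_def)

lemma amplitude_Suc: "amplitude \<theta> h (Suc k) b \<omega> x = hop \<theta> h b \<omega> (amplitude \<theta> h k b \<omega> x)"
  by (simp add: amplitude_def)

lemma inner_delta: "delta n \<bullet> \<phi> = Re (entry \<phi> n)"
proof -
  have "delta n \<bullet> \<phi> = (\<Sum>\<^sub>\<infinity>m\<in>{n}. Re (entry \<phi> n))"
    unfolding inner_ell2_def by (rule infsum_cong_neutral) (auto simp: delta.rep_eq inner_complex_def)
  then show ?thesis by simp
qed

lemma inner_site_vec: "site_vec y \<bullet> \<psi> = Re (entry (if fst y then snd \<psi> else fst \<psi>) (snd y))"
  by (simp add: site_vec_def delta1_def delta2_def inner_prod_def inner_delta)

lemma inner_site_vec_site_vec: "site_vec y \<bullet> site_vec x = (if y = x then 1 else 0)"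
  unfolding inner_site_vec by (auto simp: site_vec_def delta1_def delta2_def delta.rep_eq zero_ell2.rep_eq prod_eq_iff)

lemma norm_site_vec: "norm (site_vec y) = 1"
  by (simp add: norm_eq_sqrt_inner inner_site_vec_site_vec)

lemma Re_kernel_op:
  assumes "schur_kernel t S"
  shows "Re (entry (kernel_op t \<phi>) n) = (\<Sum>\<^sub>\<infinity>n'. t n n' * Re (entry \<phi> n'))"
  unfolding schur_kernel.entry_kernel_op[OF assms]
  by (simp add: infsum_Re[OF schur_kernel.action_summable[OF assms], symmetric])

lemma (in interlayer) inner_site_vec_hamiltonian:
  assumes "bounded_disorder K x"
  shows "site_vec y \<bullet> hamiltonian \<theta> h x \<psi> = hop \<theta> h (fst x) (disorder (snd x)) (\<lambda>z. site_vec z \<bullet> \<psi>) y"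
proof -
  have w: "\<And>n. \<bar>fst (snd x) n\<bar> \<le> K" "\<And>n. \<bar>snd (snd x) n\<bar> \<le> K" using assms by (auto simp: bounded_disorder_def)
  have "(\<Sum>\<^sub>\<infinity>m. h (pos \<theta> (fst x) y - pos \<theta> (fst x) (\<not> fst y, m)) * (site_vec (\<not> fst y, m) \<bullet> \<psi>))
      = (if fst y then \<Sum>\<^sub>\<infinity>m. kernel21 \<theta> h (fst x) (snd y) m * Re (entry (fst \<psi>) m)
         else \<Sum>\<^sub>\<infinity>m. kernel12 \<theta> h (fst x) (snd y) m * Re (entry (snd \<psi>) m))"
    by (simp add: inner_site_vec pos_def kernel12_def kernel21_def algebra_simps)
  then show ?thesis
    by (simp add: hop_def inner_site_vec hamiltonian_def plus_ell2.rep_eq Re_kernel_op[OF schur_kernel12]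
        Re_kernel_op[OF schur_kernel21] entry_kernel_op_onsite[OF w(1)] entry_kernel_op_onsite[OF w(2)]
        laplacian_def disorder_def algebra_simps)
qed

lemma (in interlayer) amplitude_eq:
  assumes "bounded_disorder K x"
  shows "site_vec y \<bullet> (hamiltonian \<theta> h x ^^ k) (site_vec z) = amplitude \<theta> h k (fst x) (disorder (snd x)) z y"
proof (induction k arbitrary: y)
  case 0
  show ?case by (simp add: amplitude_0 inner_site_vec_site_vec)
next
  case (Suc k)
  then show ?case by (simp add: amplitude_Suc inner_site_vec_hamiltonian[OF assms])
qed

lemma norm_funpow_le:
  fixes A :: "'a::real_normed_vector \<Rightarrow> 'a"
  assumes "\<And>\<psi>. norm (A \<psi>) \<le> M * norm \<psi>" "0 \<le> (M::real)"
  shows "norm ((A ^^ k) \<psi>) \<le> M ^ k * norm \<psi>"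
proof (induction k)
  case (Suc k)
  have "norm ((A ^^ Suc k) \<psi>) \<le> M * norm ((A ^^ k) \<psi>)" using assms(1) by simp
  also have "\<dots> \<le> M * (M ^ k * norm \<psi>)" by (intro mult_left_mono Suc assms(2))
  finally show ?case by (simp add: mult.assoc)
qed simp

lemma (in interlayer) amplitude_bound:
  assumes "bounded_disorder K x"
  shows "\<bar>amplitude \<theta> h k (fst x) (disorder (snd x)) z y\<bar> \<le> (2 * (K + 4 + S)) ^ k"
proof -
  interpret self_adjoint_operator "hamiltonian \<theta> h x" "2 * (K + 4 + S)"
    by (rule self_adjoint_hamiltonian[OF assms])
  have "\<bar>site_vec y \<bullet> (hamiltonian \<theta> h x ^^ k) (site_vec z)\<bar> \<le> norm (site_vec y) * norm ((hamiltonian \<theta> h x ^^ k) (site_vec z))"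
    by (rule Cauchy_Schwarz_ineq2)
  also have "\<dots> \<le> (2 * (K + 4 + S)) ^ k"
    using norm_funpow_le[of "hamiltonian \<theta> h x", OF norm_le less_imp_le[OF M_pos], of k "site_vec z"] by (simp add: norm_site_vec)
  finally show ?thesis by (simp add: amplitude_eq[OF assms])
qed

text \<open>With \<open>1 \<le> R\<close> a single radius covers the coupling and the
  nearest-neighbour hops, whose lengths are 1 and 1 - \<theta>.\<close>

locale finite_range =
  fixes \<theta> :: real and h :: "real \<Rightarrow> real" and R :: real
  assumes theta: "0 < \<theta>" "\<theta> < 1" and range: "R < \<bar>\<eta>\<bar> \<Longrightarrow> h \<eta> = 0" and R: "1 \<le> R"
begin

lemma hop_local:
  assumes v: "\<And>z. r < \<bar>pos \<theta> b z - p\<bar> \<Longrightarrow> v z = 0" and y: "r + R < \<bar>pos \<theta> b y - p\<bar>"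
  shows "hop \<theta> h b \<omega> v y = 0"
proof -
  have near: "\<bar>pos \<theta> b (fst y, snd y + j) - pos \<theta> b y\<bar> \<le> R" if j: "j \<in> {-1, 0, 1}" for j
  proof -
    have "pos \<theta> b (fst y, snd y + j) - pos \<theta> b y = (if fst y then 1 - \<theta> else 1) * real_of_int j"
      by (simp add: pos_def algebra_simps)
    moreover have "\<bar>(if fst y then 1 - \<theta> else 1) * real_of_int j\<bar> \<le> 1 * 1"
      unfolding abs_mult using theta j by (intro mult_mono) auto
    ultimately show ?thesis using R by simp
  qed
  have z': "v (fst y, snd y + j) = 0" if "j \<in> {-1, 0, 1}" for j
    using near[OF that] y by (intro v) linarith
  have z: "v y = 0" "v (fst y, snd y + 1) = 0" "v (fst y, snd y - 1) = 0"
    using z'[of 0] z'[of 1] z'[of "-1"] by simp_all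
  have "h (pos \<theta> b y - pos \<theta> b z) * v z = 0" for z
  proof (cases "r < \<bar>pos \<theta> b z - p\<bar>")
    case False
    then have "R < \<bar>pos \<theta> b y - pos \<theta> b z\<bar>" using y by linarith
    then show ?thesis using range by simp
  qed (simp add: v)
  then have "(\<Sum>\<^sub>\<infinity>m. h (pos \<theta> b y - pos \<theta> b (\<not> fst y, m)) * v (\<not> fst y, m)) = 0"
    by (intro infsum_0) blast
  then show ?thesis by (simp add: hop_def z)
qed

lemma amplitude_local:
  "real k * R < \<bar>pos \<theta> b y - pos \<theta> b x\<bar> \<Longrightarrow> amplitude \<theta> h k b \<omega> x y = 0"
proof (induction k arbitrary: y)
  case 0
  then show ?case by (auto simp: amplitude_0)
next
  case (Suc k)
  show ?case unfolding amplitude_Suc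
    by (rule hop_local[where r = "real k * R" and p = "pos \<theta> b x"]) (use Suc in \<open>auto simp: algebra_simps\<close>)
qed

text \<open>The disorder enters \<open>hop\<close> only multiplied by the amplitude at the same
  site, which vanishes beyond distance \<open>k * R\<close>. Amplitudes at distant sites therefore
  depend on disjoint sets of coordinates and are independent.\<close>

lemma amplitude_cong:
  assumes "\<And>z. \<bar>pos \<theta> b z - pos \<theta> b x\<bar> \<le> real k * R \<Longrightarrow> \<omega> z = \<omega>' z"
  shows "amplitude \<theta> h k b \<omega> x = amplitude \<theta> h k b \<omega>' x"
  using assms
proof (induction k)
  case 0
  show ?case by (simp add: amplitude_def)
next
  case (Suc k)
  have le: "real k * R \<le> real (Suc k) * R" using R by simp
  have IH: "amplitude \<theta> h k b \<omega> x = amplitude \<theta> h k b \<omega>' x"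
    by (rule Suc.IH) (use Suc.prems le in fastforce)
  have "\<omega> y * amplitude \<theta> h k b \<omega>' x y = \<omega>' y * amplitude \<theta> h k b \<omega>' x y" for y
  proof (cases "real k * R < \<bar>pos \<theta> b y - pos \<theta> b x\<bar>")
    case False
    then show ?thesis using Suc.prems[of y] le by simp
  qed (simp add: amplitude_local)
  then show ?case unfolding amplitude_Suc IH by (simp add: hop_def fun_eq_iff)
qed

lemma finite_near: "finite {m. \<bar>p - pos \<theta> b (i, m)\<bar> \<le> r}"
proof (cases i)
  case True
  have "{m. \<bar>p - pos \<theta> b (i, m)\<bar> \<le> r} \<subseteq> {\<lfloor>(p - b - r) / (1 - \<theta>)\<rfloor>..\<lceil>(p - b + r) / (1 - \<theta>)\<rceil>}"
    using theta True by (auto simp: pos_def floor_le_iff le_ceiling_iff field_simps)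
  then show ?thesis by (rule finite_subset) simp
next
  case False
  have "{m. \<bar>p - pos \<theta> b (i, m)\<bar> \<le> r} \<subseteq> {\<lfloor>p - r\<rfloor>..\<lceil>p + r\<rceil>}"
    using False by (auto simp: pos_def floor_le_iff le_ceiling_iff)
  then show ?thesis by (rule finite_subset) simp
qed

lemma hop_finite_sum:
  assumes "finite F" "{m. \<bar>pos \<theta> b y - pos \<theta> b (\<not> fst y, m)\<bar> \<le> R} \<subseteq> F"
  shows "(\<Sum>\<^sub>\<infinity>m. h (pos \<theta> b y - pos \<theta> b (\<not> fst y, m)) * v (\<not> fst y, m))
    = (\<Sum>m\<in>F. h (pos \<theta> b y - pos \<theta> b (\<not> fst y, m)) * v (\<not> fst y, m))"
proof -
  have "(\<Sum>\<^sub>\<infinity>m. h (pos \<theta> b y - pos \<theta> b (\<not> fst y, m)) * v (\<not> fst y, m))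
    = (\<Sum>\<^sub>\<infinity>m\<in>F. h (pos \<theta> b y - pos \<theta> b (\<not> fst y, m)) * v (\<not> fst y, m))"
    by (rule infsum_cong_neutral) (use assms(2) range in \<open>force simp: not_le\<close>)+
  then show ?thesis using assms(1) by simp
qed

text \<open>The set of interacting sites changes with \<open>b\<close>. Relative positions move by
  at most 1 while \<open>b\<close> stays within 1 of \<open>b0\<close>, so the sites within
  \<open>R + 1\<close> at \<open>b0\<close> form one finite set that serves this whole
  neighbourhood, and the coupling becomes a fixed finite sum of continuous functions.\<close>

lemma isCont_amplitude:
  assumes "continuous_on UNIV h"
  shows "isCont (\<lambda>b. amplitude \<theta> h k b \<omega> x y) b0"
proof (induction k arbitrary: y)
  case 0
  show ?case by (simp add: amplitude_0)
next
  case (Suc k)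
  define F where "F = {m. \<bar>pos \<theta> b0 y - pos \<theta> b0 (\<not> fst y, m)\<bar> \<le> R + 1}"
  have F: "finite F" unfolding F_def by (rule finite_near)
  have sub: "{m. \<bar>pos \<theta> b y - pos \<theta> b (\<not> fst y, m)\<bar> \<le> R} \<subseteq> F" if "dist b b0 < 1" for b
  proof
    fix m assume "m \<in> {m. \<bar>pos \<theta> b y - pos \<theta> b (\<not> fst y, m)\<bar> \<le> R}"
    moreover have "\<bar>(pos \<theta> b0 y - pos \<theta> b0 (\<not> fst y, m)) - (pos \<theta> b y - pos \<theta> b (\<not> fst y, m))\<bar> \<le> 1"
      using that by (auto simp: pos_def dist_real_def)
    ultimately show "m \<in> F" unfolding F_def mem_Collect_eq by linarith
  qed
  let ?g = "\<lambda>b. 2 * amplitude \<theta> h k b \<omega> x y - amplitude \<theta> h k b \<omega> x (fst y, snd y + 1)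
      - amplitude \<theta> h k b \<omega> x (fst y, snd y - 1) + \<omega> y * amplitude \<theta> h k b \<omega> x y
      + (\<Sum>m\<in>F. h (pos \<theta> b y - pos \<theta> b (\<not> fst y, m)) * amplitude \<theta> h k b \<omega> x (\<not> fst y, m))"
  have "\<forall>\<^sub>F b in nhds b0. amplitude \<theta> h (Suc k) b \<omega> x y = ?g b"
    unfolding eventually_nhds_metric
    by (intro exI[of _ 1]) (auto simp: amplitude_Suc hop_def hop_finite_sum[OF F sub])
  moreover have "isCont ?g b0"
  proof -
    have p: "isCont (\<lambda>b. pos \<theta> b z) b0" for z
      unfolding pos_def by (cases "fst z") (auto intro!: continuous_intros)
    have hc: "isCont h \<eta>" for \<eta> using assms by (simp add: continuous_on_eq_continuous_at)
    have "isCont (\<lambda>b. h (pos \<theta> b y - pos \<theta> b z)) b0" for z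
      by (rule isCont_o2[OF _ hc]) (intro continuous_diff p)
    then show ?thesis
      by (intro continuous_add continuous_diff continuous_mult continuous_sum continuous_const Suc)
  qed
  ultimately show ?case by (simp add: isCont_cong)
qed

end

section \<open>Translation covariance\<close>

lemma bij_shift: "bij (\<lambda>m::int. m + c)"
  by (rule bij_betw_byWitness[where f' = "\<lambda>m. m - c"]) auto

definition translate :: "(bool \<Rightarrow> int) \<Rightarrow> site \<Rightarrow> site" where
  "translate c y = (fst y, snd y + c (fst y))"

text \<open>The coupling sees only differences of positions between the layers. Translating the
  layers by separate amounts changes all these differences by one constant, which the offset
  absorbs; hops inside a layer are unaffected.\<close>

lemma amplitude_translate:
  "amplitude \<theta> h k b \<omega> (translate c x) (translate c y)
    = amplitude \<theta> h k (b - real_of_int (c False) + (1 - \<theta>) * real_of_int (c True)) (\<omega> \<circ> translate c) x y"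
proof (induction k arbitrary: y)
  case 0
  show ?case by (auto simp: amplitude_0 translate_def prod_eq_iff)
next
  case (Suc k)
  let ?b = "b - real_of_int (c False) + (1 - \<theta>) * real_of_int (c True)"
  let ?u = "amplitude \<theta> h k b \<omega> (translate c x)"
  have pos: "pos \<theta> b (translate c y) - pos \<theta> b (translate c z) = pos \<theta> ?b y - pos \<theta> ?b z" if "fst z = (\<not> fst y)" for z
    using that by (cases "fst y") (simp_all add: pos_def translate_def algebra_simps)
  have t: "(\<not> fst y, m + c (\<not> fst y)) = translate c (\<not> fst y, m)" for m by (simp add: translate_def)
  have "(\<Sum>\<^sub>\<infinity>m. h (pos \<theta> b (translate c y) - pos \<theta> b (\<not> fst y, m)) * ?u (\<not> fst y, m))
      = (\<Sum>\<^sub>\<infinity>m. h (pos \<theta> b (translate c y) - pos \<theta> b (translate c (\<not> fst y, m))) * ?u (translate c (\<not> fst y, m)))"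
    unfolding t[symmetric] by (rule infsum_reindex_bij_betw[OF bij_shift, symmetric])
  also have "\<dots> = (\<Sum>\<^sub>\<infinity>m. h (pos \<theta> ?b y - pos \<theta> ?b (\<not> fst y, m)) * amplitude \<theta> h k ?b (\<omega> \<circ> translate c) x (\<not> fst y, m))"
    by (rule infsum_cong) (simp only: pos Suc fst_conv)
  finally have inter: "(\<Sum>\<^sub>\<infinity>m. h (pos \<theta> b (translate c y) - pos \<theta> b (\<not> fst y, m)) * ?u (\<not> fst y, m)) = \<dots>" .
  have nn: "(fst y, snd (translate c y) + 1) = translate c (fst y, snd y + 1)"
    "(fst y, snd (translate c y) - 1) = translate c (fst y, snd y - 1)" "fst (translate c y) = fst y"
    by (simp_all add: translate_def)
  show ?case
    unfolding amplitude_Suc hop_def nn inter Suc by (simp only: o_apply)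
qed

section \<open>Truncated chains and their boundaries\<close>

definition layer_sites :: "real \<Rightarrow> real \<Rightarrow> real \<Rightarrow> bool \<Rightarrow> int set" where
  "layer_sites \<theta> b L i = (if i then Lambda2 \<theta> b L else Lambda1 L)"

definition spacing :: "real \<Rightarrow> bool \<Rightarrow> real" where
  "spacing \<theta> i = (if i then 1 - \<theta> else 1)"

lemma layer_sites_iff: "\<theta> < 1 \<Longrightarrow> n \<in> layer_sites \<theta> b L i \<longleftrightarrow> \<bar>pos \<theta> b (i, n)\<bar> \<le> L"
  by (cases i) (auto simp: layer_sites_def Lambda1_def Lambda2_def pos_def divide_le_eq le_divide_eq algebra_simps)

lemma inner_site_vec_proj_Lambda:
  "\<theta> < 1 \<Longrightarrow> site_vec y \<bullet> proj_Lambda \<theta> b L \<psi> = (if \<bar>pos \<theta> b y\<bar> \<le> L then site_vec y \<bullet> \<psi> else 0)"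
  using layer_sites_iff[of \<theta> "snd y" b L "fst y"]
  by (auto simp: inner_site_vec proj_Lambda_def restrict_ell2.rep_eq layer_sites_def split: if_splits)

text \<open>From a site at distance at least \<open>k * R\<close> from the ends, \<open>k\<close>
  applications of the operator never leave the box, so each projection acts trivially on the vectors
  that occur.\<close>

lemma (in finite_range) truncated_amplitude:
  assumes "interlayer \<theta> h S" and x: "bounded_disorder K x"
    and z: "\<bar>pos \<theta> (fst x) z\<bar> + real k * R \<le> L"
  shows "site_vec z \<bullet> (truncated_hamiltonian \<theta> h L x ^^ k) (site_vec z) = amplitude \<theta> h k (fst x) (disorder (snd x)) z z"
proof -
  interpret interlayer \<theta> h S by fact
  let ?u = "\<lambda>j. amplitude \<theta> h j (fst x) (disorder (snd x)) z"
  have supp: "?u j y = 0" if "j \<le> k" "L < \<bar>pos \<theta> (fst x) y\<bar>" for j y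
  proof (rule amplitude_local)
    have "real j * R \<le> real k * R" using that(1) R by (intro mult_right_mono) auto
    then show "real j * R < \<bar>pos \<theta> (fst x) y - pos \<theta> (fst x) z\<bar>" using that(2) z by linarith
  qed
  have "(\<lambda>y. site_vec y \<bullet> (truncated_hamiltonian \<theta> h L x ^^ j) (site_vec z)) = ?u j" if "j \<le> k" for j
    using that
  proof (induction j)
    case 0
    show ?case by (simp add: fun_eq_iff amplitude_0 inner_site_vec_site_vec)
  next
    case (Suc j)
    define \<psi> where "\<psi> = (truncated_hamiltonian \<theta> h L x ^^ j) (site_vec z)"
    have IH: "site_vec y \<bullet> \<psi> = ?u j y" for y
      using fun_cong[OF Suc.IH, of y] Suc.prems by (simp add: \<psi>_def)
    have restr: "(\<lambda>y. if \<bar>pos \<theta> (fst x) y\<bar> \<le> L then site_vec y \<bullet> \<psi> else 0) = ?u j"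
      using supp[of j] Suc.prems by (auto simp: IH fun_eq_iff)
    have "site_vec y \<bullet> truncated_hamiltonian \<theta> h L x \<psi> = ?u (Suc j) y" for y
      using supp[of "Suc j" y] Suc.prems
      unfolding truncated_hamiltonian_def inner_site_vec_proj_Lambda[OF theta(2)]
        inner_site_vec_hamiltonian[OF x, of y "proj_Lambda \<theta> (fst x) L \<psi>"] restr amplitude_Suc[symmetric]
      by auto
    then show ?case by (simp add: \<psi>_def fun_eq_iff)
  qed
  from fun_cong[OF this[OF order_refl]] show ?thesis .
qed

lemma card_int_interval_le: "real (card {n::int. a \<le> real_of_int n \<and> real_of_int n \<le> c}) \<le> max 0 (c - a + 1)"
proof -
  have "{n::int. a \<le> real_of_int n \<and> real_of_int n \<le> c} = {\<lceil>a\<rceil>..\<lfloor>c\<rfloor>}"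
    by (auto simp: ceiling_le_iff le_floor_iff)
  then show ?thesis by simp linarith
qed

text \<open>The sites near the ends have indices in two intervals of length
  \<open>r / spacing \<theta> i\<close>, whatever \<open>L\<close> is; the summand 1 is for counting
  integers in a closed interval.\<close>

lemma card_boundary_le:
  assumes "0 < \<theta>" "\<theta> < 1" "0 \<le> r"
  shows "real (card {n \<in> layer_sites \<theta> b L i. L < \<bar>pos \<theta> b (i, n)\<bar> + r}) \<le> 2 * (r / spacing \<theta> i + 1)"
proof -
  define \<alpha> where "\<alpha> = spacing \<theta> i"
  define \<beta> where "\<beta> = (if i then b else 0)"
  have \<alpha>: "0 < \<alpha>" using assms by (simp add: \<alpha>_def spacing_def)
  have p: "pos \<theta> b (i, n) = \<alpha> * real_of_int n + \<beta>" for n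
    by (simp add: pos_def \<alpha>_def \<beta>_def spacing_def)
  let ?I = "\<lambda>a c. {n::int. a \<le> real_of_int n \<and> real_of_int n \<le> c}"
  let ?A = "?I ((- L - \<beta>) / \<alpha>) ((- L + r - \<beta>) / \<alpha>)" and ?B = "?I ((L - r - \<beta>) / \<alpha>) ((L - \<beta>) / \<alpha>)"
  have fin: "finite (?I a c)" for a c
    by (rule finite_subset[of _ "{\<lceil>a\<rceil>..\<lfloor>c\<rfloor>}"]) (auto simp: ceiling_le_iff le_floor_iff)
  have "{n \<in> layer_sites \<theta> b L i. L < \<bar>pos \<theta> b (i, n)\<bar> + r} \<subseteq> ?A \<union> ?B"
  proof
    fix n assume "n \<in> {n \<in> layer_sites \<theta> b L i. L < \<bar>pos \<theta> b (i, n)\<bar> + r}"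
    then have "\<bar>\<alpha> * real_of_int n + \<beta>\<bar> \<le> L" "L < \<bar>\<alpha> * real_of_int n + \<beta>\<bar> + r"
      using assms by (auto simp: layer_sites_iff p)
    then have "- L - \<beta> \<le> real_of_int n * \<alpha> \<and> real_of_int n * \<alpha> \<le> - L + r - \<beta> \<or> L - r - \<beta> \<le> real_of_int n * \<alpha> \<and> real_of_int n * \<alpha> \<le> L - \<beta>"
      unfolding mult.commute[of \<alpha>] by linarith
    then show "n \<in> ?A \<union> ?B" using \<alpha> by (simp add: divide_le_eq le_divide_eq)
  qed
  then have "card {n \<in> layer_sites \<theta> b L i. L < \<bar>pos \<theta> b (i, n)\<bar> + r} \<le> card (?A \<union> ?B)"
    using fin by (intro card_mono) auto
  also have "\<dots> \<le> card ?A + card ?B" by (rule card_Un_le)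
  finally have "real (card {n \<in> layer_sites \<theta> b L i. L < \<bar>pos \<theta> b (i, n)\<bar> + r}) \<le> real (card ?A) + real (card ?B)"
    by linarith
  also have "\<dots> \<le> (r / \<alpha> + 1) + (r / \<alpha> + 1)"
  proof (intro add_mono)
    have "(- L + r - \<beta>) / \<alpha> - (- L - \<beta>) / \<alpha> = r / \<alpha>" "(L - \<beta>) / \<alpha> - (L - r - \<beta>) / \<alpha> = r / \<alpha>" "0 \<le> r / \<alpha>"
      using \<alpha> assms by (simp_all add: field_simps)
    then show "real (card ?A) \<le> r / \<alpha> + 1" "real (card ?B) \<le> r / \<alpha> + 1"
      using card_int_interval_le[of "(- L - \<beta>) / \<alpha>" "(- L + r - \<beta>) / \<alpha>"] card_int_interval_le[of "(L - r - \<beta>) / \<alpha>" "(L - \<beta>) / \<alpha>"]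
      by linarith+
  qed
  finally show ?thesis by (simp add: \<alpha>_def)
qed

text \<open>The support may vary with the point, but at each point the symmetric partial sums are
  eventually equal to the full sum, so measurability follows as for a pointwise limit.\<close>

lemma borel_measurable_infsum_finite_support:
  fixes f :: "int \<Rightarrow> 'a \<Rightarrow> real"
  assumes "\<And>m. f m \<in> borel_measurable M" and "\<And>x. x \<in> space M \<Longrightarrow> finite {m. f m x \<noteq> 0}"
  shows "(\<lambda>x. \<Sum>\<^sub>\<infinity>m. f m x) \<in> borel_measurable M"
proof (rule borel_measurable_LIMSEQ_real)
  show "(\<lambda>x. \<Sum>m\<in>{- int N..int N}. f m x) \<in> borel_measurable M" for N
    using assms(1) by measurable
  fix x assume "x \<in> space M"
  note fin = assms(2)[OF this]
  obtain N where N: "\<And>m. f m x \<noteq> 0 \<Longrightarrow> \<bar>m\<bar> \<le> int N"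
  proof -
    obtain B where B: "\<And>m. m \<in> {m. f m x \<noteq> 0} \<Longrightarrow> \<bar>m\<bar> \<le> B"
      using finite_imageI[OF fin, of abs] by (metis Max_ge image_eqI)
    show ?thesis by (rule that[of "nat B"]) (use B in force)
  qed
  show "(\<lambda>N. \<Sum>m\<in>{- int N..int N}. f m x) \<longlonglongrightarrow> (\<Sum>\<^sub>\<infinity>m. f m x)"
  proof (rule tendsto_eventually, unfold eventually_sequentially, intro exI[of _ N] allI impI)
    fix n assume "N \<le> n"
    have "(\<Sum>\<^sub>\<infinity>m. f m x) = (\<Sum>\<^sub>\<infinity>m\<in>{- int n..int n}. f m x)"
      by (rule infsum_cong_neutral) (use N \<open>N \<le> n\<close> in force)+
    then show "(\<Sum>m\<in>{- int n..int n}. f m x) = (\<Sum>\<^sub>\<infinity>m. f m x)" by simp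
  qed
qed

lemma measurable_disorder_component:
  assumes "sets P0 = sets (borel :: real measure)"
  shows "(\<lambda>\<omega>. \<omega> y) \<in> borel_measurable (\<Pi>\<^sub>M y\<in>(UNIV :: site set). P0)"
proof -
  have "(\<lambda>\<omega>. \<omega> y) \<in> (\<Pi>\<^sub>M y\<in>(UNIV :: site set). P0) \<rightarrow>\<^sub>M P0" by simp
  then show ?thesis using assms by (simp cong: measurable_cong_sets)
qed

lemma (in finite_range) measurable_amplitude:
  assumes "continuous_on UNIV h" and P0: "sets P0 = sets (borel :: real measure)"
  shows "(\<lambda>p. amplitude \<theta> h k (fst p) (snd p) x y) \<in> borel_measurable (borel \<Otimes>\<^sub>M (\<Pi>\<^sub>M y\<in>(UNIV :: site set). P0))"
proof (induction k arbitrary: y)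
  case 0
  show ?case by (simp add: amplitude_0)
next
  case (Suc k)
  have h[measurable]: "h \<in> borel_measurable borel" by (rule borel_measurable_continuous_onI) fact
  have p[measurable]: "(\<lambda>p. pos \<theta> (fst p) z) \<in> borel_measurable (borel \<Otimes>\<^sub>M (\<Pi>\<^sub>M y\<in>(UNIV :: site set). P0))" for z
    unfolding pos_def by (cases "fst z") (simp_all, measurable)
  have w[measurable]: "(\<lambda>p. snd p y) \<in> borel_measurable (borel \<Otimes>\<^sub>M (\<Pi>\<^sub>M y\<in>(UNIV :: site set). P0))"
    by (rule measurable_compose[OF measurable_snd measurable_disorder_component[OF P0]])
  note Suc[measurable]
  have [measurable]: "(\<lambda>p. \<Sum>\<^sub>\<infinity>m. h (pos \<theta> (fst p) y - pos \<theta> (fst p) (\<not> fst y, m)) * amplitude \<theta> h k (fst p) (snd p) x (\<not> fst y, m))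
      \<in> borel_measurable (borel \<Otimes>\<^sub>M (\<Pi>\<^sub>M y\<in>(UNIV :: site set). P0))"
  proof (rule borel_measurable_infsum_finite_support)
    fix p :: "real \<times> (site \<Rightarrow> real)"
    show "finite {m. h (pos \<theta> (fst p) y - pos \<theta> (fst p) (\<not> fst y, m)) * amplitude \<theta> h k (fst p) (snd p) x (\<not> fst y, m) \<noteq> 0}"
      by (rule finite_subset[OF _ finite_near[of "pos \<theta> (fst p) y" "fst p" "\<not> fst y" R]]) (use range in \<open>force simp: not_le[symmetric]\<close>)
  qed measurable
  show ?case unfolding amplitude_Suc hop_def by measurable
qed

section \<open>Product measures\<close>

lemma indep_vars_PiM_coordinates:
  assumes "\<And>i. i \<in> I \<Longrightarrow> prob_space (M i)" and "I \<noteq> {}"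
  shows "prob_space.indep_vars (PiM I M) M (\<lambda>i \<omega>. \<omega> i) I"
proof -
  interpret P: prob_space "PiM I M" by (rule prob_space_PiM) (rule assms(1))
  have "distr (PiM I M) (PiM I M) (\<lambda>\<omega>. \<lambda>i\<in>I. \<omega> i) = distr (PiM I M) (PiM I M) (\<lambda>\<omega>. \<omega>)"
    by (rule distr_cong) (auto simp: space_PiM)
  also have "\<dots> = PiM I (\<lambda>i. distr (PiM I M) (M i) (\<lambda>\<omega>. \<omega> i))"
    using assms(1) by (simp add: distr_id2 distr_PiM_component cong: PiM_cong)
  finally show ?thesis
    by (subst P.indep_vars_iff_distr_eq_PiM') (use assms(2) in auto)
qed

lemma PiM_integral_mult_disjoint:
  fixes f g :: "('i \<Rightarrow> real) \<Rightarrow> real"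
  assumes P0: "prob_space P0" "sets P0 = sets borel"
    and f[measurable]: "f \<in> borel_measurable (\<Pi>\<^sub>M i\<in>(UNIV :: 'i set). P0)"
    and g[measurable]: "g \<in> borel_measurable (\<Pi>\<^sub>M i\<in>(UNIV :: 'i set). P0)"
    and fint: "integrable (\<Pi>\<^sub>M i\<in>(UNIV :: 'i set). P0) f" and gint: "integrable (\<Pi>\<^sub>M i\<in>(UNIV :: 'i set). P0) g"
    and fdep: "\<And>\<omega> \<omega>'. (\<And>i. i \<in> A \<Longrightarrow> \<omega> i = \<omega>' i) \<Longrightarrow> f \<omega> = f \<omega>'"
    and gdep: "\<And>\<omega> \<omega>'. (\<And>i. i \<in> B \<Longrightarrow> \<omega> i = \<omega>' i) \<Longrightarrow> g \<omega> = g \<omega>'"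
    and disj: "A \<inter> B = {}"
  shows "(\<integral>\<omega>. f \<omega> * g \<omega> \<partial>(\<Pi>\<^sub>M i\<in>(UNIV :: 'i set). P0))
    = (\<integral>\<omega>. f \<omega> \<partial>(\<Pi>\<^sub>M i\<in>(UNIV :: 'i set). P0)) * (\<integral>\<omega>. g \<omega> \<partial>(\<Pi>\<^sub>M i\<in>(UNIV :: 'i set). P0))"
proof -
  let ?M = "\<Pi>\<^sub>M i\<in>(UNIV :: 'i set). P0"
  interpret M: prob_space ?M by (rule prob_space_PiM) (rule P0)
  have sp: "space P0 = UNIV" using sets_eq_imp_space_eq[OF P0(2)] by simp
  have "M.indep_vars (\<lambda>_. P0) (\<lambda>i \<omega>. \<omega> i) UNIV"
    by (rule indep_vars_PiM_coordinates) (use P0 in auto)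
  then have indep: "M.indep_var (PiM A (\<lambda>_. P0)) (\<lambda>\<omega>. \<lambda>i\<in>A. \<omega> i) (PiM B (\<lambda>_. P0)) (\<lambda>\<omega>. \<lambda>i\<in>B. \<omega> i)"
    by (rule M.indep_var_restrict) (use disj in auto)
  \<comment> \<open>Refilling the forgotten coordinates with 0 exhibits \<open>f\<close> and
    \<open>g\<close> as measurable functions of the restricted families, which are independent; by
    \<open>fdep\<close> and \<open>gdep\<close> the filling does not alter their values.\<close>
  define ext where "ext C \<omega> i = (if i \<in> C then \<omega> i else 0)" for C and \<omega> :: "'i \<Rightarrow> real" and i
  have ext_meas: "ext C \<in> PiM C (\<lambda>_. P0) \<rightarrow>\<^sub>M ?M" for C
  proof (rule measurable_PiM_single')
    show "(\<lambda>\<omega>. ext C \<omega> i) \<in> PiM C (\<lambda>_. P0) \<rightarrow>\<^sub>M P0" for i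
      by (cases "i \<in> C") (simp_all add: ext_def sp)
  qed (auto simp: sp)
  have "M.indep_var borel ((f \<circ> ext A) \<circ> (\<lambda>\<omega>. \<lambda>i\<in>A. \<omega> i)) borel ((g \<circ> ext B) \<circ> (\<lambda>\<omega>. \<lambda>i\<in>B. \<omega> i))"
    by (rule M.indep_var_compose[OF indep]) (intro measurable_comp[OF ext_meas] f g)+
  moreover have "(f \<circ> ext A) \<circ> (\<lambda>\<omega>. \<lambda>i\<in>A. \<omega> i) = f" "(g \<circ> ext B) \<circ> (\<lambda>\<omega>. \<lambda>i\<in>B. \<omega> i) = g"
    by (auto simp: fun_eq_iff ext_def intro!: fdep gdep)
  ultimately have "M.indep_var borel f borel g" by simp
  then show ?thesis by (rule M.indep_var_lebesgue_integral) (rule fint gint)+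
qed

lemma PiM_distr_reindex_bij:
  assumes "prob_space P0" "inj T"
  shows "distr (\<Pi>\<^sub>M i\<in>UNIV. P0) (\<Pi>\<^sub>M i\<in>UNIV. P0) (\<lambda>\<omega>. \<omega> \<circ> T) = (\<Pi>\<^sub>M i\<in>UNIV. P0)"
  using distr_PiM_reindex[of UNIV "\<lambda>_. P0" T UNIV] assms by (simp add: comp_def restrict_def)

section \<open>Ergodic averages of the amplitudes\<close>

locale disordered_chain = interlayer \<theta> h S + finite_range \<theta> h R for \<theta> h S R +
  fixes P0 :: "real measure" and K :: real
  assumes P0: "prob_space P0" "sets P0 = sets borel" and K: "AE y in P0. \<bar>y\<bar> \<le> K"
    and irrational: "\<theta> \<notin> \<rat>" and cont: "continuous_on UNIV h"
begin

text \<open>One product over all sites instead of a pair of products over the layers, so that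
  translation and independence concern a single index set. The passage back to the pair is
  \<open>distr_disorder\<close>.\<close>

abbreviation Prob :: "(site \<Rightarrow> real) measure" where "Prob \<equiv> \<Pi>\<^sub>M y\<in>UNIV. P0"

sublocale Pr: prob_space Prob
  by (rule prob_space_PiM) (rule P0)

text \<open>The spacing of the other layer: moving that layer by one site leaves
  \<open>(i, 0)\<close> in place and changes the offset by this amount.\<close>

definition period :: "bool \<Rightarrow> real" where "period i = (if i then 1 else 1 - \<theta>)"

text \<open>In law, moving from one site of layer \<open>i\<close> to the next is the same as increasing \<open>b\<close> by \<open>drift i\<close>.\<close>

definition drift :: "bool \<Rightarrow> real" where "drift i = (if i then 1 - \<theta> else - 1)"

definition moment :: "nat \<Rightarrow> bool \<Rightarrow> real \<Rightarrow> real" where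
  "moment k i b = (\<integral>\<omega>. amplitude \<theta> h k b \<omega> (i, 0) (i, 0) \<partial>Prob)"

definition mean_moment :: "nat \<Rightarrow> bool \<Rightarrow> real" where
  "mean_moment k i = integral {0..period i} (moment k i) / period i"

abbreviation amp_bound :: "nat \<Rightarrow> real" where "amp_bound k \<equiv> (2 * (K + 4 + S)) ^ k"

lemma AE_bounded: "AE \<omega> in Prob. \<forall>y. \<bar>\<omega> y\<bar> \<le> K"
proof -
  have "AE \<omega> in Prob. \<bar>\<omega> y\<bar> \<le> K" for y
    by (rule AE_PiM_component) (use P0 K in auto)
  then show ?thesis by (simp add: AE_all_countable)
qed

lemma K_nonneg: "0 \<le> K"
proof -
  interpret P: prob_space P0 by (rule P0)
  have "AE y in P0. 0 \<le> K" using K by eventually_elim auto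
  then show ?thesis by simp
qed

lemma amp_bound_nonneg: "0 \<le> amp_bound k"
  using K_nonneg S_nonneg by simp

lemma amplitude_le:
  assumes "\<forall>y. \<bar>\<omega> y\<bar> \<le> K"
  shows "\<bar>amplitude \<theta> h k b \<omega> x y\<bar> \<le> amp_bound k"
proof -
  let ?x = "(b, (\<lambda>n. \<omega> (False, n)), (\<lambda>n. \<omega> (True, n)))"
  have "disorder (snd ?x) = \<omega>"
  proof
    show "disorder (snd ?x) y = \<omega> y" for y by (cases y) (simp add: disorder_def)
  qed
  then show ?thesis
    using amplitude_bound[of K ?x k x y] assms by (simp add: bounded_disorder_def)
qed

lemma AE_amplitude_le: "AE \<omega> in Prob. \<bar>amplitude \<theta> h k b \<omega> x y\<bar> \<le> amp_bound k"
  using AE_bounded by eventually_elim (rule amplitude_le)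

lemma measurable_amplitude_snd [measurable]: "(\<lambda>\<omega>. amplitude \<theta> h k b \<omega> x y) \<in> borel_measurable Prob"
  using measurable_compose[OF measurable_Pair1'[of b borel Prob] measurable_amplitude[OF cont P0(2), of k x y]] by simp

lemma integrable_amplitude: "integrable Prob (\<lambda>\<omega>. amplitude \<theta> h k b \<omega> x y)"
  by (rule Pr.integrable_const_bound[of _ "amp_bound k"]) (use AE_amplitude_le in simp_all)

text \<open>The product of identical laws is invariant under relabelling the sites, so in the mean
  the covariance of \<open>amplitude_translate\<close> is a pure shift of the offset.\<close>

lemma integral_translate:
  "(\<integral>\<omega>. amplitude \<theta> h k b \<omega> (translate c x) (translate c y) \<partial>Prob)
    = (\<integral>\<omega>. amplitude \<theta> h k (b - real_of_int (c False) + (1 - \<theta>) * real_of_int (c True)) \<omega> x y \<partial>Prob)"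
proof -
  have inj: "inj (translate c)" by (auto simp: inj_on_def translate_def prod_eq_iff)
  have T: "(\<lambda>\<omega>. \<omega> \<circ> translate c) \<in> Prob \<rightarrow>\<^sub>M Prob"
    by (rule measurable_PiM_single') (auto simp: space_PiM PiE_iff)
  show ?thesis
    unfolding amplitude_translate
    by (subst (2) PiM_distr_reindex_bij[OF P0(1) inj, symmetric]) (simp add: integral_distr[OF T])
qed

lemma moment_site: "(\<integral>\<omega>. amplitude \<theta> h k b \<omega> (i, n) (i, n) \<partial>Prob) = moment k i (b + real_of_int n * drift i)"
  using integral_translate[of k b "\<lambda>j. if j = i then n else 0" "(i, 0)" "(i, 0)"]
  by (cases i) (simp_all add: translate_def moment_def drift_def algebra_simps)

lemma moment_period: "moment k i (b + period i) = moment k i b"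
  using integral_translate[of k b "\<lambda>j. if j = i then 0 else if i then - 1 else 1" "(i, 0)" "(i, 0)"]
  by (cases i) (simp_all add: translate_def moment_def period_def algebra_simps)

lemma abs_moment_le: "\<bar>moment k i b\<bar> \<le> amp_bound k"
proof -
  have "\<bar>moment k i b\<bar> \<le> (\<integral>\<omega>. \<bar>amplitude \<theta> h k b \<omega> (i, 0) (i, 0)\<bar> \<partial>Prob)"
    unfolding moment_def by (rule integral_abs_bound)
  also have "\<dots> \<le> (\<integral>\<omega>. amp_bound k \<partial>Prob)"
    by (rule integral_mono_AE) (use integrable_amplitude AE_amplitude_le in auto)
  finally show ?thesis by (simp add: Pr.prob_space)
qed

lemma continuous_moment: "continuous_on UNIV (moment k i)"
  unfolding continuous_on_eq_continuous_at[OF open_UNIV]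
proof
  fix b0
  show "isCont (moment k i) b0"
    unfolding continuous_at_sequentially
  proof (intro allI impI)
    fix X :: "nat \<Rightarrow> real" assume "X \<longlonglongrightarrow> b0"
    then have lim: "(\<lambda>n. amplitude \<theta> h k (X n) \<omega> (i, 0) (i, 0)) \<longlonglongrightarrow> amplitude \<theta> h k b0 \<omega> (i, 0) (i, 0)" for \<omega>
      by (rule isCont_tendsto_compose[OF isCont_amplitude[OF cont]])
    show "(moment k i \<circ> X) \<longlonglongrightarrow> moment k i b0"
      unfolding moment_def comp_def
      by (rule integral_dominated_convergence[where w = "\<lambda>_. amp_bound k"]) (use lim AE_amplitude_le in auto)
  qed
qed

lemma irrational_ratio: "- drift i / period i \<notin> \<rat>" "drift i / period i \<notin> \<rat>"
proof -
  have *: "drift i / period i \<notin> \<rat>"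
  proof (cases i)
    case True
    have "1 - \<theta> \<notin> \<rat>" using irrational by (metis Rats_1 Rats_diff add_diff_cancel_left' diff_add_cancel)
    then show ?thesis using True by (simp add: drift_def period_def)
  next
    case False
    have "- 1 / (1 - \<theta>) \<notin> \<rat>"
    proof
      assume "- 1 / (1 - \<theta>) \<in> \<rat>"
      from Rats_add[OF Rats_1 Rats_divide[OF Rats_1 this]]
      have "1 + 1 / (- 1 / (1 - \<theta>)) \<in> \<rat>" .
      then show False using irrational theta by simp
    qed
    then show ?thesis using False by (simp add: drift_def period_def)
  qed
  show "drift i / period i \<notin> \<rat>" by (rule *)
  show "- drift i / period i \<notin> \<rat>" using * by (metis Rats_minus_iff minus_divide_left)
qed

lemma period_pos: "0 < period i"
  using theta by (simp add: period_def)

text \<open>The two choices of \<open>f\<close> run through the nonnegative and the negative sites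
  of a layer. Deviations from the means are averaged by the law of large numbers, while the means
  are values of \<open>moment k i\<close> along a rotation with irrational ratio of step to period,
  so no offset is exceptional.\<close>

lemma ergodic_average:
  fixes f :: "nat \<Rightarrow> int"
  assumes f: "f = int \<or> f = (\<lambda>n. - 1 - int n)"
  shows "AE \<omega> in Prob. (\<lambda>N. (\<Sum>n<N. amplitude \<theta> h k b \<omega> (i, f n) (i, f n)) / real N) \<longlonglongrightarrow> mean_moment k i"
proof -
  define Y where "Y n \<omega> = amplitude \<theta> h k b \<omega> (i, f n) (i, f n)" for n \<omega>
  define c where "c n = moment k i (b + real_of_int (f n) * drift i)" for n
  have Ymeas[measurable]: "Y n \<in> borel_measurable Prob" for n unfolding Y_def by measurable
  have Yint: "integrable Prob (Y n)" for n unfolding Y_def[abs_def] by (rule integrable_amplitude)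
  have EY: "(\<integral>\<omega>. Y n \<omega> \<partial>Prob) = c n" for n by (simp add: Y_def c_def moment_site)
  \<comment> \<open>Sites of one layer are at least 1 - \<theta> apart, so an index distance above
    \<open>D\<close> separates two balls of radius \<open>k * R\<close>, on which the amplitudes
    depend.\<close>
  obtain D :: nat where D: "2 * real k * R / (1 - \<theta>) < real D" using reals_Archimedean2 by blast
  have centered: "AE \<omega> in Prob. (\<lambda>N. (\<Sum>n<N. Y n \<omega> - c n) / real N) \<longlonglongrightarrow> 0"
  proof (rule Pr.slln_finite_range[where B = "2 * amp_bound k" and D = D])
    show "AE \<omega> in Prob. \<bar>Y n \<omega> - c n\<bar> \<le> 2 * amp_bound k" for n
      using AE_amplitude_le[of k b "(i, f n)" "(i, f n)"]
    proof eventually_elim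
      case (elim \<omega>)
      then show ?case
        using abs_moment_le[of k i "b + real_of_int (f n) * drift i"] unfolding Y_def c_def by linarith
    qed
    show "0 \<le> 2 * amp_bound k" using amp_bound_nonneg by simp
    fix m n assume mn: "m + D < n"
    define ball where "ball j = {z. \<bar>pos \<theta> b z - pos \<theta> b (i, f j)\<bar> \<le> real k * R}" for j
    have "(1 - \<theta>) * real D < \<bar>pos \<theta> b (i, f m) - pos \<theta> b (i, f n)\<bar>"
    proof -
      have "pos \<theta> b (i, f m) - pos \<theta> b (i, f n) = (if i then 1 - \<theta> else 1) * (real_of_int (f m) - real_of_int (f n))"
        by (simp add: pos_def algebra_simps)
      moreover have "\<bar>real_of_int (f m) - real_of_int (f n)\<bar> = real n - real m"
        using f mn by auto
      ultimately have "\<bar>pos \<theta> b (i, f m) - pos \<theta> b (i, f n)\<bar> = (if i then 1 - \<theta> else 1) * (real n - real m)"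
        using theta by (simp add: abs_mult)
      moreover have "(1 - \<theta>) * real D < (1 - \<theta>) * (real n - real m)"
        using theta mn by (intro mult_strict_left_mono) auto
      moreover have "(1 - \<theta>) * (real n - real m) \<le> (if i then 1 - \<theta> else 1) * (real n - real m)"
        using theta mn by (intro mult_right_mono) auto
      ultimately show ?thesis by linarith
    qed
    moreover have "2 * real k * R < (1 - \<theta>) * real D" using D theta by (simp add: field_simps)
    ultimately have "2 * real k * R < \<bar>pos \<theta> b (i, f m) - pos \<theta> b (i, f n)\<bar>" by linarith
    then have disj: "ball m \<inter> ball n = {}"
      unfolding ball_def by (auto simp: abs_if split: if_splits)
    have dep: "Y j \<omega> - c j = Y j \<omega>' - c j" if "\<And>z. z \<in> ball j \<Longrightarrow> \<omega> z = \<omega>' z" for j \<omega> \<omega>'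
      using amplitude_cong[of b "(i, f j)" k \<omega> \<omega>'] that by (simp add: Y_def ball_def)
    have "(\<integral>\<omega>. (Y m \<omega> - c m) * (Y n \<omega> - c n) \<partial>Prob) = (\<integral>\<omega>. Y m \<omega> - c m \<partial>Prob) * (\<integral>\<omega>. Y n \<omega> - c n \<partial>Prob)"
      by (rule PiM_integral_mult_disjoint[OF P0 _ _ _ _ dep dep disj]) (use Yint in auto)
    also have "\<dots> = 0" using Yint by (simp add: EY Pr.prob_space)
    finally show "(\<integral>\<omega>. (Y m \<omega> - c m) * (Y n \<omega> - c n) \<partial>Prob) = 0" .
  qed measurable
  have equi: "(\<lambda>N. (\<Sum>n<N. moment k i (b' + real n * s)) / real N) \<longlonglongrightarrow> mean_moment k i"
    if "s / period i \<notin> \<rat>" for b' s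
    unfolding mean_moment_def
    by (rule equidistribution_period[OF continuous_moment period_pos moment_period that])
  have means: "(\<lambda>N. (\<Sum>n<N. c n) / real N) \<longlonglongrightarrow> mean_moment k i"
    using f
  proof
    assume "f = int"
    then show ?thesis
      using equi[OF irrational_ratio(2), of b] by (simp add: c_def)
  next
    assume "f = (\<lambda>n. - 1 - int n)"
    \<comment> \<open>This enumeration starts at site -1 and moves backwards, so the rotation starts
      at \<open>b - drift i\<close> and has step \<open>- drift i\<close>.\<close>
    then have "c n = moment k i ((b - drift i) + real n * (- drift i))" for n
      by (simp add: c_def algebra_simps)
    then show ?thesis
      using equi[OF irrational_ratio(1), of "b - drift i"] by simp
  qed
  from centered show ?thesis
  proof eventually_elim
    case (elim \<omega>)
    from tendsto_add[OF this means] show ?case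
      by (simp add: Y_def sum_subtractf diff_divide_distrib)
  qed
qed

end

text \<open>Restricting the tolerance to \<open>1 / (j + 1)\<close> leaves countably many
  quantifiers.\<close>

lemma pred_LIMSEQ:
  fixes u :: "nat \<Rightarrow> 'a \<Rightarrow> real"
  assumes [measurable]: "\<And>n. u n \<in> borel_measurable M"
  shows "Measurable.pred M (\<lambda>x. (\<lambda>n. u n x) \<longlonglongrightarrow> c)"
proof -
  have "(\<lambda>n. u n x) \<longlonglongrightarrow> c \<longleftrightarrow> (\<forall>j. \<exists>N. \<forall>n. N \<le> n \<longrightarrow> \<bar>u n x - c\<bar> < 1 / real (Suc j))" for x
  proof
    assume l: "(\<lambda>n. u n x) \<longlonglongrightarrow> c"
    have "\<exists>N. \<forall>n. N \<le> n \<longrightarrow> \<bar>u n x - c\<bar> < 1 / real (Suc j)" for j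
      using LIMSEQ_D[OF l, of "1 / real (Suc j)"] by simp
    then show "\<forall>j. \<exists>N. \<forall>n. N \<le> n \<longrightarrow> \<bar>u n x - c\<bar> < 1 / real (Suc j)" by blast
  next
    assume a: "\<forall>j. \<exists>N. \<forall>n. N \<le> n \<longrightarrow> \<bar>u n x - c\<bar> < 1 / real (Suc j)"
    show "(\<lambda>n. u n x) \<longlonglongrightarrow> c"
    proof (rule LIMSEQ_I)
      fix r :: real assume "0 < r"
      then obtain j where j: "1 / real (Suc j) < r" using nat_approx_posE by blast
      obtain N where "\<forall>n. N \<le> n \<longrightarrow> \<bar>u n x - c\<bar> < 1 / real (Suc j)" using a by blast
      then show "\<exists>N. \<forall>n\<ge>N. norm (u n x - c) < r" using j by (intro exI[of _ N]) force
    qed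
  qed
  then show ?thesis by simp
qed

section \<open>Passing between the two layers and a single family of sites\<close>

locale disorder_law =
  fixes P0 :: "real measure" and K :: real
  assumes P0: "prob_space P0" "sets P0 = sets borel" and K: "AE y in P0. \<bar>y\<bar> \<le> K"
begin

abbreviation Pair2 :: "((int \<Rightarrow> real) \<times> (int \<Rightarrow> real)) measure" where
  "Pair2 \<equiv> disorder_measure P0 \<Otimes>\<^sub>M disorder_measure P0"

sublocale D: prob_space "disorder_measure P0"
  unfolding disorder_measure_def by (rule prob_space_PiM) (rule P0)

sublocale DD: pair_prob_space "disorder_measure P0" "disorder_measure P0" ..

lemma space_P0: "space P0 = UNIV"
  using sets_eq_imp_space_eq[OF P0(2)] by simp

lemma measurable_disorder_P0: "(\<lambda>\<omega>. disorder \<omega> y) \<in> Pair2 \<rightarrow>\<^sub>M P0"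
  unfolding disorder_def disorder_measure_def by (cases "fst y") (simp_all, measurable)

lemma measurable_disorder [measurable]: "disorder \<in> Pair2 \<rightarrow>\<^sub>M (\<Pi>\<^sub>M y\<in>UNIV. P0)"
proof (rule measurable_PiM_single')
  show "(\<lambda>\<omega>. disorder \<omega> y) \<in> Pair2 \<rightarrow>\<^sub>M P0" for y by (rule measurable_disorder_P0)
qed (auto simp: space_P0)

text \<open>Under the product over all sites the two layers are independent, so splitting a
  configuration into layers has the product law; \<open>disorder\<close> inverts this
  splitting.\<close>

lemma distr_disorder: "distr Pair2 (\<Pi>\<^sub>M y\<in>UNIV. P0) disorder = (\<Pi>\<^sub>M y\<in>UNIV. P0)"
proof -
  let ?M = "\<Pi>\<^sub>M y\<in>(UNIV :: site set). P0" and ?D = "disorder_measure P0"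
  interpret M: prob_space ?M by (rule prob_space_PiM) (rule P0)
  define layer where "layer i \<omega> n = \<omega> (i, n)" for i :: bool and \<omega> :: "site \<Rightarrow> real" and n :: int
  define A where "A i = {i} \<times> (UNIV :: int set)" for i :: bool
  have "M.indep_vars (\<lambda>_. P0) (\<lambda>y \<omega>. \<omega> y) UNIV"
    by (rule indep_vars_PiM_coordinates) (use P0 in auto)
  then have indep: "M.indep_var (PiM (A False) (\<lambda>_. P0)) (\<lambda>\<omega>. \<lambda>y\<in>A False. \<omega> y) (PiM (A True) (\<lambda>_. P0)) (\<lambda>\<omega>. \<lambda>y\<in>A True. \<omega> y)"
    by (rule M.indep_var_restrict) (auto simp: A_def)
  have lm: "layer i \<in> PiM (A i) (\<lambda>_. P0) \<rightarrow>\<^sub>M ?D" for i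
    unfolding layer_def disorder_measure_def
    by (rule measurable_PiM_single') (auto simp: A_def space_P0)
  have "M.indep_var ?D (layer False \<circ> (\<lambda>\<omega>. \<lambda>y\<in>A False. \<omega> y)) ?D (layer True \<circ> (\<lambda>\<omega>. \<lambda>y\<in>A True. \<omega> y))"
    by (rule M.indep_var_compose[OF indep lm lm])
  moreover have "layer i \<circ> (\<lambda>\<omega>. \<lambda>y\<in>A i. \<omega> y) = layer i" for i
    by (simp add: fun_eq_iff layer_def A_def)
  ultimately have ind: "M.indep_var ?D (layer False) ?D (layer True)" by simp
  have law: "distr ?M ?D (layer i) = ?D" for i
  proof -
    have "distr ?M (\<Pi>\<^sub>M n\<in>UNIV. P0) (\<lambda>\<omega>. \<lambda>n\<in>UNIV. \<omega> (i, n)) = (\<Pi>\<^sub>M n\<in>UNIV. P0)"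
      by (rule distr_PiM_reindex) (auto simp: P0 inj_on_def)
    then show ?thesis by (simp add: disorder_measure_def layer_def[abs_def] restrict_def)
  qed
  have split_meas: "(\<lambda>\<omega>. (layer False \<omega>, layer True \<omega>)) \<in> ?M \<rightarrow>\<^sub>M Pair2"
    using M.indep_var_rv1[OF ind] M.indep_var_rv2[OF ind] by measurable
  have "Pair2 = distr ?M Pair2 (\<lambda>\<omega>. (layer False \<omega>, layer True \<omega>))"
    using M.indep_var_distribution_eq[THEN iffD1, OF ind] by (simp add: law)
  then have "distr Pair2 ?M disorder = distr (distr ?M Pair2 (\<lambda>\<omega>. (layer False \<omega>, layer True \<omega>))) ?M disorder"
    by simp
  also have "\<dots> = distr ?M ?M (disorder \<circ> (\<lambda>\<omega>. (layer False \<omega>, layer True \<omega>)))"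
    by (rule distr_distr[OF measurable_disorder split_meas])
  also have "disorder \<circ> (\<lambda>\<omega>. (layer False \<omega>, layer True \<omega>)) = (\<lambda>\<omega>. \<omega>)"
  proof (intro ext)
    show "(disorder \<circ> (\<lambda>\<omega>. (layer False \<omega>, layer True \<omega>))) \<omega> y = \<omega> y" for \<omega> y
      by (cases y) (simp add: disorder_def layer_def)
  qed
  finally show ?thesis by (simp add: distr_id2)
qed

lemma AE_Pair2: "AE \<omega> in (\<Pi>\<^sub>M y\<in>UNIV. P0). Q \<omega> \<Longrightarrow> AE \<omega> in Pair2. Q (disorder \<omega>)"
  by (rule AE_distrD[OF measurable_disorder]) (simp only: distr_disorder)

lemma pred_bounded_disorder:
  assumes "sets N = sets borel"
  shows "Measurable.pred (N \<Otimes>\<^sub>M Pair2) (bounded_disorder K)"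
proof -
  have [measurable]: "(\<lambda>\<omega>. disorder \<omega> y) \<in> borel_measurable Pair2" for y
    using measurable_disorder_P0[of y] P0(2) by (simp cong: measurable_cong_sets)
  have "bounded_disorder K x \<longleftrightarrow> (\<forall>n. \<bar>disorder (snd x) (False, n)\<bar> \<le> K \<and> \<bar>disorder (snd x) (True, n)\<bar> \<le> K)" for x :: "real \<times> (int \<Rightarrow> real) \<times> (int \<Rightarrow> real)"
    by (simp add: bounded_disorder_def disorder_def)
  then show ?thesis by (subst measurable_cong) (assumption, measurable)
qed

lemma AE_bounded_disorder:
  assumes N: "sigma_finite_measure N" "sets N = sets borel"
  shows "AE x in N \<Otimes>\<^sub>M Pair2. bounded_disorder K x"
proof -
  interpret N: sigma_finite_measure N by (rule N)
  interpret pair_sigma_finite N Pair2 ..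
  have comp: "AE \<omega> in (\<Pi>\<^sub>M y\<in>(UNIV :: site set). P0). \<bar>\<omega> y\<bar> \<le> K" for y
    by (rule AE_PiM_component) (use P0 K in auto)
  then have "AE \<omega> in (\<Pi>\<^sub>M y\<in>(UNIV :: site set). P0). \<forall>y. \<bar>\<omega> y\<bar> \<le> K" by (simp add: AE_all_countable)
  from AE_Pair2[OF this] have "AE \<omega> in Pair2. \<forall>y. \<bar>disorder \<omega> y\<bar> \<le> K" .
  then have *: "AE \<omega> in Pair2. bounded_disorder K (b, \<omega>)" for b
  proof eventually_elim
    case (elim \<omega>)
    have "\<bar>disorder \<omega> (False, n)\<bar> \<le> K \<and> \<bar>disorder \<omega> (True, n)\<bar> \<le> K" for n using elim by blast
    then show ?case by (simp add: bounded_disorder_def disorder_def)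
  qed
  show ?thesis
  proof (rule AE_pair_measure)
    show "{x \<in> space (N \<Otimes>\<^sub>M Pair2). bounded_disorder K x} \<in> sets (N \<Otimes>\<^sub>M Pair2)"
      using pred_bounded_disorder[OF N(2)] by (rule predE)
  qed (simp add: *)
qed

end

context disordered_chain
begin

sublocale law: disorder_law P0 K
  by (rule disorder_law.intro) (rule P0 K)+

definition diag_amplitude :: "nat \<Rightarrow> bool \<Rightarrow> int \<Rightarrow> real \<times> (int \<Rightarrow> real) \<times> (int \<Rightarrow> real) \<Rightarrow> real" where
  "diag_amplitude k i n x = amplitude \<theta> h k (fst x) (disorder (snd x)) (i, n) (i, n)"

lemma measurable_diag_amplitude:
  assumes N: "sets N = sets borel"
  shows "diag_amplitude k i n \<in> borel_measurable (N \<Otimes>\<^sub>M law.Pair2)"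
proof -
  have id: "(\<lambda>x. x) \<in> N \<rightarrow>\<^sub>M borel" using N by (simp cong: measurable_cong_sets)
  have "(\<lambda>x. (fst x, disorder (snd x))) \<in> N \<Otimes>\<^sub>M law.Pair2 \<rightarrow>\<^sub>M borel \<Otimes>\<^sub>M Prob"
    by (intro measurable_Pair measurable_compose[OF measurable_fst id] measurable_compose[OF measurable_snd law.measurable_disorder])
  from measurable_compose[OF this measurable_amplitude[OF cont P0(2)]]
  show ?thesis by (simp add: diag_amplitude_def[abs_def])
qed

lemma diag_amplitude_le: "bounded_disorder K x \<Longrightarrow> \<bar>diag_amplitude k i n x\<bar> \<le> amp_bound k"
  unfolding diag_amplitude_def by (rule amplitude_bound)

definition typical :: "real \<times> (int \<Rightarrow> real) \<times> (int \<Rightarrow> real) \<Rightarrow> bool" where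
  "typical x \<longleftrightarrow> (\<forall>k i. (\<lambda>N. (\<Sum>n<N. diag_amplitude k i (int n) x) / real N) \<longlonglongrightarrow> mean_moment k i
     \<and> (\<lambda>N. (\<Sum>n<N. diag_amplitude k i (- 1 - int n) x) / real N) \<longlonglongrightarrow> mean_moment k i)"

text \<open>\<open>ergodic_average\<close> gives a null set of configurations for each single
  offset. Joint measurability of the convergence makes the union over the offsets a null set of the
  product, and only countably many powers and layers are involved.\<close>

lemma AE_typical: "AE x in parameter_measure P0. typical x"
proof -
  interpret pair_sigma_finite lborel law.Pair2 ..
  let ?Q = "\<lambda>f k i x. (\<lambda>N. (\<Sum>n<N. diag_amplitude k i (f n) x) / real N) \<longlonglongrightarrow> mean_moment k i"
  have "AE x in parameter_measure P0. ?Q f k i x" if f: "f = int \<or> f = (\<lambda>n. - 1 - int n)" for f k i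
    unfolding parameter_measure_def
  proof (rule AE_pair_measure)
    have [measurable]: "diag_amplitude k i n \<in> borel_measurable (lborel \<Otimes>\<^sub>M law.Pair2)" for n
      by (rule measurable_diag_amplitude) simp
    have "Measurable.pred (lborel \<Otimes>\<^sub>M law.Pair2) (?Q f k i)"
      by (rule pred_LIMSEQ) measurable
    then show "{x \<in> space (lborel \<Otimes>\<^sub>M law.Pair2). ?Q f k i x} \<in> sets (lborel \<Otimes>\<^sub>M law.Pair2)"
      by (rule predE)
    have "AE \<omega> in law.Pair2. ?Q f k i (b, \<omega>)" for b
      using law.AE_Pair2[OF ergodic_average[OF f, of k b i]] by (simp add: diag_amplitude_def)
    then show "AE b in lborel. AE \<omega> in law.Pair2. ?Q f k i (b, \<omega>)" by simp
  qed
  then show ?thesis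
    unfolding typical_def AE_all_countable[symmetric] by (simp add: AE_all_countable)
qed

lemma integral_moment_uniform:
  "(\<integral>b. moment k i b \<partial>uniform_measure lborel {0..<period i}) = mean_moment k i"
proof -
  have p: "0 < period i" by (rule period_pos)
  have em: "emeasure lborel {0..<period i} = ennreal (period i)" using p by simp
  have m[measurable]: "moment k i \<in> borel_measurable borel"
    by (rule borel_measurable_continuous_onI) (rule continuous_moment)
  have "(\<integral>b. moment k i b \<partial>uniform_measure lborel {0..<period i})
      = (\<integral>b. moment k i b \<partial>density lborel (\<lambda>x. ennreal (indicator {0..<period i} x / period i)))"
    unfolding uniform_measure_def em
    using p by (intro arg_cong2[where f = lebesgue_integral] density_cong) (auto simp: divide_ennreal[symmetric] ennreal_indicator)
  also have "\<dots> = (\<integral>b. (indicator {0..<period i} b / period i) *\<^sub>R moment k i b \<partial>lborel)"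
    using p by (subst integral_density) auto
  \<comment> \<open>The half-open and the closed interval differ by one point, which is a null set;
    the closed one matches \<open>mean_moment\<close>.\<close>
  also have "\<dots> = (\<integral>b. (indicator {0..period i} b *\<^sub>R moment k i b) / period i \<partial>lborel)"
    by (rule integral_cong_AE) (auto intro!: AE_I'[of "{period i}"] simp: indicator_def)
  also have "\<dots> = (\<integral>b\<in>{0..period i}. moment k i b \<partial>lborel) / period i"
    by (simp add: set_lebesgue_integral_def)
  also have "(\<integral>b\<in>{0..period i}. moment k i b \<partial>lborel) = integral {0..period i} (moment k i)"
    by (rule set_borel_integral_eq_integral)
      (rule borel_integrable_atLeastAtMost', rule continuous_on_subset[OF continuous_moment], simp)
  finally show ?thesis by (simp add: mean_moment_def)
qed

text \<open>By Fubini the disorder is integrated first, which leaves \<open>moment\<close>, and its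
  average over one period is \<open>mean_moment\<close>. The bound for integrability holds only
  almost surely, where the disorder is bounded.\<close>

lemma diag_amplitude_shift_measure:
  shows "diag_amplitude k i n \<in> borel_measurable (shift_measure (period i) P0)"
    and "integrable (shift_measure (period i) P0) (diag_amplitude k i n)"
    and "integral\<^sup>L (shift_measure (period i) P0) (diag_amplitude k i 0) = mean_moment k i"
proof -
  let ?U = "uniform_measure lborel {0..<period i}"
  interpret U: prob_space ?U by (rule prob_space_uniform_measure) (use period_pos[of i] in auto)
  interpret pair_prob_space ?U law.Pair2 ..
  have sets: "sets ?U = sets borel" by simp
  have m: "diag_amplitude k i n \<in> borel_measurable (?U \<Otimes>\<^sub>M law.Pair2)" for n
    by (rule measurable_diag_amplitude[OF sets])
  have int: "integrable (?U \<Otimes>\<^sub>M law.Pair2) (diag_amplitude k i n)" for n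
  proof (rule P.integrable_const_bound[of _ "amp_bound k"])
    show "AE x in ?U \<Otimes>\<^sub>M law.Pair2. norm (diag_amplitude k i n x) \<le> amp_bound k"
      using law.AE_bounded_disorder[OF U.sigma_finite_measure_axioms sets]
      by eventually_elim (simp only: real_norm_def diag_amplitude_le)
  qed (rule m)
  show "diag_amplitude k i n \<in> borel_measurable (shift_measure (period i) P0)"
    unfolding shift_measure_def using m by (rule measurable_completion)
  show "integrable (shift_measure (period i) P0) (diag_amplitude k i n)"
    unfolding shift_measure_def using int m by (simp add: integrable_completion)
  have "integral\<^sup>L (shift_measure (period i) P0) (diag_amplitude k i 0) = integral\<^sup>L (?U \<Otimes>\<^sub>M law.Pair2) (diag_amplitude k i 0)"
    unfolding shift_measure_def using m by (rule integral_completion)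
  also have "\<dots> = (\<integral>b. (\<integral>\<omega>. diag_amplitude k i 0 (b, \<omega>) \<partial>law.Pair2) \<partial>?U)"
    using integral_fst'[OF int[of 0]] by simp
  also have "\<dots> = (\<integral>b. moment k i b \<partial>?U)"
  proof (rule Bochner_Integration.integral_cong[OF refl])
    fix b
    have "(\<integral>\<omega>. diag_amplitude k i 0 (b, \<omega>) \<partial>law.Pair2)
        = (\<integral>\<omega>. amplitude \<theta> h k b \<omega> (i, 0) (i, 0) \<partial>distr law.Pair2 Prob disorder)"
      by (simp add: integral_distr[OF law.measurable_disorder] diag_amplitude_def)
    then show "(\<integral>\<omega>. diag_amplitude k i 0 (b, \<omega>) \<partial>law.Pair2) = moment k i b"
      by (simp add: law.distr_disorder moment_def)
  qed
  finally show "integral\<^sup>L (shift_measure (period i) P0) (diag_amplitude k i 0) = mean_moment k i"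
    by (simp add: integral_moment_uniform)
qed

end

section \<open>Averages over the truncated chain\<close>

lemma two_sided_average:
  fixes Y :: "int \<Rightarrow> real" and lo hi :: "real \<Rightarrow> nat"
  assumes pos: "(\<lambda>N. (\<Sum>n<N. Y (int n)) / real N) \<longlonglongrightarrow> c"
    and neg: "(\<lambda>N. (\<Sum>n<N. Y (- 1 - int n)) / real N) \<longlonglongrightarrow> c"
    and lo: "filterlim lo at_top F" and hi: "filterlim hi at_top F"
  shows "((\<lambda>L. (\<Sum>n\<in>{- int (lo L)..<int (hi L)}. Y n) / real (lo L + hi L)) \<longlongrightarrow> c) F"
proof -
  define P where "P N = (\<Sum>n<N. Y (int n))" for N
  define Q where "Q N = (\<Sum>n<N. Y (- 1 - int n))" for N
  have split: "(\<Sum>n\<in>{- int a..<int b}. Y n) = Q a + P b" for a b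
  proof -
    have "(\<Sum>n\<in>{- int a..<int b}. Y n) = (\<Sum>n\<in>{- int a..<0}. Y n) + (\<Sum>n\<in>{0..<int b}. Y n)"
      by (subst sum.union_disjoint[symmetric]) (auto intro!: sum.cong)
    also have "(\<Sum>n\<in>{0..<int b}. Y n) = P b"
      unfolding P_def by (rule sum.reindex_bij_witness[where i = int and j = nat]) auto
    also have "(\<Sum>n\<in>{- int a..<0}. Y n) = Q a"
      unfolding Q_def by (rule sum.reindex_bij_witness[where i = "\<lambda>n. - 1 - int n" and j = "\<lambda>n. nat (- 1 - n)"]) auto
    finally show ?thesis .
  qed
  have "((\<lambda>L. \<bar>Q (lo L) / real (lo L) - c\<bar> + \<bar>P (hi L) / real (hi L) - c\<bar>) \<longlongrightarrow> \<bar>c - c\<bar> + \<bar>c - c\<bar>) F"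
    by (intro tendsto_intros filterlim_compose[OF pos[folded P_def] hi] filterlim_compose[OF neg[folded Q_def] lo])
  then have lim: "((\<lambda>L. \<bar>Q (lo L) / real (lo L) - c\<bar> + \<bar>P (hi L) / real (hi L) - c\<bar>) \<longlongrightarrow> 0) F" by simp
  have "\<forall>\<^sub>F L in F. norm ((\<Sum>n\<in>{- int (lo L)..<int (hi L)}. Y n) / real (lo L + hi L) - c)
      \<le> \<bar>Q (lo L) / real (lo L) - c\<bar> + \<bar>P (hi L) / real (hi L) - c\<bar>"
    using filterlim_at_top[THEN iffD1, OF lo, rule_format, of 1] filterlim_at_top[THEN iffD1, OF hi, rule_format, of 1]
  proof eventually_elim
    case (elim L)
    define a b where "a = real (lo L)" and "b = real (hi L)"
    have ab: "0 < a" "0 < b" using elim by (simp_all add: a_def b_def)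
    \<comment> \<open>The two-sided average is a convex combination of the one-sided ones, so no
      relation between the growth of \<open>lo\<close> and \<open>hi\<close> has to be
      known.\<close>
    have "(Q (lo L) + P (hi L)) / (a + b) - c = a / (a + b) * (Q (lo L) / a - c) + b / (a + b) * (P (hi L) / b - c)"
      using ab by (simp add: divide_simps) (simp add: algebra_simps)
    also have "\<bar>\<dots>\<bar> \<le> \<bar>a / (a + b) * (Q (lo L) / a - c)\<bar> + \<bar>b / (a + b) * (P (hi L) / b - c)\<bar>"
      by (rule abs_triangle_ineq)
    also have "\<dots> \<le> 1 * \<bar>Q (lo L) / a - c\<bar> + 1 * \<bar>P (hi L) / b - c\<bar>"
      unfolding abs_mult using ab by (intro add_mono mult_right_mono) auto
    finally show ?case by (simp add: split a_def b_def)
  qed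
  from Lim_null_comparison[OF this lim] show ?thesis by (simp add: Lim_null[symmetric])
qed

lemma layer_sites_interval:
  fixes b :: real
  assumes "\<theta> < 1"
  defines "\<beta> i \<equiv> (if i then b else 0)"
  shows "layer_sites \<theta> b L i = {\<lceil>(- L - \<beta> i) / spacing \<theta> i\<rceil>..<\<lfloor>(L - \<beta> i) / spacing \<theta> i\<rfloor> + 1}"
  using assms(1) unfolding \<beta>_def
  by (auto simp: layer_sites_def Lambda1_def Lambda2_def spacing_def ceiling_le_iff le_floor_iff)

lemma finite_layer_sites: "\<theta> < 1 \<Longrightarrow> finite (layer_sites \<theta> b L i)"
  by (simp add: layer_sites_interval)

lemma layer_sites_average:
  assumes th: "0 < \<theta>" "\<theta> < 1"
    and pos: "(\<lambda>N. (\<Sum>n<N. Y (int n)) / real N) \<longlonglongrightarrow> c"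
    and neg: "(\<lambda>N. (\<Sum>n<N. Y (- 1 - int n)) / real N) \<longlonglongrightarrow> (c::real)"
  shows "((\<lambda>L. (\<Sum>n\<in>layer_sites \<theta> b L i. Y n) / real (card (layer_sites \<theta> b L i))) \<longlongrightarrow> c) at_top"
proof -
  define \<alpha> where "\<alpha> = spacing \<theta> i"
  define \<beta> where "\<beta> = (if i then b else 0)"
  have \<alpha>: "0 < \<alpha>" using th by (simp add: \<alpha>_def spacing_def)
  \<comment> \<open>\<open>lo\<close> counts the negative indices and \<open>hi\<close> the
    nonnegative ones, including 0, whence the \<open>+ 1\<close>. As soon as \<open>L\<close>
    exceeds \<open>\<bar>\<beta>\<bar>\<close>, both arguments of \<open>nat\<close> are
    nonnegative.\<close>
  define lo where "lo L = nat (- \<lceil>(- L - \<beta>) / \<alpha>\<rceil>)" for L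
  define hi where "hi L = nat (\<lfloor>(L - \<beta>) / \<alpha>\<rfloor> + 1)" for L
  have lin: "filterlim (\<lambda>L. (L + g) / \<alpha>) at_top at_top" for g
  proof -
    have "filterlim (\<lambda>L. (1 / \<alpha>) * (g + L)) at_top at_top"
      using \<alpha> by (intro filterlim_tendsto_pos_mult_at_top[OF tendsto_const] filterlim_tendsto_add_at_top[OF tendsto_const] filterlim_ident) simp
    then show ?thesis by (simp add: add.commute)
  qed
  have L0: "\<forall>\<^sub>F L in at_top. \<bar>\<beta>\<bar> < L" by (rule eventually_gt_at_top)
  have flr: "filterlim (\<lambda>L. nat \<lfloor>(L + g) / \<alpha>\<rfloor>) at_top at_top" for g
    by (rule filterlim_compose[OF filterlim_nat_sequentially filterlim_compose[OF filterlim_floor_sequentially lin]])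
  have lo_eq: "lo L = nat \<lfloor>(L + \<beta>) / \<alpha>\<rfloor>" for L
  proof -
    have "- L - \<beta> = - (L + \<beta>)" by simp
    then have "(- L - \<beta>) / \<alpha> = - ((L + \<beta>) / \<alpha>)" by (simp only: minus_divide_left)
    then show ?thesis by (simp add: lo_def ceiling_minus)
  qed
  have lo: "filterlim lo at_top at_top" unfolding lo_eq[abs_def] by (rule flr)
  have hi: "filterlim hi at_top at_top"
    by (rule filterlim_at_top_mono[OF flr[of "- \<beta>"]]) (auto intro!: always_eventually nat_mono simp: hi_def)
  have ev: "\<forall>\<^sub>F L in at_top. (\<Sum>n\<in>layer_sites \<theta> b L i. Y n) / real (card (layer_sites \<theta> b L i))
      = (\<Sum>n\<in>{- int (lo L)..<int (hi L)}. Y n) / real (lo L + hi L)"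
    using L0
  proof eventually_elim
    case (elim L)
    have "(- L - \<beta>) / \<alpha> \<le> 0" "0 \<le> (L - \<beta>) / \<alpha>" using elim \<alpha> by (auto simp: divide_le_0_iff)
    then have "\<lceil>(- L - \<beta>) / \<alpha>\<rceil> \<le> 0" "0 \<le> \<lfloor>(L - \<beta>) / \<alpha>\<rfloor>" by (simp_all add: ceiling_le_iff le_floor_iff)
    then have "\<lceil>(- L - \<beta>) / \<alpha>\<rceil> = - int (lo L)" "\<lfloor>(L - \<beta>) / \<alpha>\<rfloor> + 1 = int (hi L)" by (simp_all add: lo_def hi_def)
    moreover have "layer_sites \<theta> b L i = {\<lceil>(- L - \<beta>) / \<alpha>\<rceil>..<\<lfloor>(L - \<beta>) / \<alpha>\<rfloor> + 1}"
      unfolding \<alpha>_def \<beta>_def by (rule layer_sites_interval[OF th(2)])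
    ultimately have "layer_sites \<theta> b L i = {- int (lo L)..<int (hi L)}" by simp
    then show ?case by simp
  qed
  show ?thesis
    by (rule iffD2[OF tendsto_cong[OF ev] two_sided_average[OF pos neg lo hi]])
qed

lemma card_layer_sites:
  assumes "0 < \<theta>" "\<theta> < 1"
  shows "((\<lambda>L. real (card (layer_sites \<theta> b L i)) / L) \<longlongrightarrow> 2 / spacing \<theta> i) at_top"
proof -
  define \<alpha> where "\<alpha> = spacing \<theta> i"
  define \<beta> where "\<beta> = (if i then b else 0)"
  have \<alpha>: "0 < \<alpha>" using assms by (simp add: \<alpha>_def spacing_def)
  have "\<forall>\<^sub>F L in at_top. norm (real (card (layer_sites \<theta> b L i)) / L - 2 / \<alpha>) \<le> 1 / L"
    using eventually_gt_at_top[of "\<bar>\<beta>\<bar> + \<alpha>"]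
  proof eventually_elim
    case (elim L)
    have L: "0 < L" using elim \<alpha> by linarith
    define u v where "u = (- L - \<beta>) / \<alpha>" and "v = (L - \<beta>) / \<alpha>"
    have uv: "v - u = 2 * L / \<alpha>" by (simp add: u_def v_def flip: diff_divide_distrib)
    have "u \<le> 0" "0 \<le> v" using elim \<alpha> by (auto simp: u_def v_def divide_le_0_iff)
    then have "\<lceil>u\<rceil> \<le> 0" "0 \<le> \<lfloor>v\<rfloor>" by (simp_all only: ceiling_le_zero zero_le_floor)
    then have "real (nat (\<lfloor>v\<rfloor> + 1 - \<lceil>u\<rceil>)) = of_int (\<lfloor>v\<rfloor> + 1 - \<lceil>u\<rceil>)" by (intro of_nat_nat) linarith
    moreover have "layer_sites \<theta> b L i = {\<lceil>u\<rceil>..<\<lfloor>v\<rfloor> + 1}"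
      unfolding u_def v_def \<alpha>_def \<beta>_def by (rule layer_sites_interval[OF assms(2)])
    ultimately have "real (card (layer_sites \<theta> b L i)) = of_int \<lfloor>v\<rfloor> + 1 - of_int \<lceil>u\<rceil>"
      by (simp only: card_atLeastLessThan_int of_int_add of_int_diff of_int_1)
    then have "\<bar>real (card (layer_sites \<theta> b L i)) - 2 * L / \<alpha>\<bar> \<le> 1"
      using uv by linarith
    then have "\<bar>real (card (layer_sites \<theta> b L i)) - 2 * L / \<alpha>\<bar> / L \<le> 1 / L"
      using L by (intro divide_right_mono) auto
    moreover have "real (card (layer_sites \<theta> b L i)) / L - 2 / \<alpha> = (real (card (layer_sites \<theta> b L i)) - 2 * L / \<alpha>) / L"
      using L by (simp add: field_simps)
    ultimately show ?case using L by simp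
  qed
  moreover have "((\<lambda>L::real. 1 / L) \<longlongrightarrow> 0) at_top"
    by (rule tendsto_divide_0[OF tendsto_const]) (rule filterlim_at_top_imp_at_infinity[OF filterlim_ident])
  ultimately have "((\<lambda>L. real (card (layer_sites \<theta> b L i)) / L - 2 / \<alpha>) \<longlongrightarrow> 0) at_top"
    by (rule Lim_null_comparison)
  then show ?thesis by (simp add: Lim_null[symmetric] \<alpha>_def)
qed

lemma card_Lambda_eq: "card_Lambda \<theta> b L = card (layer_sites \<theta> b L False) + card (layer_sites \<theta> b L True)"
  by (simp add: card_Lambda_def layer_sites_def)

text \<open>The asymptotic share of layer \<open>i\<close> among all sites: the layers have
  densities 1 and \<open>1 / (1 - \<theta>)\<close> on the line.\<close>

definition layer_weight :: "real \<Rightarrow> bool \<Rightarrow> real" where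
  "layer_weight \<theta> i = (if i then 1 / (1 + (1 - \<theta>)) else (1 - \<theta>) / (1 + (1 - \<theta>)))"

lemma card_Lambda_limit:
  assumes "0 < \<theta>" "\<theta> < 1"
  shows "((\<lambda>L. real (card_Lambda \<theta> b L) / L) \<longlongrightarrow> 2 + 2 / (1 - \<theta>)) at_top"
  using tendsto_add[OF card_layer_sites[OF assms, of b False] card_layer_sites[OF assms, of b True]]
  by (simp add: card_Lambda_eq spacing_def add_divide_distrib)

lemma layer_fraction:
  assumes th: "0 < \<theta>" "\<theta> < 1"
  shows "((\<lambda>L. real (card (layer_sites \<theta> b L i)) / real (card_Lambda \<theta> b L)) \<longlongrightarrow> layer_weight \<theta> i) at_top"
proof -
  have nz: "2 + 2 / (1 - \<theta>) \<noteq> 0" using th by (simp add: add_nonneg_eq_0_iff)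
  have lim: "((\<lambda>L. (real (card (layer_sites \<theta> b L i)) / L) / (real (card_Lambda \<theta> b L) / L))
      \<longlongrightarrow> (2 / spacing \<theta> i) / (2 + 2 / (1 - \<theta>))) at_top"
    by (intro tendsto_divide card_layer_sites card_Lambda_limit th nz)
  have weight: "(2 / spacing \<theta> i) / (2 + 2 / (1 - \<theta>)) = layer_weight \<theta> i"
  proof -
    define a c where "a = 1 - \<theta>" and "c = 1 + a"
    have a: "0 < a" "0 < c" using th by (simp_all add: a_def c_def)
    have "2 + 2 / a = 2 * c / a" using a by (simp add: c_def field_simps)
    then show ?thesis using a
      by (simp add: spacing_def layer_weight_def a_def[symmetric] c_def[symmetric])
  qed
  have ev: "\<forall>\<^sub>F L in at_top. (real (card (layer_sites \<theta> b L i)) / L) / (real (card_Lambda \<theta> b L) / L)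
      = real (card (layer_sites \<theta> b L i)) / real (card_Lambda \<theta> b L)"
    using eventually_gt_at_top[of 0] by eventually_elim simp
  show ?thesis
    using iffD1[OF tendsto_cong[OF ev] lim] by (simp only: weight)
qed

lemma card_Lambda_at_top:
  assumes "0 < \<theta>" "\<theta> < 1"
  shows "filterlim (\<lambda>L. real (card_Lambda \<theta> b L)) at_top at_top"
proof -
  have "0 < 2 + 2 / (1 - \<theta>)" using assms by (simp add: add_pos_nonneg)
  then have lim: "filterlim (\<lambda>L. (real (card_Lambda \<theta> b L) / L) * L) at_top at_top"
    by (intro filterlim_tendsto_pos_mult_at_top[OF card_Lambda_limit[OF assms]] filterlim_ident)
  have "\<forall>\<^sub>F L in at_top. (real (card_Lambda \<theta> b L) / L) * L = real (card_Lambda \<theta> b L)"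
    using eventually_gt_at_top[of 0] by eventually_elim simp
  from iffD1[OF filterlim_cong[OF refl refl this] lim] show ?thesis .
qed

context disordered_chain
begin

text \<open>Truncation alters moments at boundary sites only. Their number is bounded independently
  of \<open>L\<close>, and at each both moments are at most \<open>amp_bound k\<close>, so the total
  error stays below the constant \<open>C\<close> and vanishes after division by the number of
  sites.\<close>

lemma truncated_moment_average:
  assumes x: "bounded_disorder K x" "typical x"
  shows "((\<lambda>L. (\<Sum>n\<in>layer_sites \<theta> (fst x) L i. site_vec (i, n) \<bullet> (truncated_hamiltonian \<theta> h L x ^^ k) (site_vec (i, n)))
      / real (card_Lambda \<theta> (fst x) L)) \<longlongrightarrow> layer_weight \<theta> i * mean_moment k i) at_top"
proof -
  define T where "T L n = site_vec (i, n) \<bullet> (truncated_hamiltonian \<theta> h L x ^^ k) (site_vec (i, n))" for L n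
  define Y where "Y n = diag_amplitude k i n x" for n
  define r where "r = real k * R"
  have r: "0 \<le> r" using R by (simp add: r_def)
  let ?A = "\<lambda>L. layer_sites \<theta> (fst x) L i" and ?c = "\<lambda>L. real (card_Lambda \<theta> (fst x) L)"
  define C where "C = 2 * (r / spacing \<theta> i + 1) * (2 * amp_bound k)"
  have T_le: "\<bar>T L n\<bar> \<le> amp_bound k" for L n
  proof -
    interpret T: self_adjoint_operator "truncated_hamiltonian \<theta> h L x" "2 * (K + 4 + S)"
      by (rule self_adjoint_truncated_hamiltonian[OF x(1)])
    have "\<bar>T L n\<bar> \<le> norm (site_vec (i, n)) * norm ((truncated_hamiltonian \<theta> h L x ^^ k) (site_vec (i, n)))"
      unfolding T_def by (rule Cauchy_Schwarz_ineq2)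
    also have "\<dots> \<le> amp_bound k"
      using norm_funpow_le[of "truncated_hamiltonian \<theta> h L x", OF T.norm_le less_imp_le[OF T.M_pos], of k "site_vec (i, n)"]
      by (simp add: norm_site_vec)
    finally show ?thesis .
  qed
  have diff: "\<bar>(\<Sum>n\<in>?A L. T L n) - (\<Sum>n\<in>?A L. Y n)\<bar> \<le> C" for L
  proof -
    let ?B = "{n \<in> ?A L. L < \<bar>pos \<theta> (fst x) (i, n)\<bar> + r}"
    have eq: "T L n - Y n = 0" if "n \<in> ?A L - ?B" for n
      using that truncated_amplitude[OF interlayer_axioms x(1), of "(i, n)" k L]
      by (auto simp: T_def Y_def diag_amplitude_def r_def)
    have "(\<Sum>n\<in>?A L. T L n) - (\<Sum>n\<in>?A L. Y n) = (\<Sum>n\<in>?A L. T L n - Y n)" by (simp add: sum_subtractf)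
    also have "\<dots> = (\<Sum>n\<in>?B. T L n - Y n)"
    proof (rule sum.mono_neutral_right)
      show "finite (?A L)" by (rule finite_layer_sites[OF theta(2)])
    qed (use eq in blast)+
    finally have "\<bar>(\<Sum>n\<in>?A L. T L n) - (\<Sum>n\<in>?A L. Y n)\<bar> = \<bar>\<Sum>n\<in>?B. T L n - Y n\<bar>"
      by (rule arg_cong)
    also have "\<dots> \<le> (\<Sum>n\<in>?B. 2 * amp_bound k)"
    proof (rule order_trans[OF sum_abs], intro sum_mono)
      fix n
      show "\<bar>T L n - Y n\<bar> \<le> 2 * amp_bound k"
        using T_le[of L n] diag_amplitude_le[OF x(1), of k i n] unfolding Y_def by linarith
    qed
    also have "\<dots> = real (card ?B) * (2 * amp_bound k)" by (rule sum_constant)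
    finally have "\<bar>(\<Sum>n\<in>?A L. T L n) - (\<Sum>n\<in>?A L. Y n)\<bar> \<le> real (card ?B) * (2 * amp_bound k)" .
    moreover have cb: "real (card ?B) \<le> 2 * (r / spacing \<theta> i + 1)" by (rule card_boundary_le[OF theta r])
    have nb: "0 \<le> 2 * amp_bound k" using amp_bound_nonneg by simp
    have "real (card ?B) * (2 * amp_bound k) \<le> C"
      unfolding C_def by (rule mult_right_mono[OF cb nb])
    ultimately show ?thesis by (rule order_trans)
  qed
  have avg: "((\<lambda>L. (\<Sum>n\<in>?A L. Y n) / real (card (?A L))) \<longlongrightarrow> mean_moment k i) at_top"
    by (rule layer_sites_average[OF theta]) (use x(2) in \<open>auto simp: typical_def Y_def\<close>)
  have "((\<lambda>L. (\<Sum>n\<in>?A L. Y n) / ?c L) \<longlongrightarrow> layer_weight \<theta> i * mean_moment k i) at_top"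
  proof -
    have "((\<lambda>L. (real (card (?A L)) / ?c L) * ((\<Sum>n\<in>?A L. Y n) / real (card (?A L)))) \<longlongrightarrow> layer_weight \<theta> i * mean_moment k i) at_top"
      by (intro tendsto_mult avg layer_fraction theta)
    \<comment> \<open>An empty layer is covered too: division by zero yields 0 and the sum is
      empty.\<close>
    moreover have "(real (card (?A L)) / ?c L) * ((\<Sum>n\<in>?A L. Y n) / real (card (?A L))) = (\<Sum>n\<in>?A L. Y n) / ?c L" for L
      using finite_layer_sites[OF theta(2), of "fst x" L i] by (cases "card (?A L) = 0") auto
    ultimately show ?thesis by simp
  qed
  moreover have "((\<lambda>L. ((\<Sum>n\<in>?A L. T L n) - (\<Sum>n\<in>?A L. Y n)) / ?c L) \<longlongrightarrow> 0) at_top"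
  proof (rule Lim_null_comparison)
    show "\<forall>\<^sub>F L in at_top. norm (((\<Sum>n\<in>?A L. T L n) - (\<Sum>n\<in>?A L. Y n)) / ?c L) \<le> C / ?c L"
      using diff by (intro always_eventually allI) (auto intro: divide_right_mono)
    show "((\<lambda>L. C / ?c L) \<longlongrightarrow> 0) at_top"
      by (rule tendsto_divide_0[OF tendsto_const]) (rule filterlim_at_top_imp_at_infinity[OF card_Lambda_at_top[OF theta]])
  qed
  ultimately have "((\<lambda>L. (\<Sum>n\<in>?A L. Y n) / ?c L + ((\<Sum>n\<in>?A L. T L n) - (\<Sum>n\<in>?A L. Y n)) / ?c L)
      \<longlongrightarrow> layer_weight \<theta> i * mean_moment k i + 0) at_top"
    by (rule tendsto_add)
  then show ?thesis by (simp add: T_def diff_divide_distrib)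
qed

lemma truncated_poly_average:
  assumes x: "bounded_disorder K x" "typical x"
  shows "((\<lambda>L. (\<Sum>n\<in>layer_sites \<theta> (fst x) L i. site_vec (i, n) \<bullet> poly_op (truncated_hamiltonian \<theta> h L x) p (site_vec (i, n)))
      / real (card_Lambda \<theta> (fst x) L)) \<longlongrightarrow> layer_weight \<theta> i * (\<Sum>k\<le>degree p. coeff p k * mean_moment k i)) at_top"
proof -
  have "((\<lambda>L. \<Sum>k\<le>degree p. coeff p k * ((\<Sum>n\<in>layer_sites \<theta> (fst x) L i. site_vec (i, n) \<bullet> (truncated_hamiltonian \<theta> h L x ^^ k) (site_vec (i, n)))
      / real (card_Lambda \<theta> (fst x) L))) \<longlongrightarrow> (\<Sum>k\<le>degree p. coeff p k * (layer_weight \<theta> i * mean_moment k i))) at_top"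
    by (intro tendsto_sum tendsto_mult tendsto_const truncated_moment_average x)
  moreover have "(\<Sum>k\<le>degree p. coeff p k * ((\<Sum>n\<in>A. site_vec (i, n) \<bullet> (H ^^ k) (site_vec (i, n))) / c))
      = (\<Sum>n\<in>A. site_vec (i, n) \<bullet> poly_op H p (site_vec (i, n))) / c" for A H c
    unfolding poly_op_def inner_sum_right inner_scaleR_right
    by (subst sum.swap) (simp add: sum_divide_distrib sum_distrib_left)
  moreover have "(\<Sum>k\<le>degree p. coeff p k * (layer_weight \<theta> i * mean_moment k i)) = layer_weight \<theta> i * (\<Sum>k\<le>degree p. coeff p k * mean_moment k i)"
    by (simp add: sum_distrib_left ac_simps)
  ultimately show ?thesis by simp
qed

end

section \<open>Cutting off the interaction\<close>

text \<open>\<open>C\<close> is chosen before the operators, from \<open>p\<close> and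
  \<open>M\<close> alone, so the estimate is uniform over sizes, sites and disorder. The second
  bound is there for the induction: writing u and v for the two values of the shorter polynomial, a
  further factor splits as \<open>A (u - v) + (A v - A' v)\<close>, which needs the size of
  v.\<close>

lemma poly_op_perturbation:
  fixes p :: "real poly" and M :: real
  assumes M: "0 \<le> M"
  obtains C where "0 \<le> C"
    "\<And>(A :: 'a::real_normed_vector \<Rightarrow> 'a) A' d \<psi>. linear A \<Longrightarrow> linear A' \<Longrightarrow> 0 \<le> d \<Longrightarrow> (\<And>\<psi>. norm (A \<psi>) \<le> M * norm \<psi>)
      \<Longrightarrow> (\<And>\<psi>. norm (A' \<psi>) \<le> M * norm \<psi>) \<Longrightarrow> (\<And>\<psi>. norm (A \<psi> - A' \<psi>) \<le> d * norm \<psi>)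
      \<Longrightarrow> norm (poly_op A p \<psi> - poly_op A' p \<psi>) \<le> C * d * norm \<psi> \<and> norm (poly_op A' p \<psi>) \<le> C * norm \<psi>"
proof -
  have "\<exists>C\<ge>0. \<forall>(A :: 'a \<Rightarrow> 'a) A' d. linear A \<and> linear A' \<and> 0 \<le> d \<and> (\<forall>\<psi>. norm (A \<psi>) \<le> M * norm \<psi>)
      \<and> (\<forall>\<psi>. norm (A' \<psi>) \<le> M * norm \<psi>) \<and> (\<forall>\<psi>. norm (A \<psi> - A' \<psi>) \<le> d * norm \<psi>)
      \<longrightarrow> (\<forall>\<psi>. norm (poly_op A p \<psi> - poly_op A' p \<psi>) \<le> C * d * norm \<psi> \<and> norm (poly_op A' p \<psi>) \<le> C * norm \<psi>)"
  proof (induction p)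
    case 0
    show ?case by (intro exI[of _ 0]) (simp add: poly_op_0)
  next
    case (pCons a p)
    then obtain C where C0: "0 \<le> C" and C: "\<And>(A :: 'a \<Rightarrow> 'a) A' d \<psi>. linear A \<Longrightarrow> linear A' \<Longrightarrow> 0 \<le> d \<Longrightarrow> (\<And>\<psi>. norm (A \<psi>) \<le> M * norm \<psi>)
      \<Longrightarrow> (\<And>\<psi>. norm (A' \<psi>) \<le> M * norm \<psi>) \<Longrightarrow> (\<And>\<psi>. norm (A \<psi> - A' \<psi>) \<le> d * norm \<psi>)
      \<Longrightarrow> norm (poly_op A p \<psi> - poly_op A' p \<psi>) \<le> C * d * norm \<psi> \<and> norm (poly_op A' p \<psi>) \<le> C * norm \<psi>"
      by blast
    define C' where "C' = \<bar>a\<bar> + M * C + C"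
    have C': "M * C + C \<le> C'" "\<bar>a\<bar> + M * C \<le> C'" "0 \<le> C'"
      using C0 M by (simp_all add: C'_def)
    have "norm (poly_op A (pCons a p) \<psi> - poly_op A' (pCons a p) \<psi>) \<le> C' * d * norm \<psi> \<and> norm (poly_op A' (pCons a p) \<psi>) \<le> C' * norm \<psi>"
      if A: "linear A" "linear A'" "0 \<le> d" "\<And>\<psi>. norm (A \<psi>) \<le> M * norm \<psi>" "\<And>\<psi>. norm (A' \<psi>) \<le> M * norm \<psi>" "\<And>\<psi>. norm (A \<psi> - A' \<psi>) \<le> d * norm \<psi>"
      for A A' :: "'a \<Rightarrow> 'a" and d \<psi>
    proof
      define u v where "u = poly_op A p \<psi>" and "v = poly_op A' p \<psi>"
      have uv: "norm (u - v) \<le> C * d * norm \<psi>" "norm v \<le> C * norm \<psi>"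
        using C[OF A, of \<psi>] by (auto simp: u_def v_def)
      have "poly_op A (pCons a p) \<psi> - poly_op A' (pCons a p) \<psi> = A (u - v) + (A v - A' v)"
        using A by (simp add: poly_op_pCons u_def v_def linear_diff)
      also have "norm \<dots> \<le> M * norm (u - v) + d * norm v"
        by (rule order_trans[OF norm_triangle_ineq]) (intro add_mono A)
      also have "\<dots> \<le> M * (C * d * norm \<psi>) + d * (C * norm \<psi>)"
        using uv M A(3) by (intro add_mono mult_left_mono)
      also have "\<dots> = (M * C + C) * (d * norm \<psi>)" by (simp add: algebra_simps)
      also have "\<dots> \<le> C' * (d * norm \<psi>)" using C' A(3) by (intro mult_right_mono) auto
      finally show "norm (poly_op A (pCons a p) \<psi> - poly_op A' (pCons a p) \<psi>) \<le> C' * d * norm \<psi>" by (simp add: mult.assoc)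
      have "norm (poly_op A' (pCons a p) \<psi>) \<le> \<bar>a\<bar> * norm \<psi> + M * norm v"
        using A by (simp add: poly_op_pCons v_def) (metis norm_triangle_mono norm_scaleR order_refl)
      also have "\<dots> \<le> \<bar>a\<bar> * norm \<psi> + M * (C * norm \<psi>)"
        using uv M by (intro add_left_mono mult_left_mono)
      also have "\<dots> = (\<bar>a\<bar> + M * C) * norm \<psi>" by (simp add: algebra_simps)
      also have "\<dots> \<le> C' * norm \<psi>" using C' by (intro mult_right_mono) auto
      finally show "norm (poly_op A' (pCons a p) \<psi>) \<le> C' * norm \<psi>" .
    qed
    then show ?case using C'(3) by (intro exI[of _ C']) blast
  qed
  then show ?thesis using that by blast
qed

lemma interlayer_bound_mono:
  assumes "interlayer_bound \<theta> h S" "\<And>\<eta>. \<bar>h' \<eta>\<bar> \<le> \<bar>h \<eta>\<bar>"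
  shows "interlayer_bound \<theta> h' S"
  using assms unfolding interlayer_bound_def by (meson order_trans sum_mono)

lemma interlayer_bound_exp:
  assumes "\<theta> < 1" "0 < c"
  obtains S where "0 \<le> S" "\<And>h C. 0 \<le> C \<Longrightarrow> (\<And>\<eta>. \<bar>h \<eta>\<bar> \<le> C * exp (- c * \<bar>\<eta>\<bar>)) \<Longrightarrow> interlayer_bound \<theta> h (C * S)"
proof -
  obtain S1 where S1: "0 < S1" "\<And>\<beta> F. finite F \<Longrightarrow> (\<Sum>n\<in>F. exp (- c * \<bar>\<beta> - 1 * real_of_int n\<bar>)) \<le> S1"
    using exp_sum_bounded[of 1 c] assms by auto
  obtain S2 where S2: "0 < S2" "\<And>\<beta> F. finite F \<Longrightarrow> (\<Sum>n\<in>F. exp (- c * \<bar>\<beta> - (1 - \<theta>) * real_of_int n\<bar>)) \<le> S2"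
    using exp_sum_bounded[of "1 - \<theta>" c] assms by auto
  show ?thesis
  proof (rule that[of "S1 + S2"])
    show "0 \<le> S1 + S2" using S1 S2 by simp
    fix h :: "real \<Rightarrow> real" and C :: real
    assume C: "0 \<le> C" and h: "\<And>\<eta>. \<bar>h \<eta>\<bar> \<le> C * exp (- c * \<bar>\<eta>\<bar>)"
    have le: "(\<Sum>n\<in>F. \<bar>h (\<beta> - \<alpha> * real_of_int n)\<bar>) \<le> C * (\<Sum>n\<in>F. exp (- c * \<bar>\<beta> - \<alpha> * real_of_int n\<bar>))" for \<alpha> F \<beta>
      unfolding sum_distrib_left by (intro sum_mono h)
    have "(\<Sum>n\<in>F. \<bar>h (\<beta> - real_of_int n)\<bar>) \<le> C * (S1 + S2) \<and> (\<Sum>n\<in>F. \<bar>h (\<beta> - (1 - \<theta>) * real_of_int n)\<bar>) \<le> C * (S1 + S2)"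
      if "finite F" for F \<beta>
    proof -
      have "C * S1 \<le> C * (S1 + S2)" "C * S2 \<le> C * (S1 + S2)"
        using C S1(1) S2(1) by (simp_all add: mult_left_mono)
      then show ?thesis
        using le[where \<alpha> = 1 and F = F and \<beta> = \<beta>] le[where \<alpha> = "1 - \<theta>" and F = F and \<beta> = \<beta>] mult_left_mono[OF S1(2)[OF that, of \<beta>] C] mult_left_mono[OF S2(2)[OF that, of \<beta>] C]
        by (simp only: mult_1) linarith
    qed
    then show "interlayer_bound \<theta> h (C * (S1 + S2))" by (simp add: interlayer_bound_def)
  qed
qed

text \<open>The cutoff is linear between \<open>n\<close> and \<open>n + 1\<close> instead of sharp,
  so that continuity in the offset survives. Its multiplier lies in [0, 1], so the Schur bound of
  \<open>h\<close> and the common norm bound survive as well.\<close>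

definition cutoff :: "(real \<Rightarrow> real) \<Rightarrow> nat \<Rightarrow> real \<Rightarrow> real" where
  "cutoff h n \<eta> = h \<eta> * max 0 (min 1 (real n + 1 - \<bar>\<eta>\<bar>))"

lemma cutoff_bounds:
  assumes C: "0 \<le> C" and c: "0 < c" and h: "\<And>\<eta>. \<bar>h \<eta>\<bar> \<le> C * exp (- c * \<bar>\<eta>\<bar>)" and th: "\<theta> < 1"
  obtains S D where "interlayer_bound \<theta> h S" "\<And>n. interlayer_bound \<theta> (\<lambda>\<eta>. h \<eta> - cutoff h n \<eta>) (D n)" "D \<longlonglongrightarrow> 0"
proof -
  obtain S1 where S1: "\<And>h C. 0 \<le> C \<Longrightarrow> (\<And>\<eta>. \<bar>h \<eta>\<bar> \<le> C * exp (- c * \<bar>\<eta>\<bar>)) \<Longrightarrow> interlayer_bound \<theta> h (C * S1)"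
    using interlayer_bound_exp[OF th c] by blast
  obtain S2 where S2: "\<And>h C. 0 \<le> C \<Longrightarrow> (\<And>\<eta>. \<bar>h \<eta>\<bar> \<le> C * exp (- (c / 2) * \<bar>\<eta>\<bar>)) \<Longrightarrow> interlayer_bound \<theta> h (C * S2)"
    using interlayer_bound_exp[OF th, of "c / 2"] c by (metis half_gt_zero)
  show ?thesis
  proof (rule that[of "C * S1" "\<lambda>n. C * exp (- (c / 2)) ^ n * S2"])
    show "interlayer_bound \<theta> h (C * S1)" by (rule S1[OF C h])
    show "interlayer_bound \<theta> (\<lambda>\<eta>. h \<eta> - cutoff h n \<eta>) (C * exp (- (c / 2)) ^ n * S2)" for n
    proof (rule S2)
      show "0 \<le> C * exp (- (c / 2)) ^ n" using C by simp
      fix \<eta>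
      show "\<bar>h \<eta> - cutoff h n \<eta>\<bar> \<le> C * exp (- (c / 2)) ^ n * exp (- (c / 2) * \<bar>\<eta>\<bar>)"
      proof (cases "\<bar>\<eta>\<bar> \<le> real n")
        case True
        then show ?thesis using C by (simp add: cutoff_def)
      next
        case False
        define m where "m = max 0 (min 1 (real n + 1 - \<bar>\<eta>\<bar>))"
        have m: "0 \<le> m" "m \<le> 1" by (simp_all add: m_def)
        have "h \<eta> - cutoff h n \<eta> = h \<eta> * (1 - m)"
          unfolding cutoff_def m_def[symmetric] by (simp add: right_diff_distrib)
        then have "\<bar>h \<eta> - cutoff h n \<eta>\<bar> = \<bar>h \<eta>\<bar> * (1 - m)"
          using m by (simp add: abs_mult)
        also have "\<dots> \<le> \<bar>h \<eta>\<bar>" using m by (simp add: mult_left_le)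
        also have "\<dots> \<le> C * exp (- c * \<bar>\<eta>\<bar>)" by (rule h)
        \<comment> \<open>The decay rate is shared out: beyond distance \<open>n\<close> one half
          produces the small factor \<open>exp (- (c / 2)) ^ n\<close>, the other half remains to
          make the sums over a layer converge.\<close>
        also have "\<dots> \<le> C * exp (real n * - (c / 2) + - (c / 2) * \<bar>\<eta>\<bar>)"
        proof -
          have "c / 2 * real n \<le> c / 2 * \<bar>\<eta>\<bar>" using False c by (intro mult_left_mono) auto
          then show ?thesis using C by (intro mult_left_mono) (auto simp: algebra_simps)
        qed
        also have "\<dots> = C * exp (- (c / 2)) ^ n * exp (- (c / 2) * \<bar>\<eta>\<bar>)"
          by (simp only: exp_add exp_of_nat_mult mult.assoc)
        finally show ?thesis .
      qed
    qed
    have "(\<lambda>n. exp (- (c / 2)) ^ n) \<longlonglongrightarrow> 0" by (rule LIMSEQ_realpow_zero) (use c in simp_all)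
    from tendsto_mult[OF tendsto_mult[OF tendsto_const this, of C] tendsto_const, of S2]
    show "(\<lambda>n. C * exp (- (c / 2)) ^ n * S2) \<longlonglongrightarrow> 0" by simp
  qed
qed

text \<open>In a completed measure space, preimages that differ by a null set are measurable
  together. This is needed because \<open>fun_of_op\<close> of the random operator is controlled
  only where the disorder is bounded.\<close>

lemma measurable_completion_AE:
  assumes f: "f \<in> completion M \<rightarrow>\<^sub>M N" and eq: "AE x in completion M. f x = g x" and g: "g \<in> space M \<rightarrow> space N"
  shows "g \<in> completion M \<rightarrow>\<^sub>M N"
proof (rule measurableI)
  show "g x \<in> space N" if "x \<in> space (completion M)" for x using g that by auto
  fix A assume A: "A \<in> sets N"
  show "g -` A \<inter> space (completion M) \<in> sets (completion M)"
  proof (rule completion.in_sets_AE)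
    show "f -` A \<inter> space (completion M) \<in> sets (completion M)" by (rule measurable_sets[OF f A])
    show "AE x in completion M. (x \<in> f -` A \<inter> space (completion M)) = (x \<in> g -` A \<inter> space (completion M))"
      using eq by eventually_elim simp
  qed simp
qed

section \<open>Convergence of the local trace averages\<close>

locale random_chain = interlayer \<theta> h S for \<theta> h S +
  fixes D :: "nat \<Rightarrow> real" and P0 :: "real measure" and K :: real
  assumes theta: "0 < \<theta>" "\<theta> < 1" and irrational: "\<theta> \<notin> \<rat>" and cont: "continuous_on UNIV h"
    and P0: "prob_space P0" "sets P0 = sets borel" and K: "AE y in P0. \<bar>y\<bar> \<le> K"
    and D: "interlayer_bound \<theta> (\<lambda>\<eta>. h \<eta> - cutoff h n \<eta>) (D n)" and D_lim: "D \<longlonglongrightarrow> 0"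
begin

abbreviation norm_bound :: real where "norm_bound \<equiv> 2 * (K + 4 + S)"

sublocale law: disorder_law P0 K
  by (rule disorder_law.intro) (rule P0 K)+

lemma interlayer_diff: "interlayer \<theta> (\<lambda>\<eta>. h \<eta> - cutoff h n \<eta>) (D n)"
  by (rule interlayer.intro) (simp_all add: even cutoff_def D[unfolded cutoff_def])

lemma disordered_chain_cutoff: "disordered_chain \<theta> (cutoff h n) S (real n + 1) P0 K"
proof (intro disordered_chain.intro interlayer.intro finite_range.intro disordered_chain_axioms.intro)
  show "cutoff h n (- \<eta>) = cutoff h n \<eta>" for \<eta> by (simp add: cutoff_def even)
  have "\<bar>cutoff h n \<eta>\<bar> \<le> \<bar>h \<eta>\<bar>" for \<eta>
    unfolding cutoff_def abs_mult by (rule mult_left_le) auto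
  then show "interlayer_bound \<theta> (cutoff h n) S" by (rule interlayer_bound_mono[OF bound])
  show "cutoff h n \<eta> = 0" if "real n + 1 < \<bar>\<eta>\<bar>" for \<eta> using that by (simp add: cutoff_def)
  show "continuous_on UNIV (cutoff h n)"
    unfolding cutoff_def by (intro continuous_intros cont)
qed (use theta irrational P0 K in auto)

lemma interlayer_cutoff: "interlayer \<theta> (cutoff h n) S"
  using disordered_chain_cutoff by (rule disordered_chain.axioms)

abbreviation diag :: "nat \<Rightarrow> nat \<Rightarrow> bool \<Rightarrow> real \<times> (int \<Rightarrow> real) \<times> (int \<Rightarrow> real) \<Rightarrow> real" where
  "diag n k i \<equiv> disordered_chain.diag_amplitude \<theta> (cutoff h n) k i 0"

abbreviation limit_moment :: "nat \<Rightarrow> nat \<Rightarrow> bool \<Rightarrow> real" where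
  "limit_moment n k i \<equiv> disordered_chain.mean_moment \<theta> (cutoff h n) P0 k i"

abbreviation site_period :: "bool \<Rightarrow> real" where "site_period i \<equiv> (if i then 1 else 1 - \<theta>)"

definition generic :: "real \<times> (int \<Rightarrow> real) \<times> (int \<Rightarrow> real) \<Rightarrow> bool" where
  "generic x \<longleftrightarrow> bounded_disorder K x \<and> (\<forall>n. disordered_chain.typical \<theta> (cutoff h n) P0 x)"

lemma AE_generic: "AE x in parameter_measure P0. generic x"
proof -
  have "AE x in parameter_measure P0. bounded_disorder K x"
    unfolding parameter_measure_def by (rule law.AE_bounded_disorder) (auto intro: lborel.sigma_finite_measure_axioms)
  moreover have "AE x in parameter_measure P0. \<forall>n. disordered_chain.typical \<theta> (cutoff h n) P0 x"
    using disordered_chain.AE_typical[OF disordered_chain_cutoff] by (simp add: AE_all_countable)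
  ultimately show ?thesis by eventually_elim (simp add: generic_def)
qed

lemma AE_shift_bounded: "AE x in shift_measure (site_period i) P0. bounded_disorder K x"
proof -
  have "0 < site_period i" using theta by simp
  then interpret U: prob_space "uniform_measure lborel {0..<site_period i}"
    by (intro prob_space_uniform_measure) auto
  show ?thesis
    unfolding shift_measure_def
    by (rule AE_completion, rule law.AE_bounded_disorder[OF U.sigma_finite_measure_axioms]) simp
qed

lemma prob_space_shift_measure: "prob_space (shift_measure (site_period i) P0)"
proof -
  have "0 < site_period i" using theta by simp
  then interpret U: prob_space "uniform_measure lborel {0..<site_period i}"
    by (intro prob_space_uniform_measure) auto
  interpret pair_prob_space "uniform_measure lborel {0..<site_period i}" law.Pair2 ..
  show ?thesis unfolding shift_measure_def by (rule P.prob_space_completion)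
qed

definition density_at :: "(real \<Rightarrow> real) \<Rightarrow> site \<Rightarrow> real \<times> (int \<Rightarrow> real) \<times> (int \<Rightarrow> real) \<Rightarrow> real" where
  "density_at f y x = site_vec y \<bullet> symmetric_operator.cfun (hamiltonian \<theta> h x) norm_bound f (site_vec y)"

definition truncated_density_at :: "(real \<Rightarrow> real) \<Rightarrow> real \<Rightarrow> site \<Rightarrow> real \<times> (int \<Rightarrow> real) \<times> (int \<Rightarrow> real) \<Rightarrow> real" where
  "truncated_density_at f L y x = site_vec y \<bullet> symmetric_operator.cfun (truncated_hamiltonian \<theta> h L x) norm_bound f (site_vec y)"

lemma inner_cfun_perturbation:
  assumes A: "symmetric_operator A norm_bound" and B: "symmetric_operator B norm_bound"
    and f: "continuous_on {-norm_bound..norm_bound} f"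
    and p: "\<And>t. t \<in> {-norm_bound..norm_bound} \<Longrightarrow> \<bar>f t - poly p t\<bar> \<le> e"
    and diff: "norm (poly_op A p (site_vec y) - poly_op B p (site_vec y)) \<le> e"
  shows "\<bar>site_vec y \<bullet> symmetric_operator.cfun A norm_bound f (site_vec y) - site_vec y \<bullet> poly_op B p (site_vec y)\<bar> \<le> 2 * e"
proof -
  let ?u = "site_vec y" and ?v = "symmetric_operator.cfun A norm_bound f (site_vec y)"
  have "\<bar>?u \<bullet> ?v - ?u \<bullet> poly_op B p ?u\<bar> = \<bar>?u \<bullet> (?v - poly_op B p ?u)\<bar>" by (simp add: inner_diff_right)
  also have "\<dots> \<le> norm ?u * norm (?v - poly_op B p ?u)" by (rule Cauchy_Schwarz_ineq2)
  also have "\<dots> = norm (?v - poly_op B p ?u)" by (simp add: norm_site_vec)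
  also have "\<dots> = norm ((?v - poly_op A p ?u) + (poly_op A p ?u - poly_op B p ?u))" by simp
  also have "\<dots> \<le> e + e"
    using symmetric_operator.cfun_approx[OF A f p, of ?u] diff
    by (intro norm_triangle_mono) (simp_all add: norm_site_vec)
  finally show ?thesis by simp
qed

text \<open>The polynomial is chosen first, on the interval common to all operators; its
  perturbation constant then determines how large the cutoff must be. Half of \<open>e\<close> pays
  for each of the two steps, and neither choice depends on the disorder, the site or
  \<open>L\<close>.\<close>

lemma density_approximation:
  assumes f: "continuous_on {-norm_bound..norm_bound} f" and e: "0 < e"
  obtains p n where
    "\<And>x y. bounded_disorder K x \<Longrightarrow> \<bar>density_at f y x - site_vec y \<bullet> poly_op (hamiltonian \<theta> (cutoff h n) x) p (site_vec y)\<bar> \<le> e"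
    "\<And>x y L. bounded_disorder K x \<Longrightarrow>
      \<bar>truncated_density_at f L y x - site_vec y \<bullet> poly_op (truncated_hamiltonian \<theta> (cutoff h n) L x) p (site_vec y)\<bar> \<le> e"
proof -
  have e2: "0 < e / 2" using e by simp
  obtain p where p: "\<And>t. t \<in> {-norm_bound..norm_bound} \<Longrightarrow> \<bar>f t - poly p t\<bar> \<le> e / 2"
    using real_polynomial_approx[OF f e2] by blast
  have M: "0 \<le> norm_bound"
    using disordered_chain.K_nonneg[OF disordered_chain_cutoff] S_nonneg by simp
  obtain C where C: "0 \<le> C"
    "\<And>(A :: state \<Rightarrow> state) A' d \<psi>. linear A \<Longrightarrow> linear A' \<Longrightarrow> 0 \<le> d \<Longrightarrow> (\<And>\<psi>. norm (A \<psi>) \<le> norm_bound * norm \<psi>)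
      \<Longrightarrow> (\<And>\<psi>. norm (A' \<psi>) \<le> norm_bound * norm \<psi>) \<Longrightarrow> (\<And>\<psi>. norm (A \<psi> - A' \<psi>) \<le> d * norm \<psi>)
      \<Longrightarrow> norm (poly_op A p \<psi> - poly_op A' p \<psi>) \<le> C * d * norm \<psi> \<and> norm (poly_op A' p \<psi>) \<le> C * norm \<psi>"
    using poly_op_perturbation[OF M, of p, where 'a = state] by blast
  have "(\<lambda>n. C * (2 * D n)) \<longlonglongrightarrow> C * (2 * 0)" by (intro tendsto_intros D_lim)
  then have "\<forall>\<^sub>F n in sequentially. C * (2 * D n) < e / 2"
    by (rule order_tendstoD(2)) (use e2 in simp)
  then obtain n where n: "C * (2 * D n) < e / 2" by (auto simp: eventually_sequentially)
  note I = interlayer_axioms interlayer_cutoff[of n] interlayer_diff[of n]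
  have D0: "0 \<le> 2 * D n" using interlayer.S_nonneg[OF I(3)] by simp
  have close: "\<bar>site_vec y \<bullet> symmetric_operator.cfun A norm_bound f (site_vec y) - site_vec y \<bullet> poly_op B p (site_vec y)\<bar> \<le> e"
    if A: "self_adjoint_operator A norm_bound" and B: "self_adjoint_operator B norm_bound"
      and AB: "\<And>\<psi>. norm (A \<psi> - B \<psi>) \<le> 2 * D n * norm \<psi>" for A B y
  proof -
    interpret A: self_adjoint_operator A norm_bound by (rule A)
    interpret B: self_adjoint_operator B norm_bound by (rule B)
    have "norm (poly_op A p (site_vec y) - poly_op B p (site_vec y)) \<le> C * (2 * D n) * norm (site_vec y)"
      using C(2)[OF A.lin B.lin D0 A.norm_le B.norm_le AB] by blast
    then have "norm (poly_op A p (site_vec y) - poly_op B p (site_vec y)) \<le> e / 2"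
      using n by (simp add: norm_site_vec)
    then show ?thesis
      using inner_cfun_perturbation[OF A.symmetric_operator_axioms B.symmetric_operator_axioms f p, of y] by simp
  qed
  show ?thesis
  proof (rule that[of n p])
    fix x y L assume x: "bounded_disorder K x"
    show "\<bar>density_at f y x - site_vec y \<bullet> poly_op (hamiltonian \<theta> (cutoff h n) x) p (site_vec y)\<bar> \<le> e"
      unfolding density_at_def
      by (rule close[OF self_adjoint_hamiltonian[OF x] interlayer.self_adjoint_hamiltonian[OF I(2) x] hamiltonian_diff[OF I]])
    show "\<bar>truncated_density_at f L y x - site_vec y \<bullet> poly_op (truncated_hamiltonian \<theta> (cutoff h n) L x) p (site_vec y)\<bar> \<le> e"
      unfolding truncated_density_at_def
      by (rule close[OF self_adjoint_truncated_hamiltonian[OF x] interlayer.self_adjoint_truncated_hamiltonian[OF I(2) x] truncated_hamiltonian_diff[OF I]])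
  qed
qed

lemma poly_op_diag:
  assumes "bounded_disorder K x"
  shows "site_vec (i, 0) \<bullet> poly_op (hamiltonian \<theta> (cutoff h n) x) p (site_vec (i, 0)) = (\<Sum>k\<le>degree p. coeff p k * diag n k i x)"
  unfolding poly_op_def inner_sum_right inner_scaleR_right
  by (simp add: interlayer.amplitude_eq[OF interlayer_cutoff assms] disordered_chain.diag_amplitude_def[OF disordered_chain_cutoff])

lemma diag_poly:
  defines "N i \<equiv> shift_measure (site_period i) P0"
  shows "integrable (N i) (\<lambda>x. \<Sum>k\<le>degree p. coeff p k * diag n k i x)"
    and "(\<integral>x. (\<Sum>k\<le>degree p. coeff p k * diag n k i x) \<partial>N i) = (\<Sum>k\<le>degree p. coeff p k * limit_moment n k i)"
proof -
  note P = disordered_chain.period_def[OF disordered_chain_cutoff]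
  note dm = disordered_chain.diag_amplitude_shift_measure[OF disordered_chain_cutoff, unfolded P]
  show "integrable (N i) (\<lambda>x. \<Sum>k\<le>degree p. coeff p k * diag n k i x)"
    unfolding N_def by (intro Bochner_Integration.integrable_sum integrable_mult_right dm(2))
  show "(\<integral>x. (\<Sum>k\<le>degree p. coeff p k * diag n k i x) \<partial>N i) = (\<Sum>k\<le>degree p. coeff p k * limit_moment n k i)"
  proof -
    have "(\<integral>x. (\<Sum>k\<le>degree p. coeff p k * diag n k i x) \<partial>N i) = (\<Sum>k\<le>degree p. \<integral>x. coeff p k * diag n k i x \<partial>N i)"
      unfolding N_def by (rule Bochner_Integration.integral_sum) (intro integrable_mult_right dm(2))
    also have "\<dots> = (\<Sum>k\<le>degree p. coeff p k * limit_moment n k i)"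
      unfolding N_def by (simp only: integral_mult_right_zero dm(3))
    finally show ?thesis .
  qed
qed

text \<open>Where the disorder is bounded, the density is a uniform limit of finite combinations of
  diagonal amplitudes, which are measurable. This gives both measurability, in the completion, and
  an integrable majorant.\<close>

lemma integrable_density:
  assumes f: "continuous_on {-norm_bound..norm_bound} f"
  shows "integrable (shift_measure (site_period i) P0) (density_at f (i, 0))"
proof -
  let ?N = "shift_measure (site_period i) P0"
  interpret N: prob_space ?N by (rule prob_space_shift_measure)
  have "\<exists>q :: real poly \<times> nat. \<forall>x. bounded_disorder K x \<longrightarrow>
      \<bar>density_at f (i, 0) x - (\<Sum>k\<le>degree (fst q). coeff (fst q) k * diag (snd q) k i x)\<bar> \<le> 1 / real (Suc m)" for m
  proof -
    have e: "0 < 1 / real (Suc m)" by simp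
    show ?thesis
    proof (rule density_approximation[OF f e])
      fix p n
      assume pn: "\<And>x y. bounded_disorder K x \<Longrightarrow>
        \<bar>density_at f y x - site_vec y \<bullet> poly_op (hamiltonian \<theta> (cutoff h n) x) p (site_vec y)\<bar> \<le> 1 / real (Suc m)"
      show ?thesis
        unfolding split_paired_Ex fst_conv snd_conv
        by (intro exI[of _ p] exI[of _ n] allI impI, subst poly_op_diag[symmetric]) (assumption, rule pn)
    qed
  qed
  then have "\<exists>q :: nat \<Rightarrow> real poly \<times> nat. \<forall>m. \<forall>x. bounded_disorder K x \<longrightarrow>
      \<bar>density_at f (i, 0) x - (\<Sum>k\<le>degree (fst (q m)). coeff (fst (q m)) k * diag (snd (q m)) k i x)\<bar> \<le> 1 / real (Suc m)"
    by (intro choice allI)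
  then obtain q :: "nat \<Rightarrow> real poly \<times> nat" where pn: "\<And>m x. bounded_disorder K x \<Longrightarrow>
      \<bar>density_at f (i, 0) x - (\<Sum>k\<le>degree (fst (q m)). coeff (fst (q m)) k * diag (snd (q m)) k i x)\<bar> \<le> 1 / real (Suc m)"
    by blast
  define g where "g m x = (\<Sum>k\<le>degree (fst (q m)). coeff (fst (q m)) k * diag (snd (q m)) k i x)" for m x
  have g: "integrable ?N (g m)" for m unfolding g_def by (rule diag_poly)
  have lim: "(\<lambda>m. g m x) \<longlonglongrightarrow> density_at f (i, 0) x" if "bounded_disorder K x" for x
  proof -
    have "(\<lambda>m. g m x - density_at f (i, 0) x) \<longlonglongrightarrow> 0"
    proof (rule Lim_null_comparison[OF _ LIMSEQ_Suc[OF lim_1_over_n]])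
      show "\<forall>\<^sub>F m in sequentially. norm (g m x - density_at f (i, 0) x) \<le> 1 / real (Suc m)"
        using pn[OF that] by (auto simp: g_def abs_minus_commute)
    qed
    then show ?thesis by (simp add: Lim_null[symmetric])
  qed
  \<comment> \<open>The limit is taken with \<open>lim\<close>, which is measurable even where the
    sequence has no limit, and agrees with the density almost everywhere.\<close>
  have meas: "(\<lambda>x. lim (\<lambda>m. g m x)) \<in> borel_measurable ?N"
    using g by (intro borel_measurable_lim_metric) auto
  have dm: "density_at f (i, 0) \<in> borel_measurable ?N"
    unfolding shift_measure_def
  proof (rule measurable_completion_AE[OF meas[unfolded shift_measure_def]])
    show "AE x in completion (uniform_measure lborel {0..<site_period i} \<Otimes>\<^sub>M law.Pair2). lim (\<lambda>m. g m x) = density_at f (i, 0) x"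
      using AE_shift_bounded[of i, unfolded shift_measure_def] by eventually_elim (rule limI, rule lim)
  qed simp
  \<comment> \<open>The approximation with index 0 is within 1 of the density.\<close>
  have "integrable ?N (\<lambda>x. \<bar>g 0 x\<bar> + 1)"
    using g[of 0] by (intro Bochner_Integration.integrable_add integrable_abs) auto
  then show ?thesis
  proof (rule Bochner_Integration.integrable_bound[OF _ dm])
    show "AE x in ?N. norm (density_at f (i, 0) x) \<le> norm (\<bar>g 0 x\<bar> + 1)"
      using AE_shift_bounded[of i]
    proof eventually_elim
      case (elim x)
      then show ?case using pn[OF elim, of 0] by (simp add: g_def)
    qed
  qed
qed

text \<open>Three errors of \<open>e / 3\<close>: the truncated density against its polynomial, the
  polynomial average against its limit, and the limiting moments against the integral of the
  density. The first is uniform over sites and so survives averaging, since a layer has at most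
  \<open>card_Lambda\<close> sites.\<close>

lemma density_average:
  assumes f: "continuous_on {-norm_bound..norm_bound} f" and x: "generic x"
  shows "((\<lambda>L. (\<Sum>n\<in>layer_sites \<theta> (fst x) L i. truncated_density_at f L (i, n) x) / real (card_Lambda \<theta> (fst x) L))
    \<longlongrightarrow> layer_weight \<theta> i * (\<integral>x. density_at f (i, 0) x \<partial>shift_measure (site_period i) P0)) at_top"
proof (rule tendstoI)
  fix e :: real assume e: "0 < e"
  let ?N = "shift_measure (site_period i) P0"
  interpret N: prob_space ?N by (rule prob_space_shift_measure)
  have bx: "bounded_disorder K x" using x by (simp add: generic_def)
  have e3: "0 < e / 3" using e by simp
  define J where "J = (\<integral>x. density_at f (i, 0) x \<partial>?N)"
  obtain n p where pn:
    "\<And>x y. bounded_disorder K x \<Longrightarrow> \<bar>density_at f y x - site_vec y \<bullet> poly_op (hamiltonian \<theta> (cutoff h n) x) p (site_vec y)\<bar> \<le> e / 3"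
    "\<And>x y L. bounded_disorder K x \<Longrightarrow>
      \<bar>truncated_density_at f L y x - site_vec y \<bullet> poly_op (truncated_hamiltonian \<theta> (cutoff h n) L x) p (site_vec y)\<bar> \<le> e / 3"
    by (rule density_approximation[OF f e3]) (rule that)
  define m where "m = (\<Sum>k\<le>degree p. coeff p k * limit_moment n k i)"
  have mJ: "\<bar>m - J\<bar> \<le> e / 3"
  proof -
    let ?g = "\<lambda>x. \<Sum>k\<le>degree p. coeff p k * diag n k i x"
    have "m - J = (\<integral>x. ?g x - density_at f (i, 0) x \<partial>?N)"
      unfolding m_def J_def diag_poly(2)[symmetric]
      by (rule Bochner_Integration.integral_diff[symmetric, OF diag_poly(1) integrable_density[OF f]])
    then have "\<bar>m - J\<bar> = \<bar>\<integral>x. ?g x - density_at f (i, 0) x \<partial>?N\<bar>" by (rule arg_cong)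
    also have "\<dots> \<le> (\<integral>x. \<bar>?g x - density_at f (i, 0) x\<bar> \<partial>?N)" by (rule integral_abs_bound)
    also have "\<dots> \<le> (\<integral>x. e / 3 \<partial>?N)"
    proof (rule integral_mono_AE)
      show "integrable ?N (\<lambda>x. \<bar>?g x - density_at f (i, 0) x\<bar>)"
        by (intro integrable_abs Bochner_Integration.integrable_diff diag_poly integrable_density f)
      show "AE x in ?N. \<bar>?g x - density_at f (i, 0) x\<bar> \<le> e / 3"
        using AE_shift_bounded[of i]
      proof eventually_elim
        case (elim x)
        then show ?case using pn(1)[OF elim, of "(i, 0)"] by (simp add: poly_op_diag[OF elim] abs_minus_commute)
      qed
    qed simp
    finally show ?thesis by (simp add: N.prob_space)
  qed
  let ?A = "\<lambda>L. layer_sites \<theta> (fst x) L i" and ?c = "\<lambda>L. real (card_Lambda \<theta> (fst x) L)"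
  define T where "T L = (\<Sum>n\<in>?A L. truncated_density_at f L (i, n) x) / ?c L" for L
  define U where "U L = (\<Sum>j\<in>?A L. site_vec (i, j) \<bullet> poly_op (truncated_hamiltonian \<theta> (cutoff h n) L x) p (site_vec (i, j))) / ?c L" for L
  have w: "0 \<le> layer_weight \<theta> i" "layer_weight \<theta> i \<le> 1"
    using theta by (simp_all add: layer_weight_def)
  have "(U \<longlongrightarrow> layer_weight \<theta> i * m) at_top"
    unfolding U_def m_def
    by (rule disordered_chain.truncated_poly_average[OF disordered_chain_cutoff bx]) (use x in \<open>simp add: generic_def\<close>)
  then have "\<forall>\<^sub>F L in at_top. dist (U L) (layer_weight \<theta> i * m) < e / 3" using e by (intro tendstoD) auto
  then have "\<forall>\<^sub>F L in at_top. dist (T L) (layer_weight \<theta> i * J) < e"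
  proof eventually_elim
    case (elim L)
    have "\<bar>T L - U L\<bar> \<le> e / 3"
    proof -
      have "T L - U L = (\<Sum>j\<in>?A L. truncated_density_at f L (i, j) x
          - site_vec (i, j) \<bullet> poly_op (truncated_hamiltonian \<theta> (cutoff h n) L x) p (site_vec (i, j))) / ?c L"
        by (simp add: T_def U_def sum_subtractf diff_divide_distrib)
      then have "\<bar>T L - U L\<bar> = \<bar>\<Sum>j\<in>?A L. truncated_density_at f L (i, j) x
          - site_vec (i, j) \<bullet> poly_op (truncated_hamiltonian \<theta> (cutoff h n) L x) p (site_vec (i, j))\<bar> / ?c L"
        by simp
      also have "\<dots> \<le> (\<Sum>j\<in>?A L. e / 3) / ?c L"
        by (intro divide_right_mono order_trans[OF sum_abs] sum_mono pn(2) bx) simp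
      also have "\<dots> = real (card (?A L)) / ?c L * (e / 3)" by simp
      also have "\<dots> \<le> 1 * (e / 3)"
      proof (rule mult_right_mono)
        have "card (?A L) \<le> card_Lambda \<theta> (fst x) L" by (cases i) (simp_all add: card_Lambda_eq)
        then show "real (card (?A L)) / ?c L \<le> 1" by (auto simp: divide_le_eq_1)
      qed (use e in simp)
      finally show ?thesis by simp
    qed
    moreover have "\<bar>layer_weight \<theta> i * m - layer_weight \<theta> i * J\<bar> \<le> 1 * (e / 3)"
      unfolding right_diff_distrib[symmetric] abs_mult using w mJ by (intro mult_mono) auto
    ultimately show ?case using elim unfolding dist_real_def by linarith
  qed
  then show "\<forall>\<^sub>F L in at_top. dist ((\<Sum>n\<in>?A L. truncated_density_at f L (i, n) x) / ?c L)
      (layer_weight \<theta> i * (\<integral>x. density_at f (i, 0) x \<partial>?N)) < e"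
    by (simp only: T_def J_def)
qed

end

context random_chain
begin

lemma continuous_C0:
  assumes "g \<in> C0"
  shows "continuous_on {-norm_bound..norm_bound} (\<lambda>t. Re (g t))" "continuous_on {-norm_bound..norm_bound} (\<lambda>t. Im (g t))"
  using assms by (auto simp: C0_def intro!: continuous_intros intro: continuous_on_subset)

lemma cinner_fun_of_H_R:
  assumes "g \<in> C0" "bounded_disorder K x"
  shows "cinner (site_vec y) (fun_of_op g (H_R \<theta> h x) (site_vec y))
    = complex_of_real (density_at (\<lambda>t. Re (g t)) y x) + \<i> * complex_of_real (density_at (\<lambda>t. Im (g t)) y x)"
  unfolding H_R_eq[OF assms(2)] density_at_def
  by (rule self_adjoint_operator.cinner_fun_of_op[OF self_adjoint_hamiltonian[OF assms(2)] assms(1)])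

lemma cinner_fun_of_H_RL:
  assumes "g \<in> C0" "bounded_disorder K x"
  shows "cinner (site_vec y) (fun_of_op g (H_RL \<theta> h L x) (site_vec y))
    = complex_of_real (truncated_density_at (\<lambda>t. Re (g t)) L y x) + \<i> * complex_of_real (truncated_density_at (\<lambda>t. Im (g t)) L y x)"
  unfolding H_RL_eq[OF assms(2)] truncated_density_at_def
  by (rule self_adjoint_operator.cinner_fun_of_op[OF self_adjoint_truncated_hamiltonian[OF assms(2)] assms(1)])

text \<open>The formula in terms of densities holds for bounded disorder only, that is almost
  everywhere; completeness of \<open>shift_measure\<close> transfers measurability, and with it
  integrability, to the integrand as defined.\<close>

lemma integral_fun_of_H_R:
  fixes g :: "real \<Rightarrow> complex" and i :: bool
  assumes g: "g \<in> C0"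
  defines "N \<equiv> shift_measure (site_period i) P0"
  shows "integrable N (\<lambda>x. cinner (site_vec (i, 0)) (fun_of_op g (H_R \<theta> h x) (site_vec (i, 0))))"
    and "(\<integral>x. cinner (site_vec (i, 0)) (fun_of_op g (H_R \<theta> h x) (site_vec (i, 0))) \<partial>N)
      = complex_of_real (\<integral>x. density_at (\<lambda>t. Re (g t)) (i, 0) x \<partial>N)
        + \<i> * complex_of_real (\<integral>x. density_at (\<lambda>t. Im (g t)) (i, 0) x \<partial>N)"
proof -
  let ?F = "\<lambda>x. cinner (site_vec (i, 0)) (fun_of_op g (H_R \<theta> h x) (site_vec (i, 0)))"
  let ?a = "\<lambda>x. complex_of_real (density_at (\<lambda>t. Re (g t)) (i, 0) x)" and ?b = "\<lambda>x. \<i> * complex_of_real (density_at (\<lambda>t. Im (g t)) (i, 0) x)"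
  have int: "integrable N ?a" "integrable N ?b"
    unfolding N_def
    by (intro integrable_of_real integrable_mult_right integrable_density continuous_C0[OF g])+
  have G: "integrable N (\<lambda>x. ?a x + ?b x)" by (intro Bochner_Integration.integrable_add int)
  have eq: "AE x in N. ?a x + ?b x = ?F x"
    using AE_shift_bounded[of i] unfolding N_def[symmetric]
    by eventually_elim (rule cinner_fun_of_H_R[OF g, symmetric])
  have meas: "?F \<in> borel_measurable N"
    using borel_measurable_integrable[OF G] eq unfolding N_def shift_measure_def
    by (rule measurable_completion_AE) simp
  show "integrable N ?F"
    by (rule integrable_cong_AE_imp[OF G meas eq])
  have "(\<integral>x. ?F x \<partial>N) = (\<integral>x. ?a x + ?b x \<partial>N)"
    by (rule integral_cong_AE[OF meas borel_measurable_integrable[OF G] AE_symmetric[OF eq]])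
  also have "\<dots> = (\<integral>x. ?a x \<partial>N) + (\<integral>x. ?b x \<partial>N)"
    by (rule Bochner_Integration.integral_add[OF int])
  finally show "(\<integral>x. ?F x \<partial>N) = complex_of_real (\<integral>x. density_at (\<lambda>t. Re (g t)) (i, 0) x \<partial>N)
        + \<i> * complex_of_real (\<integral>x. density_at (\<lambda>t. Im (g t)) (i, 0) x \<partial>N)"
    by (simp only: integral_complex_of_real integral_mult_right_zero)
qed

lemma local_trace_average_limit:
  assumes g: "g \<in> C0" and x: "generic x"
  shows "(local_trace_average \<theta> h g x \<longlongrightarrow>
    complex_of_real (layer_weight \<theta> False)
      * (\<integral>x'. cinner (site_vec (False, 0)) (fun_of_op g (H_R \<theta> h x') (site_vec (False, 0))) \<partial>shift_measure (site_period False) P0)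
    + complex_of_real (layer_weight \<theta> True)
      * (\<integral>x'. cinner (site_vec (True, 0)) (fun_of_op g (H_R \<theta> h x') (site_vec (True, 0))) \<partial>shift_measure (site_period True) P0)) at_top"
proof -
  have bx: "bounded_disorder K x" using x by (simp add: generic_def)
  let ?A = "\<lambda>i L. layer_sites \<theta> (fst x) L i" and ?c = "\<lambda>L. real (card_Lambda \<theta> (fst x) L)"
  define a where "a f i L = (\<Sum>n\<in>?A i L. truncated_density_at f L (i, n) x) / ?c L" for f i L
  define J where "J f i = (\<integral>x. density_at f (i, 0) x \<partial>shift_measure (site_period i) P0)" for f i
  let ?re = "\<lambda>t. Re (g t)" and ?im = "\<lambda>t. Im (g t)"
  have lim: "(a f i \<longlongrightarrow> layer_weight \<theta> i * J f i) at_top" if "continuous_on {-norm_bound..norm_bound} f" for f i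
    unfolding a_def J_def by (rule density_average[OF that x])
  have layer: "(\<Sum>n\<in>?A i L. cinner (site_vec (i, n)) (fun_of_op g (H_RL \<theta> h L x) (site_vec (i, n)))) / of_nat (card_Lambda \<theta> (fst x) L)
      = complex_of_real (a ?re i L) + \<i> * complex_of_real (a ?im i L)" for i L
    unfolding cinner_fun_of_H_RL[OF g bx] a_def
    by (simp add: sum.distrib add_divide_distrib sum_distrib_left[symmetric])
  have avg: "local_trace_average \<theta> h g x L
      = (complex_of_real (a ?re False L) + \<i> * complex_of_real (a ?im False L)) + (complex_of_real (a ?re True L) + \<i> * complex_of_real (a ?im True L))" for L
    unfolding layer[symmetric] local_trace_average_def
    by (simp add: layer_sites_def site_vec_def add_divide_distrib)
  have "((\<lambda>L. (complex_of_real (a ?re False L) + \<i> * complex_of_real (a ?im False L)) + (complex_of_real (a ?re True L) + \<i> * complex_of_real (a ?im True L)))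
      \<longlongrightarrow> (complex_of_real (layer_weight \<theta> False * J ?re False) + \<i> * complex_of_real (layer_weight \<theta> False * J ?im False))
        + (complex_of_real (layer_weight \<theta> True * J ?re True) + \<i> * complex_of_real (layer_weight \<theta> True * J ?im True))) at_top"
    by (intro tendsto_add tendsto_mult tendsto_const tendsto_of_real lim continuous_C0[OF g])
  then show ?thesis
    unfolding avg[abs_def, symmetric] integral_fun_of_H_R(2)[OF g] J_def[symmetric]
    by (simp only: of_real_mult distrib_left mult.left_commute[of \<i>])
qed

end

theorem theorem3p22:
  fixes \<theta> :: real and h :: "real \<Rightarrow> real" and P0 :: "real measure" and \<epsilon> :: "real \<Rightarrow> real"
  assumes "0 < \<theta>" and "\<theta> < 1" and "\<theta> \<notin> \<rat>"
    and "\<forall>\<eta>. h (- \<eta>) = h \<eta>" and "smooth h" and "exponentially_decaying h"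
    and "prob_space P0" and "sets P0 = sets borel"
    and "\<exists>K. compact K \<and> (AE y in P0. y \<in> K)"
    and "(\<epsilon> \<longlongrightarrow> 0) at_top"
    and "AE x in parameter_measure P0. \<forall>L>0.
           trace_class (truncation_error \<theta> h L x)
           \<and> trace_norm (truncation_error \<theta> h L x) \<le> \<epsilon> L * real (card_Lambda \<theta> (fst x) L)"
  shows "(\<forall>g\<in>C0.
            integrable (shift_measure (1 - \<theta>) P0)
              (\<lambda>x. cinner (delta1 0) (fun_of_op g (H_R \<theta> h x) (delta1 0)))
            \<and> integrable (shift_measure 1 P0)
              (\<lambda>x. cinner (delta2 0) (fun_of_op g (H_R \<theta> h x) (delta2 0))))
       \<and> (AE x in parameter_measure P0. \<forall>g\<in>C0.
            (local_trace_average \<theta> h g x \<longlongrightarrow>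
               complex_of_real ((1 - \<theta>) / (1 + (1 - \<theta>)))
                 * (\<integral>x'. cinner (delta1 0) (fun_of_op g (H_R \<theta> h x') (delta1 0))
                       \<partial>shift_measure (1 - \<theta>) P0)
               + complex_of_real (1 / (1 + (1 - \<theta>)))
                 * (\<integral>x'. cinner (delta2 0) (fun_of_op g (H_R \<theta> h x') (delta2 0))
                       \<partial>shift_measure 1 P0)) at_top)"
proof -
  obtain C c where Cc: "0 < C" "0 < c" "\<And>\<eta>. \<bar>h \<eta>\<bar> \<le> C * exp (- c * \<bar>\<eta>\<bar>)"
    using \<open>exponentially_decaying h\<close> unfolding exponentially_decaying_def by blast
  obtain S D where SD: "interlayer_bound \<theta> h S" "\<And>n. interlayer_bound \<theta> (\<lambda>\<eta>. h \<eta> - cutoff h n \<eta>) (D n)" "D \<longlonglongrightarrow> 0"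
    using cutoff_bounds[OF less_imp_le[OF Cc(1)] Cc(2,3) \<open>\<theta> < 1\<close>] by blast
  obtain K' where K': "compact K'" "AE y in P0. y \<in> K'" using assms(9) by blast
  obtain K where K: "\<And>y. y \<in> K' \<Longrightarrow> \<bar>y\<bar> \<le> K"
    using compact_imp_bounded[OF K'(1)] by (auto simp: bounded_iff)
  have AE_K: "AE y in P0. \<bar>y\<bar> \<le> K" using K'(2) by eventually_elim (rule K)
  have "h field_differentiable at y" for y
    using \<open>smooth h\<close> by (auto simp: smooth_def dest: spec[of _ 0])
  then have cont: "continuous_on UNIV h"
    by (simp add: continuous_at_imp_continuous_on field_differentiable_imp_continuous_at)
  interpret random_chain \<theta> h S D P0 K
    by (intro random_chain.intro interlayer.intro random_chain_axioms.intro)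
      (use assms(1-4,7,8) SD AE_K cont in auto)
  have site: "site_vec (False, 0) = delta1 0" "site_vec (True, 0) = delta2 0"
    by (simp_all add: site_vec_def)
  have weight: "layer_weight \<theta> False = (1 - \<theta>) / (1 + (1 - \<theta>))" "layer_weight \<theta> True = 1 / (1 + (1 - \<theta>))"
    by (simp_all add: layer_weight_def)
  show ?thesis
  proof
    show "\<forall>g\<in>C0.
            integrable (shift_measure (1 - \<theta>) P0)
              (\<lambda>x. cinner (delta1 0) (fun_of_op g (H_R \<theta> h x) (delta1 0)))
            \<and> integrable (shift_measure 1 P0)
              (\<lambda>x. cinner (delta2 0) (fun_of_op g (H_R \<theta> h x) (delta2 0)))"
      using integral_fun_of_H_R(1)[where i = False] integral_fun_of_H_R(1)[where i = True]
      by (simp only: site if_True if_False) blast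
    show "AE x in parameter_measure P0. \<forall>g\<in>C0.
            (local_trace_average \<theta> h g x \<longlongrightarrow>
               complex_of_real ((1 - \<theta>) / (1 + (1 - \<theta>)))
                 * (\<integral>x'. cinner (delta1 0) (fun_of_op g (H_R \<theta> h x') (delta1 0))
                       \<partial>shift_measure (1 - \<theta>) P0)
               + complex_of_real (1 / (1 + (1 - \<theta>)))
                 * (\<integral>x'. cinner (delta2 0) (fun_of_op g (H_R \<theta> h x') (delta2 0))
                       \<partial>shift_measure 1 P0)) at_top"
      using AE_generic
    proof eventually_elim
      case (elim x)
      show ?case
        using local_trace_average_limit[OF _ elim] by (simp only: site weight if_True if_False) blast
    qed
  qed
qed

end
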